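(* Let $A\in\mathbb{R}^{n\times d}$, $b\in\mathbb{R}^n$, let $g:\mathbb{R}^d\to\mathbb{R}$ be convex and twice differentiable with constant psd Hessian $H^g$, and let $h:\mathbb{R}^d\to\mathbb{R}\cup\{+\infty\}$ be a closed proper convex function. Consider the problem \[ \text{minimize}_{x\in\mathbb{R}^d}\ \tfrac12\|Ax-b\|_2^2+g(x)+h(x), \] and assume it has a solution. Fix initial iterates $\tilde x^0,\tilde z^0,\tilde u^0\in\mathbb{R}^d$, a stepsize $\rho>0$, a summable sequence of tolerances $\{\varepsilon^k\}_{k\ge0}\subset(0,\infty)$, and $\delta\in(0,1)$. Let $H=A^{T}A+H^{g}$ and construct the randomized Nyström preconditioner $P$ of $H$ (with regularization $\rho$) from a $d\times s$ standard Gaussian test matrix with \[ s\geq 8\left(\sqrt{d_{\mathrm{eff}}(\rho)}+\sqrt{8\log(16/\delta)}\right)^{2}. \] Run NysADMM: for $k=0,1,2,\dots$, (i) let $r^k=\rho\tilde z^k-\rho\tilde u^k+A^{T}A\tilde x^k+H^{g}\tilde x^k-A^{T}(A\tilde x^k-b)-\nabla g(\tilde x^k)$, and let $\tilde x^{k+1}$ be the output of $T^k=4+\big\lceil 2\log\big(R/(\varepsilon^k\rho)\big)\big\rceil$ iterations of preconditioned conjugate gradients with preconditioner $P$ (started from $0$) on the system $(H+\rho I)x=r^k$; (ii) $\tilde z^{k+1}=\mathrm{argmin}_z\{h(z)+\frac{\rho}{2}\|\tilde x^{k+1}-z+\tilde u^k\|_2^2\}$; (iii) $\tilde u^{k+1}=\tilde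 u^k+\tilde x^{k+1}-\tilde z^{k+1}$. Assume $\|r^k\|_2\le R$ for all $k$, for some constant $R$. Then with probability at least $1-\delta$: 1. for all $k\ge0$, $\|\tilde x^{k+1}-x^{k+1}\|_2\le\varepsilon^k$, where $x^{k+1}$ is the exact solution of $(H+\rho I)x=r^k$; 2. as $k\to\infty$, $\tilde x^k$ converges to a solution of the primal problem above and $\rho\tilde u^k$ converges to a solution of its dual problem $\text{maximize}_{y}\ -\big(f^*(-y)+h^*(y)\big)$, where $f(x)=\tfrac12\|Ax-b\|_2^2+g(x)$ and $^*$ denotes the convex conjugate.
   Context: For symmetric psd $H$ and $\rho>0$, $d_{\mathrm{eff}}(\rho)=\mathrm{tr}\big(H(H+\rho I)^{-1}\big)$. Given $\Omega\in\mathbb{R}^{d\times s}$ with i.i.d. $N(0,1)$ entries, the Nyström approximation is $H\langle\Omega\rangle=(H\Omega)(\Omega^{T}H\Omega)^{\dagger}(H\Omega)^{T}=U\hat\Lambda U^{T}$ with $U\in\mathbb{R}^{d\times s}$ having orthonormal columns and $\hat\Lambda=\mathrm{diag}(\hat\lambda_1\ge\dots\ge\hat\lambda_s)$; the randomized Nyström preconditioner is $P=\frac{1}{\hat\lambda_s+\rho}U(\hat\Lambda+\rho I)U^{T}+(I-UU^{T})$. The preconditioner is built once and reused in every iteration. $\log$ is the natural logarithm. A sequence $\{\varepsilon^k\}$ of positive numbers is summable if $\sum_k\varepsilon^k<\infty$. *)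

theory Defs
  imports "HOL-Analysis.Analysis" "HOL-Probability.Probability"
begin

definition pinv :: "real^'s^'s \<Rightarrow> real^'s^'s" where
  "pinv M = (THE X. M ** X ** M = M \<and> X ** M ** X = X \<and>
                   transpose (M ** X) = M ** X \<and> transpose (X ** M) = X ** M)"

definition deff :: "real^'d^'d \<Rightarrow> real \<Rightarrow> real" where
  "deff H rho = trace (H ** matrix_inv (H + rho *\<^sub>R mat 1))"

definition nystrom :: "real^'d^'d \<Rightarrow> real^'s^'d \<Rightarrow> real^'d^'d" where
  "nystrom H Om = (H ** Om) ** pinv (transpose Om ** H ** Om) ** transpose (H ** Om)"

definition diagm :: "('s \<Rightarrow> real) \<Rightarrow> real^'s^'s" where
  "diagm lam = (\<chi> i j. if i = j then lam i else 0)"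

text \<open>Randomized Nystrom preconditioner built from U (orthonormal columns) and the
  Nystrom eigenvalues lam; lam_s is the smallest of them.\<close>
definition nys_precond :: "real^'s^'d \<Rightarrow> ('s::finite \<Rightarrow> real) \<Rightarrow> real \<Rightarrow> real^'d^'d" where
  "nys_precond U lam rho =
     (1 / (Min (range lam) + rho)) *\<^sub>R (U ** diagm (\<lambda>i. lam i + rho) ** transpose U)
     + (mat 1 - U ** transpose U)"

definition pcg_step :: "real^'d^'d \<Rightarrow> real^'d^'d \<Rightarrow>
    ((real^'d) \<times> (real^'d) \<times> (real^'d) \<times> (real^'d)) \<Rightarrow> ((real^'d) \<times> (real^'d) \<times> (real^'d) \<times> (real^'d))" where
  "pcg_step M Pinv st = (case st of (x, r, z, p) \<Rightarrow>
     let \<alpha> = (r \<bullet> z) / (p \<bullet> (M *v p));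
         x' = x + \<alpha> *\<^sub>R p;
         r' = r - \<alpha> *\<^sub>R (M *v p);
         z' = Pinv *v r';
         \<beta> = (r' \<bullet> z') / (r \<bullet> z);
         p' = z' + \<beta> *\<^sub>R p
     in (x', r', z', p'))"

definition pcg :: "real^'d^'d \<Rightarrow> real^'d^'d \<Rightarrow> real^'d \<Rightarrow> nat \<Rightarrow> real^'d" where
  "pcg M P rhs T =
     fst ((pcg_step M (matrix_inv P) ^^ T) (0, rhs, matrix_inv P *v rhs, matrix_inv P *v rhs))"

definition proper_fun :: "('a \<Rightarrow> ereal) \<Rightarrow> bool" where
  "proper_fun h \<longleftrightarrow> (\<forall>x. h x \<noteq> -\<infinity>) \<and> (\<exists>x. h x \<noteq> \<infinity>)"

definition epigraph :: "('a \<Rightarrow> ereal) \<Rightarrow> ('a \<times> real) set" where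
  "epigraph h = {(x, t). h x \<le> ereal t}"

definition convex_fun :: "('a::real_vector \<Rightarrow> ereal) \<Rightarrow> bool" where
  "convex_fun h \<longleftrightarrow> convex (epigraph h)"

definition closed_fun :: "('a::topological_space \<Rightarrow> ereal) \<Rightarrow> bool" where
  "closed_fun h \<longleftrightarrow> closed (epigraph h)"

definition fconj :: "('a::real_inner \<Rightarrow> ereal) \<Rightarrow> 'a \<Rightarrow> ereal" where
  "fconj phi y = (SUP x. ereal (y \<bullet> x) - phi x)"

definition fsmooth :: "real^'d^'n \<Rightarrow> real^'n \<Rightarrow> (real^'d \<Rightarrow> real) \<Rightarrow> real^'d \<Rightarrow> real" where
  "fsmooth A b g x = 1/2 * (norm (A *v x - b))^2 + g x"

definition primal_obj :: "real^'d^'n \<Rightarrow> real^'n \<Rightarrow> (real^'d \<Rightarrow> real) \<Rightarrow> (real^'d \<Rightarrow> ereal)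
    \<Rightarrow> real^'d \<Rightarrow> ereal" where
  "primal_obj A b g h x = ereal (fsmooth A b g x) + h x"

definition dual_obj :: "real^'d^'n \<Rightarrow> real^'n \<Rightarrow> (real^'d \<Rightarrow> real) \<Rightarrow> (real^'d \<Rightarrow> ereal)
    \<Rightarrow> real^'d \<Rightarrow> ereal" where
  "dual_obj A b g h y = - (fconj (\<lambda>x. ereal (fsmooth A b g x)) (- y) + fconj h y)"

definition is_primal_sol where
  "is_primal_sol A b g h x \<longleftrightarrow> (\<forall>x'. primal_obj A b g h x \<le> primal_obj A b g h x')"

definition is_dual_sol where
  "is_dual_sol A b g h y \<longleftrightarrow> (\<forall>y'. dual_obj A b g h y' \<le> dual_obj A b g h y)"

definition nys_rhs :: "real^'d^'n \<Rightarrow> real^'n \<Rightarrow> real^'d^'d \<Rightarrow> (real^'d \<Rightarrow> real^'d) \<Rightarrow> real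
    \<Rightarrow> real^'d \<Rightarrow> real^'d \<Rightarrow> real^'d \<Rightarrow> real^'d" where
  "nys_rhs A b Hg gradg rho x z u =
     rho *\<^sub>R z - rho *\<^sub>R u + (transpose A ** A) *v x + Hg *v x
     - transpose A *v (A *v x - b) - gradg x"

definition pcg_iters :: "real \<Rightarrow> real \<Rightarrow> real \<Rightarrow> nat" where
  "pcg_iters R e rho = nat (4 + \<lceil>2 * ln (R / (e * rho))\<rceil>)"

end

theory Submission
  imports Defs
begin

text \<open>
  Randomness enters only through one event: with H = B (transpose B), every w with (transpose Om) B w = 0
  satisfies |B w|^2 \<le> 14 rho |w|^2. Its probability is bounded by a PAC-Bayes argument. Averaging
  exp(-2 sum_j (y . om_j)^2), normalised to have mean 1, over y from a Gaussian prior with covariance proportional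
  to H(H + rho)^-1 gives a random variable that is rarely large, whereas recentring the prior at a null vector
  and applying Jensen's inequality bounds it from below. The effective dimension, being the trace of
  H(H + rho)^-1, is the price of the averaging.

  On that event N \<le> H \<le> N + 14 rho for the Nystrom approximation N, and the smallest retained eigenvalue
  of N is at most rho, whence rho P \<le> H + rho \<le> 16 rho P. For condition number 16 the Chebyshev bound gives
  preconditioned conjugate gradients the rate 3/5 < exp(-1/2), which matches the iteration count.

  Since the smooth part is quadratic, the linearised x-update is the exact ADMM update up to the conjugate
  gradient error. In the variable z + u the iteration is a firmly nonexpansive map perturbed by summable
  errors, so it converges to a point satisfying the optimality conditions of both problems.
\<close>

section \<open>Symmetric matrices\<close>

text \<open>The constants are set backwards from the iteration count. \<open>pcg_iters\<close> pays
  for a contraction by exp(-1/2) per step, and (sqrt k - 1)/(sqrt k + 1) stays below that for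
  condition numbers k up to about 16.6, so 16 is affordable. Of this, 2 goes to the part kept by the
  preconditioner, where \<open>Min (range lam) + rho\<close> is at most 2 rho, and 14 remains for
  what the approximation drops. The obstacle is uniformity: the null space of
  \<open>transpose Om\<close> is random, so all directions must be handled at once, and a net on the
  sphere would cost the full dimension d. Averaging over a prior costs only a trace. With s = 8
  d_eff and the weight 2 in the exponent, a null vector v with v and C v of about unit length gains
  (ln 5)/2 > 0.80 per column, while the trace term and the shift of the prior together cost about
  0.71 per column at the best variance. The slack pays for the failure probability and for the 15/14
  in \<open>null_space_bound\<close>.\<close>

lemma inner_matrix_transpose:
  fixes A :: "real^'n^'m"
  shows "x \<bullet> (A *v y) = (transpose A *v x) \<bullet> y"
  by (simp add: dot_lmul_matrix)

text \<open>As a simp rule it would turn \<open>transpose A *v x\<close> into \<open>x v* A\<close>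
  and destroy the adjoint form that \<open>inner_matrix_transpose\<close> produces.\<close>

declare transpose_matrix_vector [simp del]

text \<open>A maximiser x of the Rayleigh quotient on the unit sphere of V works: the form
  \<open>q\<close> is nonnegative on V and vanishes at x, so its first variation along the defect
  \<open>w\<close>, which lies in V by invariance, must vanish too.\<close>

lemma symmetric_has_eigenvector_in_subspace:
  fixes A :: "real^'n^'n"
  assumes sym: "transpose A = A" and V: "subspace V" and inv: "\<And>x. x \<in> V \<Longrightarrow> A *v x \<in> V"
    and nz: "V \<noteq> {0}"
  shows "\<exists>x l. x \<in> V \<and> norm x = 1 \<and> A *v x = l *\<^sub>R x"
proof -
  have symm: "a \<bullet> (A *v c) = c \<bullet> (A *v a)" for a c
    by (metis inner_matrix_transpose sym inner_commute)
  let ?S = "sphere 0 1 \<inter> V"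
  have "compact ?S" by (intro compact_Int_closed closed_subspace V) auto
  moreover obtain y where "y \<in> V" "y \<noteq> 0" using nz V subspace_0 by blast
  then have "y /\<^sub>R norm y \<in> ?S" using V by (auto simp: subspace_scale)
  then have "?S \<noteq> {}" by blast
  moreover have "continuous_on ?S (\<lambda>x. x \<bullet> (A *v x))"
    by (intro continuous_intros matrix_vector_mult_linear_continuous_on)
  ultimately have "\<exists>x\<in>?S. \<forall>y\<in>?S. y \<bullet> (A *v y) \<le> x \<bullet> (A *v x)"
    by (rule continuous_attains_sup)
  then obtain x where x: "x \<in> ?S" and mx: "\<And>y. y \<in> ?S \<Longrightarrow> y \<bullet> (A *v y) \<le> x \<bullet> (A *v x)"
    by blast
  define l where "l = x \<bullet> (A *v x)"
  have xV: "x \<in> V" and nx: "norm x = 1" using x by auto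
  define q where "q v = l * (v \<bullet> v) - v \<bullet> (A *v v)" for v
  have qnn: "q v \<ge> 0" if "v \<in> V" for v
  proof (cases "v = 0")
    case False
    then have "v /\<^sub>R norm v \<in> ?S" using that V by (auto simp: subspace_scale)
    from mx[OF this] have "(v \<bullet> (A *v v)) / (norm v)\<^sup>2 \<le> l"
      by (simp add: l_def matrix_vector_mult_scaleR power2_eq_square divide_simps)
    then show ?thesis using False by (simp add: q_def divide_simps power2_norm_eq_inner)
  qed (simp add: q_def)
  define w where "w = A *v x - l *\<^sub>R x"
  have wV: "w \<in> V" unfolding w_def by (intro subspace_diff V inv xV subspace_scale)
  have qx: "q x = 0" using nx by (simp add: q_def l_def dot_square_norm)
  have exp: "q (x + t *\<^sub>R w) = t\<^sup>2 * q w - 2 * t * (w \<bullet> w)" for t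
  proof -
    have "q (x + t *\<^sub>R w) = q x + t\<^sup>2 * q w + 2 * t * (l * (x \<bullet> w) - w \<bullet> (A *v x))"
      unfolding q_def using symm[of x w]
      by (simp add: inner_simps matrix_vector_right_distrib matrix_vector_mult_scaleR algebra_simps power2_eq_square inner_commute)
    moreover have "w \<bullet> w = w \<bullet> (A *v x) - l * (w \<bullet> x)"
      by (metis w_def inner_diff_right inner_scaleR_right)
    then have "l * (x \<bullet> w) - w \<bullet> (A *v x) = - (w \<bullet> w)" by (simp add: inner_commute)
    ultimately show ?thesis using qx by simp
  qed
  have "w = 0"
  proof (rule ccontr)
    assume "w \<noteq> 0"
    then have ww: "w \<bullet> w > 0" by simp
    \<comment> \<open>This step keeps the second-order cost \<open>t * q w\<close> below
      \<open>w \<bullet> w\<close>, half of the first-order gain; the 1 guards against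
      \<open>q w = 0\<close>.\<close>
    define t where "t = (w \<bullet> w) / (q w + 1)"
    have qw: "q w \<ge> 0" using qnn wV by blast
    then have t: "t > 0" using ww by (simp add: t_def)
    have "t * q w \<le> w \<bullet> w" using ww qw by (simp add: t_def divide_simps)
    then have "t * q w - 2 * (w \<bullet> w) < 0" using ww by linarith
    then have "t * (t * q w - 2 * (w \<bullet> w)) < 0" using t by (intro mult_pos_neg)
    moreover have "q (x + t *\<^sub>R w) \<ge> 0" by (intro qnn subspace_add V xV subspace_scale wV)
    ultimately show False unfolding exp by (simp add: power2_eq_square algebra_simps)
  qed
  then show ?thesis using xV nx w_def by (metis eq_iff_diff_eq_0)
qed

text \<open>Stated for invariant subspaces because the induction passes to the complement of one
  eigenvector inside V, which symmetry keeps invariant.\<close>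

lemma symmetric_orthonormal_eigenvectors:
  fixes A :: "real^'n^'n"
  assumes sym: "transpose A = A" and "subspace V" and "\<And>x. x \<in> V \<Longrightarrow> A *v x \<in> V"
  shows "\<exists>B\<subseteq>V. finite B \<and> card B = dim V \<and> pairwise orthogonal B \<and> (\<forall>x\<in>B. norm x = 1 \<and> (\<exists>l. A *v x = l *\<^sub>R x))"
  using assms(2,3)
proof (induction "dim V" arbitrary: V)
  case 0
  then show ?case by (intro exI[of _ "{}"]) auto
next
  case (Suc k)
  have "V \<noteq> {0}" using Suc.hyps(2) by auto
  then obtain x l where x: "x \<in> V" "norm x = 1" "A *v x = l *\<^sub>R x"
    using symmetric_has_eigenvector_in_subspace[OF sym Suc.prems] by blast
  define W where "W = {y\<in>V. \<forall>z\<in>span {x}. orthogonal z y}"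
  have "span {x} \<subseteq> V" using x Suc.prems by (simp add: span_minimal)
  then have "dim W + dim (span {x}) = dim V"
    unfolding W_def by (intro dim_subspace_orthogonal_to_vectors Suc.prems) auto
  moreover have "dim (span {x}) = 1" using x by (auto simp: dim_singleton)
  ultimately have k: "k = dim W" using Suc.hyps(2) by simp
  have Wx: "W = {y\<in>V. x \<bullet> y = 0}"
    unfolding W_def by (auto simp: span_singleton orthogonal_def)
  have sW: "subspace W" unfolding Wx subspace_def using Suc.prems(1)
    by (auto simp: subspace_0 subspace_add subspace_scale inner_simps)
  have "A *v y \<in> W" if "y \<in> W" for y
    using that Suc.prems(2) x(3) unfolding Wx by (simp add: inner_matrix_transpose sym)
  from Suc.hyps(1)[OF k sW this] obtain B where B: "B \<subseteq> W" "finite B" "card B = dim W"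
    "pairwise orthogonal B" "\<forall>x\<in>B. norm x = 1 \<and> (\<exists>l. A *v x = l *\<^sub>R x)" by blast
  have "x \<notin> B" using B(1) x(2) unfolding Wx by (auto simp: dot_square_norm)
  then show ?case using B x k Suc.hyps(2) unfolding Wx
    by (intro exI[of _ "insert x B"]) (auto simp: pairwise_insert orthogonal_def inner_commute)
qed

theorem symmetric_diagonalizable:
  fixes A :: "real^'n^'n"
  assumes sym: "transpose A = A"
  obtains Q l where "orthogonal_matrix Q" "A = Q ** diagm l ** transpose Q"
proof -
  obtain B where B: "finite B" "card B = CARD('n)" "pairwise orthogonal B"
     "\<And>x. x \<in> B \<Longrightarrow> norm x = 1 \<and> (\<exists>l. A *v x = l *\<^sub>R x)"
    using symmetric_orthonormal_eigenvectors[OF sym, of UNIV] by (auto simp: dim_UNIV)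
  obtain f where f: "bij_betw f (UNIV::'n set) B"
    using B(1,2) by (metis finite_same_card_bij finite)
  then have fB: "f j \<in> B" for j by (auto simp: bij_betw_def)
  obtain l where l: "\<And>j. A *v f j = l j *\<^sub>R f j" using B(4)[OF fB] by metis
  define Q :: "real^'n^'n" where "Q = (\<chi> i j. f j $ i)"
  have ff: "f i \<bullet> f j = (if i = j then 1 else 0)" for i j
  proof (cases "i = j")
    case False
    then have "f i \<noteq> f j" using f by (auto simp: bij_betw_def inj_on_def)
    then show ?thesis using False B(3) fB unfolding pairwise_def orthogonal_def by auto
  qed (use B(4)[OF fB] in \<open>simp add: dot_square_norm\<close>)
  have QQ: "transpose Q ** Q = mat 1"
    using ff by (simp add: matrix_matrix_mult_def transpose_def Q_def vec_eq_iff inner_vec_def mat_def)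
  then have oQ: "orthogonal_matrix Q" by (simp add: orthogonal_matrix)
  have "(\<Sum>k\<in>UNIV. A $ i $ k * f j $ k) = l j * f j $ i" for i j
    using arg_cong[OF l[of j], of "\<lambda>v. v $ i"] by (simp add: matrix_vector_mult_def)
  then have AQ: "A ** Q = Q ** diagm l"
    by (simp add: matrix_matrix_mult_def vec_eq_iff Q_def diagm_def if_distrib sum.delta mult.commute cong: if_cong)
  have "A = A ** (Q ** transpose Q)" using oQ by (simp add: orthogonal_matrix_def)
  also have "\<dots> = Q ** diagm l ** transpose Q" by (simp add: matrix_mul_assoc AQ)
  finally show thesis using that oQ by blast
qed

section \<open>Diagonal matrices, congruences and inverses\<close>

lemma diagm_mult_vec: "diagm l *v y = (\<chi> i. l i * y $ i)"
  by (simp add: diagm_def matrix_vector_mult_def vec_eq_iff mult_delta_left)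

lemma diagm_mult_diagm: "diagm f ** diagm g = diagm (\<lambda>i. f i * g i)"
  by (simp add: diagm_def matrix_matrix_mult_def vec_eq_iff mult_delta_left)

lemma transpose_diagm [simp]: "transpose (diagm f) = diagm f"
  by (auto simp: diagm_def transpose_def vec_eq_iff)

lemma diagm_one [simp]: "diagm (\<lambda>i. 1) = mat 1"
  by (simp add: diagm_def mat_def)

lemma inner_diagm: "y \<bullet> (diagm l *v y) = (\<Sum>i\<in>UNIV. l i * (y $ i)\<^sup>2)"
  by (simp add: diagm_mult_vec inner_vec_def power2_eq_square algebra_simps)

lemma inner_diagm_axis: "axis i 1 \<bullet> (diagm l *v axis i 1) = l i"
  by (simp add: inner_axis' diagm_mult_vec)

lemma inner_congruence:
  fixes G :: "real^'m^'n" and A :: "real^'n^'n"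
  shows "(G *v y) \<bullet> (A *v (G *v y)) = y \<bullet> ((transpose G ** A ** G) *v y)"
  unfolding matrix_vector_mul_assoc[symmetric] using inner_matrix_transpose[of y "transpose G" "A *v (G *v y)"] by simp

lemma matrix_inv_eqI:
  fixes A B :: "real^'n^'n"
  assumes "A ** B = mat 1"
  shows "matrix_inv A = B"
proof -
  have BA: "B ** A = mat 1" using assms by (rule matrix_left_right_inverse[THEN iffD1])
  have "A ** matrix_inv A = mat 1 \<and> matrix_inv A ** A = mat 1"
    unfolding matrix_inv_def by (rule someI[of _ B]) (simp add: assms BA)
  then have "matrix_inv A ** A = mat 1" ..
  then have "matrix_inv A ** (A ** B) = B" by (simp add: matrix_mul_assoc)
  then show ?thesis by (simp add: assms)
qed

lemma posdef_invertible:
  fixes A :: "real^'n^'n"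
  assumes "\<And>v. v \<noteq> 0 \<Longrightarrow> v \<bullet> (A *v v) > 0"
  shows "invertible A"
proof -
  have "A *v v = 0 \<Longrightarrow> v = 0" for v using assms[of v] by fastforce
  then show ?thesis using matrix_left_invertible_ker[of A] invertible_left_inverse by blast
qed

text \<open>Whitening by \<open>S\<close> turns P into the identity, and a rotation \<open>V\<close>
  then diagonalises A without disturbing it. The \<open>mu\<close> are the eigenvalues of the
  preconditioned matrix, which is not symmetric itself; its eigenvectors are the columns of
  \<open>G\<close>.\<close>

lemma simultaneous_diagonalization:
  fixes P A :: "real^'n^'n"
  assumes Ps: "transpose P = P" and Ppos: "\<And>v. v \<noteq> 0 \<Longrightarrow> v \<bullet> (P *v v) > 0" and As: "transpose A = A"
  obtains G :: "real^'n^'n" and mu where "transpose G ** P ** G = mat 1" "transpose G ** A ** G = diagm mu" "matrix_inv P = G ** transpose G" "invertible G"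
proof -
  obtain Q l where Q: "orthogonal_matrix Q" and P: "P = Q ** diagm l ** transpose Q"
    using symmetric_diagonalizable[OF Ps] .
  have QQ: "transpose Q ** Q = mat 1" "Q ** transpose Q = mat 1" using Q by (auto simp: orthogonal_matrix_def)
  have l: "l i > 0" for i
  proof -
    have "Q *v axis i 1 \<noteq> 0"
    proof
      assume "Q *v axis i 1 = 0"
      then have "(transpose Q ** Q) *v axis i 1 = 0" by (simp add: matrix_vector_mul_assoc[symmetric])
      then show False by (simp add: QQ)
    qed
    from Ppos[OF this] have "axis i 1 \<bullet> ((transpose Q ** P ** Q) *v axis i 1) > 0" by (simp add: inner_congruence)
    also have "transpose Q ** P ** Q = (transpose Q ** Q) ** diagm l ** (transpose Q ** Q)"
      by (simp add: P matrix_mul_assoc)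
    finally show ?thesis by (simp add: QQ inner_diagm_axis)
  qed
  define S where "S = Q ** diagm (\<lambda>i. 1 / sqrt (l i))"
  have tS: "transpose S = diagm (\<lambda>i. 1 / sqrt (l i)) ** transpose Q"
    by (simp add: S_def matrix_transpose_mul)
  obtain V mu where V: "orthogonal_matrix V" and K: "transpose S ** A ** S = V ** diagm mu ** transpose V"
    using symmetric_diagonalizable[of "transpose S ** A ** S"] As by (auto simp: matrix_transpose_mul matrix_mul_assoc)
  have VV: "transpose V ** V = mat 1" "V ** transpose V = mat 1" using V by (auto simp: orthogonal_matrix_def)
  have SPS: "transpose S ** P ** S = mat 1"
  proof -
    have "transpose S ** P ** S = diagm (\<lambda>i. 1 / sqrt (l i)) ** (transpose Q ** Q) ** diagm l ** (transpose Q ** Q) ** diagm (\<lambda>i. 1 / sqrt (l i))"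
      unfolding tS unfolding S_def P by (simp only: matrix_mul_assoc)
    also have "\<dots> = mat 1"
      using l by (simp add: QQ diagm_mult_diagm less_imp_le less_imp_neq[THEN not_sym])
    finally show ?thesis .
  qed
  define G where "G = S ** V"
  have tG: "transpose G = transpose V ** transpose S" by (simp add: G_def matrix_transpose_mul)
  have "transpose G ** P ** G = transpose V ** (transpose S ** P ** S) ** V"
    unfolding tG unfolding G_def by (simp only: matrix_mul_assoc)
  then have GP: "transpose G ** P ** G = mat 1" by (simp add: SPS VV)
  have "transpose G ** A ** G = transpose V ** (transpose S ** A ** S) ** V"
    unfolding tG unfolding G_def by (simp only: matrix_mul_assoc)
  also have "\<dots> = (transpose V ** V) ** diagm mu ** (transpose V ** V)" by (simp add: K matrix_mul_assoc)
  finally have GA: "transpose G ** A ** G = diagm mu" by (simp add: VV)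
  have left: "(transpose G ** P) ** G = mat 1" by (rule GP)
  then have "G ** (transpose G ** P) = mat 1" by (rule matrix_left_right_inverse[THEN iffD1])
  then have "(G ** transpose G) ** P = mat 1" by (simp add: matrix_mul_assoc)
  then have "P ** (G ** transpose G) = mat 1" by (rule matrix_left_right_inverse[THEN iffD1])
  moreover have "invertible G" using left by (auto simp: invertible_left_inverse)
  ultimately show thesis using that GP GA matrix_inv_eqI by blast
qed

lemma matrix_inv_mult:
  fixes A :: "real^'n^'n"
  assumes "invertible A"
  shows "A ** matrix_inv A = mat 1" "matrix_inv A ** A = mat 1"
proof -
  obtain B where "A ** B = mat 1 \<and> B ** A = mat 1" using assms by (auto simp: invertible_def)
  then have "A ** matrix_inv A = mat 1 \<and> matrix_inv A ** A = mat 1"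
    unfolding matrix_inv_def by (rule someI)
  then show "A ** matrix_inv A = mat 1" "matrix_inv A ** A = mat 1" by auto
qed

section \<open>Preconditioned conjugate gradients\<close>

text \<open>The state tuples of \<open>pcg_step\<close>, unfolded into four sequences. The quotients
  are unguarded: once the residual is 0 the numerator of the step length is 0 and the iterates stay
  put.\<close>

locale pcg_iteration =
  fixes A B :: "real^'n^'n" and b :: "real^'n" and x r z p :: "nat \<Rightarrow> real^'n"
  assumes A_sym: "transpose A = A" and B_sym: "transpose B = B"
    and A_pos: "\<And>v. v \<noteq> 0 \<Longrightarrow> v \<bullet> (A *v v) > 0" and B_pos: "\<And>v. v \<noteq> 0 \<Longrightarrow> v \<bullet> (B *v v) > 0"
    and init: "x 0 = 0" "r 0 = b" "p 0 = z 0" and z: "\<And>k. z k = B *v r k"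
    and x_Suc: "\<And>k. x (Suc k) = x k + ((r k \<bullet> z k) / (p k \<bullet> (A *v p k))) *\<^sub>R p k"
    and r_Suc: "\<And>k. r (Suc k) = r k - ((r k \<bullet> z k) / (p k \<bullet> (A *v p k))) *\<^sub>R (A *v p k)"
    and p_Suc: "\<And>k. p (Suc k) = z (Suc k) + ((r (Suc k) \<bullet> z (Suc k)) / (r k \<bullet> z k)) *\<^sub>R p k"
begin

lemma residual: "r k = b - A *v x k"
  by (induction k) (auto simp: init x_Suc r_Suc matrix_vector_right_distrib matrix_vector_mult_scaleR)

lemma residual_zero_stays: "r k = 0 \<Longrightarrow> r (k + j) = 0"
  by (induction j) (auto simp: r_Suc)

lemma rz_commute: "r i \<bullet> z j = z i \<bullet> r j"
  by (metis z B_sym inner_matrix_transpose)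

text \<open>The claims feed each other: residuals orthogonal to directions are orthogonal to earlier
  \<open>z\<close>, this gives conjugacy of the directions, and the last identity makes the step
  length an exact line search. Nonzero earlier residuals keep all divisors positive.\<close>

lemma orthogonality:
  assumes "\<And>j. j < k \<Longrightarrow> r j \<noteq> 0"
  shows "(\<forall>i<k. r k \<bullet> p i = 0) \<and> (\<forall>i<k. p k \<bullet> (A *v p i) = 0) \<and> r k \<bullet> p k = r k \<bullet> z k"
  using assms
proof (induction k rule: less_induct)
  case (less k)
  show ?case
  proof (cases k)
    case 0
    then show ?thesis by (simp add: init)
  next
    case (Suc k')
    define al where "al i = (r i \<bullet> z i) / (p i \<bullet> (A *v p i))" for i
    have IH: "(\<forall>i<j. r j \<bullet> p i = 0) \<and> (\<forall>i<j. p j \<bullet> (A *v p i) = 0) \<and> r j \<bullet> p j = r j \<bullet> z j" if "j \<le> k'" for j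
      using less that Suc by auto
    have rz: "r i \<bullet> z i > 0" if "i \<le> k'" for i using less.prems[of i] B_pos[of "r i"] that Suc by (simp add: z)
    have pAp: "p i \<bullet> (A *v p i) > 0" if "i \<le> k'" for i
    proof -
      have "p i \<noteq> 0" using IH[OF that] rz[OF that] by auto
      then show ?thesis by (rule A_pos)
    qed
    have al: "al i > 0" if "i \<le> k'" for i using rz pAp that by (simp add: al_def)
    have rS: "r (Suc i) = r i - al i *\<^sub>R (A *v p i)" for i by (simp add: r_Suc al_def)
    have sy: "u \<bullet> (A *v v) = v \<bullet> (A *v u)" for u v by (metis A_sym inner_matrix_transpose inner_commute)
    have rp: "r k \<bullet> p i = 0" if "i < k" for i
    proof (cases "i = k'")
      case True
      then show ?thesis using IH[of k'] pAp[of k'] unfolding Suc rS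
        by (simp add: inner_simps al_def inner_commute[of "A *v p k'"])
    next
      case False
      then have "i < k'" using that Suc by simp
      then show ?thesis using IH[of k'] sy[of "p i" "p k'"] unfolding Suc rS by (simp add: inner_simps inner_commute[of "A *v p k'"])
    qed
    have rzz: "r k \<bullet> z i = 0" if "i < k" for i
    proof (cases i)
      case 0
      then show ?thesis using rp[of 0] that by (simp add: init)
    next
      case (Suc i')
      have "r k \<bullet> z (Suc i') = r k \<bullet> p (Suc i') - ((r (Suc i') \<bullet> z (Suc i')) / (r i' \<bullet> z i')) * (r k \<bullet> p i')"
        by (simp add: p_Suc inner_simps)
      then show ?thesis using rp[of i] rp[of i'] that unfolding Suc by simp
    qed
    \<comment> \<open>The residual recurrence expresses \<open>A *v p i\<close> through two
      residuals. Only \<open>i = k'\<close> leaves a nonzero term, and the coefficient of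
      \<open>p k'\<close> in \<open>p k\<close> is made to cancel it.\<close>
    have zAp: "z k \<bullet> (A *v p i) = (z k \<bullet> r i - z k \<bullet> r (Suc i)) / al i" if "i \<le> k'" for i
      using al[OF that] unfolding rS by (simp add: inner_simps)
    have pA: "p k \<bullet> (A *v p i) = 0" if "i < k" for i
    proof -
      have ik: "i \<le> k'" using that Suc by simp
      have pk: "p k = z k + ((r k \<bullet> z k) / (r k' \<bullet> z k')) *\<^sub>R p k'" unfolding Suc by (rule p_Suc)
      show ?thesis
      proof (cases "i = k'")
        case True
        have "z k \<bullet> (A *v p k') = - (r k \<bullet> z k) / al k'"
          using zAp[of k'] rzz[of k'] Suc by (simp add: rz_commute[symmetric])
        then show ?thesis using rz[of k'] pAp[of k'] unfolding True pk by (simp add: inner_simps al_def)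
      next
        case False
        then have "i < k'" using ik by simp
        then have "z k \<bullet> (A *v p i) = 0" "p k' \<bullet> (A *v p i) = 0"
          using zAp[OF ik] rzz[of i] rzz[of "Suc i"] Suc IH[of k'] by (simp_all add: rz_commute[symmetric])
        then show ?thesis unfolding pk by (simp add: inner_simps)
      qed
    qed
    have "r k \<bullet> p k = r k \<bullet> z k" using rp[of k'] unfolding Suc p_Suc by (simp add: inner_simps)
    then show ?thesis using rp pA by blast
  qed
qed

text \<open>Before breakdown this is the Krylov space of the preconditioned matrix; directions
  replace matrix powers because orthogonality is known for them.\<close>

definition dirspan :: "nat \<Rightarrow> (real^'n) set" where "dirspan k = span (p ` {..<k})"

lemma dirspan_mono: "v \<in> dirspan k \<Longrightarrow> k \<le> m \<Longrightarrow> v \<in> dirspan m"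
  unfolding dirspan_def using span_mono[OF image_mono, of "{..<k}" "{..<m}" p] by (simp add: subset_iff)

lemma p_in_dirspan: "k < m \<Longrightarrow> p k \<in> dirspan m"
  unfolding dirspan_def by (rule span_base) simp

lemma z_in_dirspan: "k < m \<Longrightarrow> z k \<in> dirspan m"
proof (cases k)
  case (Suc i)
  assume "k < m"
  then have "p (Suc i) - ((r (Suc i) \<bullet> z (Suc i)) / (r i \<bullet> z i)) *\<^sub>R p i \<in> dirspan m"
    using p_in_dirspan[of "Suc i" m] p_in_dirspan[of i m] Suc unfolding dirspan_def by (intro span_diff span_scale) auto
  then show ?thesis using Suc by (simp add: p_Suc)
qed (use p_in_dirspan[of 0 m] in \<open>simp add: init\<close>)

lemma x_in_dirspan: "x k \<in> dirspan k"
proof (induction k)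
  case (Suc k)
  then show ?case using dirspan_mono[OF Suc, of "Suc k"] p_in_dirspan[of k "Suc k"] unfolding x_Suc dirspan_def
    by (intro span_add span_scale) auto
qed (simp add: init dirspan_def)

text \<open>The residual is orthogonal to \<open>dirspan k\<close>, so Pythagoras in the A-inner
  product makes \<open>x k\<close> the closest point of that space to the solution.\<close>

lemma optimality:
  assumes nz: "\<And>j. j < k \<Longrightarrow> r j \<noteq> 0" and sol: "A *v xs = b" and y: "y \<in> dirspan k"
  shows "(xs - x k) \<bullet> (A *v (xs - x k)) \<le> (xs - y) \<bullet> (A *v (xs - y))"
proof -
  have r: "A *v (xs - x k) = r k" by (simp add: residual sol matrix_vector_mult_diff_distrib)
  have rp: "\<forall>i<k. r k \<bullet> p i = 0" using orthogonality[of k] nz by blast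
  have orth: "r k \<bullet> v = 0" if "v \<in> dirspan k" for v
    using that unfolding dirspan_def by (induction rule: span_induct_alt) (auto simp: inner_simps rp)
  define d where "d = x k - y"
  have "d \<in> dirspan k" using x_in_dirspan y unfolding d_def dirspan_def by (rule span_diff)
  then have rd: "r k \<bullet> d = 0" by (rule orth)
  have nn: "d \<bullet> (A *v d) \<ge> 0" using A_pos[of d] by (cases "d = 0") auto
  have e: "xs - y = (xs - x k) + d" by (simp add: d_def)
  have "(xs - x k) \<bullet> (A *v d) = 0" using rd r by (metis A_sym inner_matrix_transpose)
  then show ?thesis unfolding e using nn rd
    by (simp add: matrix_vector_right_distrib inner_simps r inner_commute)
qed

text \<open>Krylov growth: \<open>B *v (A *v p i)\<close> is a multiple of
  \<open>z i - z (Suc i)\<close>. It lets a three-term polynomial recurrence run inside these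
  spaces.\<close>

lemma BA_dirspan:
  assumes nz: "\<And>j. j < k \<Longrightarrow> r j \<noteq> 0" and y: "y \<in> dirspan k"
  shows "B *v (A *v y) \<in> dirspan (Suc k)"
  using y unfolding dirspan_def[of k]
proof (induction rule: span_induct_alt)
  case base
  then show ?case by (simp add: dirspan_def span_zero)
next
  case (step c v w)
  then obtain i where i: "i < k" "v = p i" by auto
  define al where "al = (r i \<bullet> z i) / (p i \<bullet> (A *v p i))"
  have ri: "r i \<noteq> 0" using nz i by blast
  then have rz: "r i \<bullet> z i > 0" using B_pos by (simp add: z)
  have "r i \<bullet> p i = r i \<bullet> z i" using orthogonality[of i] nz i by auto
  then have "p i \<noteq> 0" using rz by auto
  then have al: "al \<noteq> 0" using rz A_pos[of "p i"] by (simp add: al_def)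
  have "z (Suc i) = z i - al *\<^sub>R (B *v (A *v p i))"
    by (simp add: z r_Suc al_def matrix_vector_mult_diff_distrib matrix_vector_mult_scaleR)
  then have "B *v (A *v p i) = (1 / al) *\<^sub>R (z i - z (Suc i))" using al by simp
  moreover have "(1 / al) *\<^sub>R (z i - z (Suc i)) \<in> dirspan (Suc k)"
    using z_in_dirspan[of i "Suc k"] z_in_dirspan[of "Suc i" "Suc k"] i unfolding dirspan_def
    by (intro span_scale span_diff) auto
  ultimately have "B *v (A *v v) \<in> dirspan (Suc k)" using i by simp
  then show ?case using step.IH unfolding dirspan_def
    by (simp add: matrix_vector_right_distrib matrix_vector_mult_scaleR span_add span_scale)
qed

end

section \<open>Chebyshev polynomials and the convergence rate\<close>

fun cheb :: "nat \<Rightarrow> real \<Rightarrow> real" where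
  "cheb 0 t = 1"
| "cheb (Suc 0) t = t"
| "cheb (Suc (Suc k)) t = 2 * t * cheb (Suc k) t - cheb k t"

lemma cheb_cos: "cheb k (cos \<theta>) = cos (real k * \<theta>)"
proof (induction k rule: induct_nat_012)
  case (ge2 k)
  have "cos (real (Suc (Suc k)) * \<theta>) + cos (real k * \<theta>) = 2 * cos \<theta> * cos (real (Suc k) * \<theta>)"
    using cos_plus_cos[of "real (Suc (Suc k)) * \<theta>" "real k * \<theta>"]
    by (simp add: algebra_simps add_divide_distrib)
  then show ?case using ge2 by simp
qed simp_all

lemma abs_cheb_le_1: "\<bar>t\<bar> \<le> 1 \<Longrightarrow> \<bar>cheb k t\<bar> \<le> 1"
  using cheb_cos[of k "arccos t"] cos_arccos_abs[of t] abs_cos_le_one[of "real k * arccos t"] by simp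

text \<open>The hyperbolic counterpart of \<open>cheb_cos\<close>; it gives the geometric growth
  outside [-1,1] that becomes the convergence rate.\<close>

lemma cheb_at_half_sum: "q \<noteq> 0 \<Longrightarrow> cheb k ((q + 1 / q) / 2) = (q ^ k + (1 / q) ^ k) / 2"
proof (induction k rule: induct_nat_012)
  case (ge2 k)
  define p where "p = 1 / q"
  have "(q + p) * (q * q ^ k + p * p ^ k) = q * (q * q ^ k) + p * (p * p ^ k) + (q * p) * (q ^ k + p ^ k)"
    by (simp add: algebra_simps)
  moreover have "q * p = 1" using ge2 by (simp add: p_def)
  ultimately have "(q + p) * (q * q ^ k + p * p ^ k) = q * (q * q ^ k) + p * (p * p ^ k) + (q ^ k + p ^ k)" by simp
  moreover have "cheb (Suc k) ((q + p) / 2) = (q * q ^ k + p * p ^ k) / 2" "cheb k ((q + p) / 2) = (q ^ k + p ^ k) / 2"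
    using ge2 by (simp_all add: p_def)
  ultimately show ?case unfolding p_def[symmetric] by (simp add: field_simps)
qed simp_all

context pcg_iteration
begin

text \<open>With the spectrum of the preconditioned matrix in an interval of ratio 16, the affine map
  sending that interval to [-1,1] sends 0 to 17/15 = (3/5 + 5/3)/2.\<close>

lemma chebyshev_error_bound:
  fixes G :: "real^'n^'n"
  assumes sol: "A *v xs = b" and a: "a > 0"
    and inv: "invertible G" and BG: "B = G ** transpose G" and AG: "transpose G ** A ** G = diagm mu"
    and mu: "\<And>i. a \<le> mu i \<and> mu i \<le> 16 * a"
  shows "(xs - x k) \<bullet> (A *v (xs - x k)) \<le> (2 * (3/5) ^ k)\<^sup>2 * (xs \<bullet> (A *v xs))"
proof (cases "\<exists>j<k. r j = 0")
  \<comment> \<open>An exact hit before step k persists, so the error is 0; otherwise the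
    orthogonality relations are available up to k.\<close>
  case True
  then obtain j where "j < k" "r j = 0" by blast
  then have "r k = 0" using residual_zero_stays[of j "k - j"] by simp
  then have "A *v (xs - x k) = 0" by (simp add: residual sol matrix_vector_mult_diff_distrib)
  moreover have "xs \<bullet> (A *v xs) \<ge> 0" using A_pos[of xs] by (cases "xs = 0") auto
  ultimately show ?thesis by simp
next
  case False
  then have nz: "r j \<noteq> 0" if "j < k" for j using that by blast
  define sg where "sg m = 17/15 - 2 / (15 * a) * m" for m
  obtain y where y: "xs = G *v y"
  proof -
    obtain G' where "G ** G' = mat 1" using inv by (auto simp: invertible_def)
    then have "xs = G *v (G' *v xs)" by (simp add: matrix_vector_mul_assoc)
    then show thesis by (rule that)
  qed
  \<comment> \<open>The j-th Chebyshev polynomial of the rescaled preconditioned matrix, applied to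
    \<open>xs\<close> one eigenvalue at a time.\<close>
  define V where "V j = G *v (\<chi> i. cheb j (sg (mu i)) * y $ i)" for j
  have BAG: "B *v (A *v (G *v v)) = G *v (\<chi> i. mu i * v $ i)" for v
  proof -
    have "B ** A ** G = G ** diagm mu" by (simp add: BG AG[symmetric] matrix_mul_assoc)
    then have "(B ** A ** G) *v v = (G ** diagm mu) *v v" by simp
    then show ?thesis by (simp add: matrix_vector_mul_assoc[symmetric] diagm_mult_vec)
  qed
  have Gsc: "c *\<^sub>R (G *v v) = G *v (\<chi> i. c * v $ i)" for c v
  proof -
    have "(\<chi> i. c * v $ i) = c *\<^sub>R v" by (simp add: vec_eq_iff)
    then show ?thesis by (simp add: matrix_vector_mult_scaleR)
  qed
  have V0: "V 0 = xs" by (simp add: V_def y)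
  have V1: "V (Suc 0) = (17/15) *\<^sub>R xs - (2 / (15 * a)) *\<^sub>R z 0"
  proof -
    have "z 0 = B *v (A *v xs)" by (simp add: z init sol)
    then have z0: "z 0 = G *v (\<chi> i. mu i * y $ i)" by (simp only: y BAG)
    show ?thesis unfolding z0 unfolding V_def y Gsc matrix_vector_mult_diff_distrib[symmetric]
      by (rule arg_cong[where f = "\<lambda>v. G *v v"]) (simp add: vec_eq_iff sg_def algebra_simps)
  qed
  have VS: "V (Suc (Suc j)) = (2 * (17/15)) *\<^sub>R V (Suc j) - (2 * (2 / (15 * a))) *\<^sub>R (B *v (A *v V (Suc j))) - V j" for j
    unfolding V_def BAG Gsc matrix_vector_mult_diff_distrib[symmetric]
    by (rule arg_cong[where f = "\<lambda>v. G *v v"]) (simp add: vec_eq_iff sg_def algebra_simps)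
  define tau where "tau j = cheb j (17/15)" for j
  have z0: "B *v (A *v xs) = z 0" by (simp add: z init sol)
  \<comment> \<open>A polynomial minus its value at 0 contains the factor \<open>B A\<close>, and
    \<open>B A xs = z 0\<close>; so the difference lies in the Krylov space although
    \<open>xs\<close> need not. Dividing by \<open>tau k\<close> then yields an admissible
    competitor \<open>yk\<close> with error \<open>V k\<close> over \<open>tau k\<close>.\<close>
  have W: "V j - tau j *\<^sub>R xs \<in> dirspan j" if "j \<le> k" for j
    using that
  proof (induction j rule: less_induct)
    case (less j)
    consider "j = 0" | "j = Suc 0" | i where "j = Suc (Suc i)" by (metis not0_implies_Suc)
    then show ?case
    proof cases
      case 1
      then show ?thesis by (simp add: V0 tau_def dirspan_def span_zero)
    next
      case 2
      then show ?thesis using z_in_dirspan[of 0 "Suc 0"] by (simp add: V1 tau_def dirspan_def span_neg span_scale)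
    next
      case 3
      let ?W = "\<lambda>j. V j - tau j *\<^sub>R xs"
      have eq: "?W j = (2 * (17/15)) *\<^sub>R ?W (Suc i) - (2 * (2 / (15 * a))) *\<^sub>R (B *v (A *v ?W (Suc i)))
          - (2 * (2 / (15 * a)) * tau (Suc i)) *\<^sub>R z 0 - ?W i"
        unfolding 3 VS by (simp add: tau_def z0 matrix_vector_mult_diff_distrib matrix_vector_mult_scaleR algebra_simps)
      have "?W (Suc i) \<in> dirspan (Suc i)" "?W i \<in> dirspan i" using less 3 by auto
      then have "?W (Suc i) \<in> dirspan j" "?W i \<in> dirspan j" "B *v (A *v ?W (Suc i)) \<in> dirspan j" "z 0 \<in> dirspan j"
        using BA_dirspan[of "Suc i" "?W (Suc i)"] nz less.prems 3 dirspan_mono z_in_dirspan by auto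
      moreover have "c1 *\<^sub>R u1 - c2 *\<^sub>R u2 - c3 *\<^sub>R u3 - u4 \<in> dirspan j"
        if "u1 \<in> dirspan j" "u2 \<in> dirspan j" "u3 \<in> dirspan j" "u4 \<in> dirspan j" for c1 c2 c3 u1 u2 u3 u4
        using that unfolding dirspan_def by (intro span_diff span_scale)
      ultimately show ?thesis unfolding eq by blast
    qed
  qed
  have tau: "tau k \<ge> (5/3) ^ k / 2"
    unfolding tau_def using cheb_at_half_sum[of "3/5" k] by simp
  then have tpos: "tau k > 0" by (rule less_le_trans[rotated]) simp
  define yk where "yk = - ((1 / tau k) *\<^sub>R (V k - tau k *\<^sub>R xs))"
  have "yk \<in> dirspan k" using W[of k] unfolding yk_def dirspan_def by (intro span_neg span_scale) auto
  from optimality[OF nz sol this]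
  have "(xs - x k) \<bullet> (A *v (xs - x k)) \<le> (xs - yk) \<bullet> (A *v (xs - yk))" by blast
  also have "xs - yk = (1 / tau k) *\<^sub>R V k" using tpos by (simp add: yk_def algebra_simps)
  also have "((1 / tau k) *\<^sub>R V k) \<bullet> (A *v ((1 / tau k) *\<^sub>R V k)) = (1 / tau k)\<^sup>2 * (V k \<bullet> (A *v V k))"
    by (simp add: matrix_vector_mult_scaleR power2_eq_square)
  also have "V k \<bullet> (A *v V k) \<le> xs \<bullet> (A *v xs)"
  proof -
    have "V k \<bullet> (A *v V k) = (\<Sum>i\<in>UNIV. mu i * (cheb k (sg (mu i)) * y $ i)\<^sup>2)"
      unfolding V_def inner_congruence AG inner_diagm by simp
    also have "\<dots> \<le> (\<Sum>i\<in>UNIV. mu i * (y $ i)\<^sup>2)"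
    proof (rule sum_mono)
      fix i
      have m: "a \<le> mu i" "mu i \<le> 16 * a" using mu by auto
      have "\<bar>sg (mu i)\<bar> \<le> 1" using m a by (simp add: sg_def abs_le_iff field_simps)
      then have "\<bar>cheb k (sg (mu i))\<bar> \<le> 1" by (rule abs_cheb_le_1)
      then have "(cheb k (sg (mu i)))\<^sup>2 * (y $ i)\<^sup>2 \<le> 1 * (y $ i)\<^sup>2"
        by (intro mult_right_mono) (auto simp: abs_square_le_1)
      then show "mu i * (cheb k (sg (mu i)) * y $ i)\<^sup>2 \<le> mu i * (y $ i)\<^sup>2"
        using m a by (intro mult_left_mono) (auto simp: power_mult_distrib)
    qed
    also have "\<dots> = xs \<bullet> (A *v xs)" unfolding y inner_congruence AG inner_diagm by simp
    finally show ?thesis .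
  qed
  also have "(1 / tau k)\<^sup>2 * (xs \<bullet> (A *v xs)) \<le> (2 * (3/5) ^ k)\<^sup>2 * (xs \<bullet> (A *v xs))"
  proof (intro mult_right_mono power_mono)
    have "1 / tau k \<le> 1 / ((5/3) ^ k / 2)" using tau tpos by (intro divide_left_mono) auto
    also have "\<dots> = 2 * (3/5) ^ k" by (simp add: power_divide)
    finally show "1 / tau k \<le> 2 * (3/5) ^ k" .
    show "xs \<bullet> (A *v xs) \<ge> 0" using A_pos[of xs] by (cases "xs = 0") auto
  qed (use tpos in auto)
  finally show ?thesis by (simp add: mult_left_mono)
qed

end

theorem pcg_error_bound:
  fixes A P :: "real^'n^'n"
  assumes As: "transpose A = A" and Ps: "transpose P = P" and a: "a > 0"
    and P_pos: "\<And>v. v \<noteq> 0 \<Longrightarrow> v \<bullet> (P *v v) > 0"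
    and lower: "\<And>v. a * (v \<bullet> (P *v v)) \<le> v \<bullet> (A *v v)"
    and upper: "\<And>v. v \<bullet> (A *v v) \<le> 16 * a * (v \<bullet> (P *v v))"
    and sol: "A *v xs = b"
  shows "(xs - pcg A P b k) \<bullet> (A *v (xs - pcg A P b k)) \<le> (2 * (3/5) ^ k)\<^sup>2 * (xs \<bullet> (A *v xs))"
proof -
  obtain G :: "real^'n^'n" and mu where G: "transpose G ** P ** G = mat 1" "transpose G ** A ** G = diagm mu"
    "matrix_inv P = G ** transpose G" "invertible G"
    by (rule simultaneous_diagonalization[OF Ps P_pos As])
  define st where "st j = (pcg_step A (matrix_inv P) ^^ j) (0, b, matrix_inv P *v b, matrix_inv P *v b)" for j
  define x r z p where "x j = fst (st j)" "r j = fst (snd (st j))" "z j = fst (snd (snd (st j)))" "p j = snd (snd (snd (st j)))" for j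
  note d = x_r_z_p_def
  have st: "st j = (x j, r j, z j, p j)" for j by (simp add: d)
  have st0: "st 0 = (0, b, matrix_inv P *v b, matrix_inv P *v b)" by (simp add: st_def)
  have stS: "st (Suc j) = pcg_step A (matrix_inv P) (x j, r j, z j, p j)" for j
    using st[of j] by (simp add: st_def)
  have init: "x 0 = 0" "r 0 = b" "z 0 = matrix_inv P *v b" "p 0 = matrix_inv P *v b"
    by (simp_all add: d st0)
  have "(x (Suc j), r (Suc j), z (Suc j), p (Suc j)) = pcg_step A (matrix_inv P) (x j, r j, z j, p j)" for j
    using st[of "Suc j"] stS[of j] by simp
  then have step: "x (Suc j) = x j + ((r j \<bullet> z j) / (p j \<bullet> (A *v p j))) *\<^sub>R p j"
    "r (Suc j) = r j - ((r j \<bullet> z j) / (p j \<bullet> (A *v p j))) *\<^sub>R (A *v p j)"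
    "z (Suc j) = matrix_inv P *v r (Suc j)"
    "p (Suc j) = z (Suc j) + ((r (Suc j) \<bullet> z (Suc j)) / (r j \<bullet> z j)) *\<^sub>R p j" for j
    by (simp_all add: pcg_step_def Let_def)
  have zk: "z j = matrix_inv P *v r j" for j
    by (cases j) (simp_all only: init step(3))
  interpret pcg_iteration A "matrix_inv P" b x r z p
  proof
    show "transpose (matrix_inv P) = matrix_inv P" by (simp add: G(3) matrix_transpose_mul)
    show "v \<bullet> (A *v v) > 0" if "v \<noteq> 0" for v
      using lower[of v] P_pos[OF that] a by (smt (verit) mult_pos_pos)
    show "v \<bullet> (matrix_inv P *v v) > 0" if "v \<noteq> 0" for v
    proof -
      have "transpose G *v v \<noteq> 0"
      proof
        assume 0: "transpose G *v v = 0"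
        have "\<exists>C. C ** transpose G = mat 1" using G(4) by (simp add: left_invertible_transpose invertible_right_inverse)
        then show False using 0 that by (metis matrix_left_invertible_ker)
      qed
      then have "(transpose G *v v) \<bullet> (transpose G *v v) > 0" by simp
      then show ?thesis by (simp add: G(3) matrix_vector_mul_assoc[symmetric] inner_matrix_transpose)
    qed
    show "z j = matrix_inv P *v r j" for j by (rule zk)
  qed (simp_all only: As init step)
  \<comment> \<open>The columns of \<open>G\<close> have P-norm 1, so testing both form bounds on
    them brackets the eigenvalues.\<close>
  have mu: "a \<le> mu i \<and> mu i \<le> 16 * a" for i
  proof -
    let ?g = "G *v axis i 1"
    have "?g \<bullet> (P *v ?g) = 1" unfolding inner_congruence G by (simp add: inner_axis_axis)
    moreover have "?g \<bullet> (A *v ?g) = mu i" unfolding inner_congruence G by (rule inner_diagm_axis)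
    ultimately show ?thesis using lower[of ?g] upper[of ?g] by simp
  qed
  have "pcg A P b k = x k" by (simp add: pcg_def d st_def)
  then show ?thesis using chebyshev_error_bound[OF sol a G(4,3,2) mu] by simp
qed

text \<open>The start at 0 makes the initial error \<open>xs\<close>, of norm at most R / rho. The
  same lower bound on A that gives this also converts the energy norm back to the Euclidean one. In
  the iteration count, the summand 4 supplies a factor exp(-2), which beats the 2 of the Chebyshev
  bound.\<close>

lemma pcg_iters_accuracy:
  fixes A P :: "real^'n^'n"
  assumes As: "transpose A = A" and Ps: "transpose P = P" and rho: "rho > 0" and e: "e > 0"
    and P_pos: "\<And>v. v \<bullet> v \<le> v \<bullet> (P *v v)" and A_pos: "\<And>v. rho * (v \<bullet> v) \<le> v \<bullet> (A *v v)"
    and lower: "\<And>v. rho * (v \<bullet> (P *v v)) \<le> v \<bullet> (A *v v)"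
    and upper: "\<And>v. v \<bullet> (A *v v) \<le> 16 * rho * (v \<bullet> (P *v v))"
    and R: "norm b \<le> R"
  shows "norm (pcg A P b (pcg_iters R e rho) - matrix_inv A *v b) \<le> e"
proof -
  define xs where "xs = matrix_inv A *v b"
  define k where "k = pcg_iters R e rho"
  define d where "d = xs - pcg A P b k"
  have "invertible A"
  proof (rule posdef_invertible)
    fix v :: "real^'n" assume "v \<noteq> 0"
    then have "0 < rho * (v \<bullet> v)" using rho by simp
    then show "0 < v \<bullet> (A *v v)" using A_pos[of v] by linarith
  qed
  then have sol: "A *v xs = b" by (simp add: xs_def matrix_vector_mul_assoc matrix_inv_mult)
  have Ppos: "0 < v \<bullet> (P *v v)" if "v \<noteq> 0" for v
    using P_pos[of v] that by (smt (verit) inner_gt_zero_iff)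
  have err: "d \<bullet> (A *v d) \<le> (2 * (3/5) ^ k)\<^sup>2 * (xs \<bullet> (A *v xs))"
    unfolding d_def by (rule pcg_error_bound[OF As Ps rho Ppos lower upper sol])
  have R0: "R \<ge> 0" using R norm_ge_zero[of b] by linarith
  have xb: "xs \<bullet> (A *v xs) \<le> norm xs * R"
    unfolding sol using norm_cauchy_schwarz[of xs b] R by (smt (verit) mult_left_mono norm_ge_zero)
  have nx: "norm xs \<le> R / rho"
  proof (cases "xs = 0")
    case False
    have "norm xs * (rho * norm xs) \<le> norm xs * R" using A_pos[of xs] xb by (simp add: dot_square_norm power2_eq_square mult_ac)
    then have "rho * norm xs \<le> R" using False by (simp add: mult_le_cancel_left)
    then show ?thesis using rho by (simp add: field_simps)
  qed (use R0 rho in simp)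
  have "rho * (norm d)\<^sup>2 \<le> (2 * (3/5) ^ k)\<^sup>2 * (R / rho * R)"
  proof -
    have "rho * (norm d)\<^sup>2 \<le> d \<bullet> (A *v d)" using A_pos[of d] by (simp add: dot_square_norm)
    also note err
    also have "(2 * (3/5) ^ k)\<^sup>2 * (xs \<bullet> (A *v xs)) \<le> (2 * (3/5) ^ k)\<^sup>2 * (R / rho * R)"
      using xb mult_right_mono[OF nx R0] by (intro mult_left_mono) auto
    finally show ?thesis .
  qed
  then have "(norm d)\<^sup>2 \<le> (2 * (3/5) ^ k * (R / rho))\<^sup>2"
    using rho by (simp add: field_simps power2_eq_square)
  then have nd: "norm d \<le> 2 * (3/5) ^ k * (R / rho)"
    by (rule power2_le_imp_le) (use R0 rho in simp)
  have "2 * (3/5) ^ k * (R / rho) \<le> e"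
  \<comment> \<open>For \<open>R = 0\<close> the logarithm in \<open>pcg_iters\<close> is
    meaningless, but the error bound is already 0.\<close>
  proof (cases "R = 0")
    case False
    define X where "X = R / (e * rho)"
    have X: "X > 0" using False R0 e rho by (simp add: X_def)
    \<comment> \<open>The ceiling and the truncation by \<open>nat\<close> both only increase the
      count, so a negative logarithm needs no separate case.\<close>
    have k: "real k \<ge> 4 + 2 * ln X" unfolding k_def pcg_iters_def X_def[symmetric] by linarith
    have "exp (1/2::real) \<le> 5/3"
    proof (rule power2_le_imp_le)
      have "(exp (1/2::real))\<^sup>2 = exp 1" by (simp add: exp_of_nat_mult[symmetric])
      then show "(exp (1/2::real))\<^sup>2 \<le> (5/3)\<^sup>2" using e_less_272 by (simp add: power2_eq_square)
    qed simp
    then have "3/5 \<le> exp (- (1/2::real))" by (simp add: exp_minus field_simps)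
    then have "(3/5) ^ k \<le> exp (- (1/2::real)) ^ k" by (intro power_mono) auto
    also have "\<dots> = exp (- (real k / 2))" by (simp add: exp_of_nat_mult[symmetric])
    also have "\<dots> \<le> exp (- 2 - ln X)" using k by simp
    also have "\<dots> = exp (- 2) / X" using X by (simp add: exp_diff)
    finally have "2 * (3/5) ^ k \<le> 2 * exp (- 2) / X" by simp
    also have "\<dots> \<le> 1 / X"
    proof -
      have "(2::real) \<le> exp 2" using exp_ge_add_one_self[of "2::real"] by simp
      then have "2 * exp (- 2) \<le> (1::real)" by (simp add: exp_minus field_simps)
      then show ?thesis using X by (intro divide_right_mono) auto
    qed
    finally have "2 * (3/5) ^ k * (R / rho) \<le> 1 / X * (R / rho)" using R0 rho by (intro mult_right_mono) auto
    also have "\<dots> = e" using False e rho by (simp add: X_def)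
    finally show ?thesis .
  qed (use e in simp)
  then show ?thesis using nd by (simp add: d_def k_def xs_def norm_minus_commute)
qed

section \<open>Gaussian measures\<close>

lemma nn_integral_normal_density: "0 < \<sigma> \<Longrightarrow> (\<integral>\<^sup>+t. ennreal (normal_density \<mu> \<sigma> t) \<partial>lborel) = 1"
  by (subst nn_integral_eq_integral) simp_all

text \<open>Tilting by the square leaves a centred Gaussian of deviation \<open>\<tau>\<close>. Both
  signs of a occur: positive for the weights of the columns, negative for the exponential moments of
  \<open>T\<close> in \<open>null_space_bound\<close>.\<close>

lemma nn_integral_normal_exp_square:
  assumes s: "0 < \<sigma>" and a: "0 < 1 + 2 * a * \<sigma>\<^sup>2"
  shows "(\<integral>\<^sup>+t. ennreal (exp (- a * t\<^sup>2)) * ennreal (normal_density 0 \<sigma> t) \<partial>lborel) = ennreal (1 / sqrt (1 + 2 * a * \<sigma>\<^sup>2))"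
proof -
  define D where "D = 1 + 2 * a * \<sigma>\<^sup>2"
  have D: "D > 0" using a by (simp add: D_def)
  define \<tau> where "\<tau> = \<sigma> / sqrt D"
  have t: "\<tau> > 0" using s D by (simp add: \<tau>_def)
  have "exp (- a * t\<^sup>2) * normal_density 0 \<sigma> t = (1 / sqrt D) * normal_density 0 \<tau> t" for t
  proof -
    have e: "- a * t\<^sup>2 - t\<^sup>2 / (2 * \<sigma>\<^sup>2) = - t\<^sup>2 / (2 * \<tau>\<^sup>2)"
      using s D by (simp add: \<tau>_def power_divide field_simps) (simp add: D_def algebra_simps)
    have "sqrt (2 * pi * \<tau>\<^sup>2) = sqrt (2 * pi) * \<tau>" "sqrt (2 * pi * \<sigma>\<^sup>2) = sqrt (2 * pi) * \<sigma>"
      using t s by (simp_all add: real_sqrt_mult)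
    then have c: "1 / sqrt (2 * pi * \<sigma>\<^sup>2) = (1 / sqrt D) * (1 / sqrt (2 * pi * \<tau>\<^sup>2))"
      using D s by (simp add: \<tau>_def)
    have "exp (- a * t\<^sup>2) * normal_density 0 \<sigma> t = (1 / sqrt (2 * pi * \<sigma>\<^sup>2)) * exp (- a * t\<^sup>2 - t\<^sup>2 / (2 * \<sigma>\<^sup>2))"
      by (simp add: normal_density_def exp_diff exp_minus field_simps)
    then show ?thesis unfolding e c by (simp add: normal_density_def)
  qed
  then have "(\<integral>\<^sup>+t. ennreal (exp (- a * t\<^sup>2)) * ennreal (normal_density 0 \<sigma> t) \<partial>lborel)
      = (\<integral>\<^sup>+t. ennreal (1 / sqrt D) * ennreal (normal_density 0 \<tau> t) \<partial>lborel)"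
    using D by (simp add: ennreal_mult'[symmetric])
  also have "\<dots> = ennreal (1 / sqrt D)"
    using t by (simp add: nn_integral_cmult nn_integral_normal_density)
  finally show ?thesis by (simp add: D_def)
qed

lemma nn_integral_normal_exp_linear:
  assumes s: "0 < \<sigma>"
  shows "(\<integral>\<^sup>+t. ennreal (exp (c * t)) * ennreal (normal_density 0 \<sigma> t) \<partial>lborel) = ennreal (exp (\<sigma>\<^sup>2 * c\<^sup>2 / 2))"
proof -
  have "exp (c * t) * normal_density 0 \<sigma> t = exp (\<sigma>\<^sup>2 * c\<^sup>2 / 2) * normal_density (\<sigma>\<^sup>2 * c) \<sigma> t" for t
  proof -
    have "c * t + - t\<^sup>2 / (2 * \<sigma>\<^sup>2) = \<sigma>\<^sup>2 * c\<^sup>2 / 2 + - (t - \<sigma>\<^sup>2 * c)\<^sup>2 / (2 * \<sigma>\<^sup>2)"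
      using s by (simp add: field_simps power2_eq_square)
    then have "exp (c * t) * exp (- t\<^sup>2 / (2 * \<sigma>\<^sup>2)) = exp (\<sigma>\<^sup>2 * c\<^sup>2 / 2) * exp (- (t - \<sigma>\<^sup>2 * c)\<^sup>2 / (2 * \<sigma>\<^sup>2))"
      by (simp only: exp_add[symmetric])
    then show ?thesis by (simp add: normal_density_def)
  qed
  then have "(\<integral>\<^sup>+t. ennreal (exp (c * t)) * ennreal (normal_density 0 \<sigma> t) \<partial>lborel)
     = (\<integral>\<^sup>+t. ennreal (exp (\<sigma>\<^sup>2 * c\<^sup>2 / 2)) * ennreal (normal_density (\<sigma>\<^sup>2 * c) \<sigma> t) \<partial>lborel)"
    by (simp add: ennreal_mult'[symmetric])
  also have "\<dots> = ennreal (exp (\<sigma>\<^sup>2 * c\<^sup>2 / 2))"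
    using s by (simp add: nn_integral_cmult nn_integral_normal_density)
  finally show ?thesis .
qed

lemma (in prob_space) linear_combination_indep_normal:
  assumes I: "finite I" and ind: "indep_vars (\<lambda>_. borel) X I" and s: "0 < \<sigma>"
    and normal: "\<And>i. i \<in> I \<Longrightarrow> distributed M lborel (X i) (normal_density 0 \<sigma>)"
    and nz: "\<exists>i\<in>I. c i \<noteq> 0"
  shows "distributed M lborel (\<lambda>\<omega>. \<Sum>i\<in>I. c i * X i \<omega>) (normal_density 0 (\<sigma> * sqrt (\<Sum>i\<in>I. (c i)\<^sup>2)))"
proof -
  \<comment> \<open>Terms with coefficient 0 are constant and have no normal density, so they are
    removed before summing.\<close>
  define J where "J = {i\<in>I. c i \<noteq> 0}"
  have J: "finite J" "J \<noteq> {}" "J \<subseteq> I" using I nz by (auto simp: J_def)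
  have "distributed M lborel (\<lambda>x. \<Sum>i\<in>J. c i * X i x) (normal_density (\<Sum>i\<in>J. 0) (sqrt (\<Sum>i\<in>J. (\<bar>c i\<bar> * \<sigma>)\<^sup>2)))"
  proof (rule sum_indep_normal)
    show "indep_vars (\<lambda>i. borel) (\<lambda>i x. c i * X i x) J"
      by (rule indep_vars_compose2[OF indep_vars_subset[OF ind J(3)]]) simp
    fix i assume i: "i \<in> J"
    then show "0 < \<bar>c i\<bar> * \<sigma>" using s by (simp add: J_def)
    have "distributed M lborel (\<lambda>x. 0 + c i * X i x) (normal_density (0 + c i * 0) (\<bar>c i\<bar> * \<sigma>))"
      using i by (intro normal_density_affine normal s) (auto simp: J_def)
    then show "distributed M lborel (\<lambda>x. c i * X i x) (normal_density 0 (\<bar>c i\<bar> * \<sigma>))" by simp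
  qed (use J in auto)
  moreover have "(\<Sum>i\<in>J. c i * X i x) = (\<Sum>i\<in>I. c i * X i x)" for x
    using I by (intro sum.mono_neutral_left) (auto simp: J_def)
  moreover have "(\<Sum>i\<in>J. (\<bar>c i\<bar> * \<sigma>)\<^sup>2) = \<sigma>\<^sup>2 * (\<Sum>i\<in>I. (c i)\<^sup>2)"
    using I by (subst sum.mono_neutral_left[of I J]) (auto simp: J_def power_mult_distrib sum_distrib_left mult.commute)
  ultimately show ?thesis using s by (simp add: real_sqrt_mult)
qed

section \<open>Gaussian vectors\<close>

lemma borel_measurable_vecI:
  fixes f :: "'a \<Rightarrow> real^'n"
  assumes "\<And>i. (\<lambda>x. f x $ i) \<in> borel_measurable M"
  shows "f \<in> borel_measurable M"
proof (rule borel_measurable_euclidean_space[THEN iffD2], rule)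
  fix b :: "real^'n" assume "b \<in> Basis"
  then obtain i where "b = axis i 1" by (auto simp: Basis_vec_def)
  then show "(\<lambda>x. f x \<bullet> b) \<in> borel_measurable M" using assms[of i] by (simp add: inner_axis)
qed

lemma nn_integral_lborel_vec_prod:
  fixes f :: "'n::finite \<Rightarrow> real \<Rightarrow> ennreal"
  assumes [measurable]: "\<And>i. f i \<in> borel_measurable borel"
  shows "(\<integral>\<^sup>+x. (\<Prod>i\<in>UNIV. f i (x $ i)) \<partial>(lborel::(real^'n) measure)) = (\<Prod>i\<in>UNIV. \<integral>\<^sup>+t. f i t \<partial>lborel)"
proof -
  define ix :: "real^'n \<Rightarrow> 'n" where "ix b = (SOME i. b = axis i 1)" for b
  have ix: "ix (axis i 1) = i" for i by (simp add: ix_def axis_eq_axis)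
  have B: "(Basis :: (real^'n) set) = (\<lambda>i. axis i 1) ` UNIV" by (auto simp: Basis_vec_def)
  have inj: "inj (\<lambda>i::'n. axis i (1::real))" by (simp add: inj_def axis_eq_axis)
  have "(\<integral>\<^sup>+x. (\<Prod>b\<in>Basis. f (ix b) (x \<bullet> b)) \<partial>lborel) = (\<Prod>b\<in>Basis. \<integral>\<^sup>+t. f (ix b) t \<partial>lborel)"
    by (rule nn_integral_lborel_prod) auto
  then show ?thesis unfolding B by (simp add: prod.reindex[OF inj] ix inner_axis)
qed

text \<open>Given by a density instead of a product measure, so that shifting it reduces to
  translation invariance of \<open>lborel\<close>, while product integrands still factor.\<close>

definition gauss :: "real \<Rightarrow> (real^'n) measure" where
  "gauss \<sigma> = density lborel (\<lambda>x. ennreal (\<Prod>i\<in>UNIV. normal_density 0 \<sigma> (x $ i)))"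

lemma borel_measurable_gauss_density [measurable]:
  "(\<lambda>x::real^'n. \<Prod>i\<in>UNIV. normal_density 0 \<sigma> (x $ i)) \<in> borel_measurable borel"
  by (intro borel_measurable_prod) measurable

lemma sets_gauss [measurable_cong, simp]: "sets (gauss \<sigma>) = sets borel"
  by (simp add: gauss_def)

lemma space_gauss [simp]: "space (gauss \<sigma>) = UNIV"
  by (simp add: gauss_def)

lemma nn_integral_gauss_prod:
  fixes f :: "'n::finite \<Rightarrow> real \<Rightarrow> ennreal"
  assumes [measurable]: "\<And>i. f i \<in> borel_measurable borel"
  shows "(\<integral>\<^sup>+x. (\<Prod>i\<in>UNIV. f i (x $ i)) \<partial>gauss \<sigma>) = (\<Prod>i\<in>UNIV. \<integral>\<^sup>+t. f i t * ennreal (normal_density 0 \<sigma> t) \<partial>lborel)"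
proof -
  have [measurable]: "(\<lambda>x::real^'n. \<Prod>i\<in>UNIV. f i (x $ i)) \<in> borel_measurable borel"
    by (intro borel_measurable_prod_ennreal) measurable
  have "(\<integral>\<^sup>+x. (\<Prod>i\<in>UNIV. f i (x $ i)) \<partial>gauss \<sigma>) =
    (\<integral>\<^sup>+x. (\<Prod>i\<in>UNIV. (\<lambda>t. f i t * ennreal (normal_density 0 \<sigma> t)) (x $ i)) \<partial>lborel)"
    unfolding gauss_def
    by (subst nn_integral_density) (auto simp: prod_ennreal[symmetric] prod.distrib mult.commute)
  also have "\<dots> = (\<Prod>i\<in>UNIV. \<integral>\<^sup>+t. f i t * ennreal (normal_density 0 \<sigma> t) \<partial>lborel)"
    by (rule nn_integral_lborel_vec_prod) measurable
  finally show ?thesis .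
qed

lemma prob_space_gauss:
  assumes "0 < \<sigma>" shows "prob_space (gauss \<sigma> :: (real^'n) measure)"
proof
  have "emeasure (gauss \<sigma> :: (real^'n) measure) (space (gauss \<sigma>)) = (\<integral>\<^sup>+x. (\<Prod>i\<in>UNIV. (\<lambda>t. 1) (x $ i)) \<partial>(gauss \<sigma> :: (real^'n) measure))"
    by simp
  also have "\<dots> = 1" by (subst nn_integral_gauss_prod) (auto simp: nn_integral_normal_density assms)
  finally show "emeasure (gauss \<sigma> :: (real^'n) measure) (space (gauss \<sigma>)) = 1" .
qed

lemma emeasure_gauss_box:
  fixes A :: "'n::finite \<Rightarrow> real set"
  assumes [measurable]: "\<And>i. A i \<in> sets borel"
  shows "emeasure (gauss \<sigma>) {x. \<forall>i. x $ i \<in> A i} = (\<Prod>i\<in>UNIV. emeasure (density lborel (normal_density 0 \<sigma>)) (A i))"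
proof -
  have [measurable]: "{x::real^'n. \<forall>i. x $ i \<in> A i} \<in> sets borel" by measurable
  have "emeasure (gauss \<sigma>) {x. \<forall>i. x $ i \<in> A i} = (\<integral>\<^sup>+x. indicator {x. \<forall>i. x $ i \<in> A i} x \<partial>gauss \<sigma>)"
    by simp
  also have "(\<lambda>x::real^'n. indicator {x. \<forall>i. x $ i \<in> A i} x :: ennreal) = (\<lambda>x. \<Prod>i\<in>UNIV. indicator (A i) (x $ i))"
    by (auto simp: fun_eq_iff indicator_def prod_zero_iff)
  also have "(\<integral>\<^sup>+x. (\<Prod>i\<in>UNIV. indicator (A i) (x $ i)) \<partial>gauss \<sigma>) = (\<Prod>i\<in>UNIV. \<integral>\<^sup>+t. indicator (A i) t * ennreal (normal_density 0 \<sigma> t) \<partial>lborel)"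
    by (rule nn_integral_gauss_prod) measurable
  also have "\<dots> = (\<Prod>i\<in>UNIV. emeasure (density lborel (normal_density 0 \<sigma>)) (A i))"
    by (simp add: emeasure_density mult.commute)
  finally show ?thesis .
qed

lemma distributed_gauss_component:
  assumes s: "0 < \<sigma>"
  shows "distributed (gauss \<sigma> :: (real^'n) measure) lborel (\<lambda>x. x $ i) (normal_density 0 \<sigma>)"
  unfolding distributed_def
proof (intro conjI measure_eqI)
  fix A assume "A \<in> sets (distr (gauss \<sigma> :: (real^'n) measure) lborel (\<lambda>x. x $ i))"
  then have A[measurable]: "A \<in> sets borel" by simp
  interpret nd: prob_space "density lborel (normal_density 0 \<sigma>)" using s by (rule prob_space_normal_density)
  have "emeasure (distr (gauss \<sigma>) lborel (\<lambda>x. x $ i)) A = emeasure (gauss \<sigma> :: (real^'n) measure) {x. x $ i \<in> A}"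
    by (subst emeasure_distr) (auto intro!: arg_cong2[where f = emeasure])
  also have "{x::real^'n. x $ i \<in> A} = {x. \<forall>k. x $ k \<in> (if k = i then A else UNIV)}" by auto
  also have "emeasure (gauss \<sigma> :: (real^'n) measure) \<dots> = (\<Prod>k\<in>UNIV. emeasure (density lborel (normal_density 0 \<sigma>)) (if k = i then A else UNIV))"
    by (rule emeasure_gauss_box) simp
  also have "\<dots> = (\<Prod>k\<in>UNIV. if k = i then emeasure (density lborel (normal_density 0 \<sigma>)) A else 1)"
    using nd.emeasure_space_1 by (intro prod.cong) auto
  finally show "emeasure (distr (gauss \<sigma> :: (real^'n) measure) lborel (\<lambda>x. x $ i)) A = emeasure (density lborel (normal_density 0 \<sigma>)) A"
    by simp
qed auto

lemma indep_gauss_components: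
  assumes s: "0 < \<sigma>"
  shows "prob_space.indep_vars (gauss \<sigma> :: (real^'n) measure) (\<lambda>_. borel) (\<lambda>i x. x $ i) UNIV"
proof -
  interpret N: prob_space "gauss \<sigma> :: (real^'n) measure" using s by (rule prob_space_gauss)
  have m[measurable]: "(\<lambda>x::real^'n. x $ i) \<in> measurable (gauss \<sigma>) borel" for i by measurable
  interpret P: product_prob_space "\<lambda>i. distr (gauss \<sigma> :: (real^'n) measure) borel (\<lambda>x. x $ i)" UNIV
    by (intro product_prob_spaceI N.prob_space_distr m)
  have d: "distr (gauss \<sigma> :: (real^'n) measure) borel (\<lambda>x. x $ i) = density lborel (normal_density 0 \<sigma>)" for i
    using distributed_gauss_component[OF s, of i] unfolding distributed_def
    by (simp add: distr_cong[OF refl, of borel lborel])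
  have "distr (gauss \<sigma> :: (real^'n) measure) (Pi\<^sub>M UNIV (\<lambda>_. borel)) (\<lambda>x. \<lambda>i\<in>UNIV. x $ i) = Pi\<^sub>M UNIV (\<lambda>i. distr (gauss \<sigma> :: (real^'n) measure) borel (\<lambda>x. x $ i))"
  proof (rule P.PiM_eqI)
    fix A :: "'n \<Rightarrow> real set" assume "\<And>i. i \<in> UNIV \<Longrightarrow> A i \<in> sets (distr (gauss \<sigma> :: (real^'n) measure) borel (\<lambda>x. x $ i))"
    then have A[measurable]: "A i \<in> sets borel" for i by simp
    have "emeasure (distr (gauss \<sigma> :: (real^'n) measure) (Pi\<^sub>M UNIV (\<lambda>_. borel)) (\<lambda>x. \<lambda>i\<in>UNIV. x $ i)) (Pi\<^sub>E UNIV A)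
      = emeasure (gauss \<sigma>) {x. \<forall>i. x $ i \<in> A i}"
      by (subst emeasure_distr) (auto intro!: arg_cong2[where f = emeasure] sets_PiM_I_finite measurable_restrict)
    then show "emeasure (distr (gauss \<sigma> :: (real^'n) measure) (Pi\<^sub>M UNIV (\<lambda>_. borel)) (\<lambda>x. \<lambda>i\<in>UNIV. x $ i)) (Pi\<^sub>E UNIV A)
      = (\<Prod>i\<in>UNIV. emeasure (distr (gauss \<sigma> :: (real^'n) measure) borel (\<lambda>x. x $ i)) (A i))"
      unfolding d by (simp add: emeasure_gauss_box)
  qed (auto intro!: sets_PiM_cong)
  then show ?thesis by (subst N.indep_vars_iff_distr_eq_PiM') auto
qed

text \<open>First and second moments suffice, since the exponent to which Jensen's inequality is
  applied is quadratic. The case \<open>a = 0\<close> is degenerate and has no density.\<close>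

lemma gauss_linear_moments:
  fixes a :: "real^'n"
  assumes s: "0 < \<sigma>"
  shows "integrable (gauss \<sigma>) (\<lambda>x. a \<bullet> x)" "(\<integral>x. a \<bullet> x \<partial>gauss \<sigma>) = 0"
    "integrable (gauss \<sigma>) (\<lambda>x. (a \<bullet> x)\<^sup>2)" "(\<integral>x. (a \<bullet> x)\<^sup>2 \<partial>gauss \<sigma>) = \<sigma>\<^sup>2 * (norm a)\<^sup>2"
proof -
  interpret N: prob_space "gauss \<sigma> :: (real^'n) measure" using s by (rule prob_space_gauss)
  have "integrable (gauss \<sigma>) (\<lambda>x. a \<bullet> x) \<and> (\<integral>x. a \<bullet> x \<partial>gauss \<sigma>) = 0 \<and>
    integrable (gauss \<sigma>) (\<lambda>x. (a \<bullet> x)\<^sup>2) \<and> (\<integral>x. (a \<bullet> x)\<^sup>2 \<partial>gauss \<sigma>) = \<sigma>\<^sup>2 * (norm a)\<^sup>2"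
  proof (cases "a = 0")
    case False
    define \<tau> where "\<tau> = \<sigma> * norm a"
    have t: "\<tau> > 0" using s False by (simp add: \<tau>_def)
    have "distributed (gauss \<sigma>) lborel (\<lambda>x. \<Sum>i\<in>UNIV. a $ i * x $ i) (normal_density 0 (\<sigma> * sqrt (\<Sum>i\<in>UNIV. (a $ i)\<^sup>2)))"
      using False
      by (intro N.linear_combination_indep_normal indep_gauss_components distributed_gauss_component s) (auto simp: vec_eq_iff)
    then have D: "distributed (gauss \<sigma>) lborel (\<lambda>x. a \<bullet> x) (normal_density 0 \<tau>)"
      by (simp add: \<tau>_def inner_vec_def norm_vec_def L2_set_def)
    have i1: "integrable (gauss \<sigma>) (\<lambda>x. a \<bullet> x)"
      using distributed_integrable[OF D, of "\<lambda>t. t"] integrable_normal_moment[OF t, of 0 1] by simp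
    have e1: "(\<integral>x. a \<bullet> x \<partial>gauss \<sigma>) = 0" using N.normal_distributed_expectation[OF t D] .
    have i2: "integrable (gauss \<sigma>) (\<lambda>x. (a \<bullet> x)\<^sup>2)"
      using distributed_integrable[OF D, of "\<lambda>t. t\<^sup>2"] integrable_normal_moment[OF t, of 0 2] by simp
    have "(\<integral>x. (a \<bullet> x)\<^sup>2 \<partial>gauss \<sigma>) = \<tau>\<^sup>2" using N.normal_distributed_variance[OF t D] e1 by simp
    then show ?thesis using i1 e1 i2 by (simp add: \<tau>_def power_mult_distrib)
  qed simp
  then show "integrable (gauss \<sigma>) (\<lambda>x. a \<bullet> x)" "(\<integral>x. a \<bullet> x \<partial>gauss \<sigma>) = 0"
    "integrable (gauss \<sigma>) (\<lambda>x. (a \<bullet> x)\<^sup>2)" "(\<integral>x. (a \<bullet> x)\<^sup>2 \<partial>gauss \<sigma>) = \<sigma>\<^sup>2 * (norm a)\<^sup>2" by blast+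
qed

lemma nn_integral_gauss_exp_linear:
  fixes a :: "real^'n"
  assumes s: "0 < \<sigma>"
  shows "(\<integral>\<^sup>+x. ennreal (exp (a \<bullet> x)) \<partial>gauss \<sigma>) = ennreal (exp (\<sigma>\<^sup>2 * (norm a)\<^sup>2 / 2))"
proof -
  have "(\<integral>\<^sup>+x. ennreal (exp (a \<bullet> x)) \<partial>gauss \<sigma>) = (\<integral>\<^sup>+x. (\<Prod>i\<in>UNIV. ennreal (exp (a $ i * x $ i))) \<partial>gauss \<sigma>)"
    by (simp add: inner_vec_def exp_sum prod_ennreal)
  also have "\<dots> = (\<Prod>i\<in>UNIV. \<integral>\<^sup>+t. ennreal (exp (a $ i * t)) * ennreal (normal_density 0 \<sigma> t) \<partial>lborel)"
    by (rule nn_integral_gauss_prod) measurable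
  also have "\<dots> = ennreal (exp (\<Sum>i\<in>UNIV. \<sigma>\<^sup>2 * (a $ i)\<^sup>2 / 2))"
    using s by (simp add: nn_integral_normal_exp_linear prod_ennreal exp_sum)
  also have "(\<Sum>i\<in>UNIV. \<sigma>\<^sup>2 * (a $ i)\<^sup>2 / 2) = \<sigma>\<^sup>2 * (norm a)\<^sup>2 / 2"
    by (simp add: norm_vec_def L2_set_def sum_nonneg sum_distrib_left sum_divide_distrib)
  finally show ?thesis .
qed

lemma nn_integral_gauss_exp_diag:
  fixes d :: "'n::finite \<Rightarrow> real"
  assumes d: "\<And>i. 2 * d i < 1"
  shows "(\<integral>\<^sup>+x. ennreal (exp (\<Sum>i\<in>UNIV. d i * (x $ i)\<^sup>2)) \<partial>gauss 1) = ennreal (\<Prod>i\<in>UNIV. 1 / sqrt (1 - 2 * d i))"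
proof -
  have "(\<integral>\<^sup>+x. ennreal (exp (\<Sum>i\<in>UNIV. d i * (x $ i)\<^sup>2)) \<partial>gauss 1) = (\<integral>\<^sup>+x. (\<Prod>i\<in>UNIV. ennreal (exp (- (- d i) * (x $ i)\<^sup>2))) \<partial>gauss 1)"
    by (simp add: exp_sum prod_ennreal)
  also have "\<dots> = (\<Prod>i\<in>UNIV. \<integral>\<^sup>+t. ennreal (exp (- (- d i) * t\<^sup>2)) * ennreal (normal_density 0 1 t) \<partial>lborel)"
    by (rule nn_integral_gauss_prod) measurable
  also have "\<dots> = (\<Prod>i\<in>UNIV. ennreal (1 / sqrt (1 + 2 * (- d i) * 1\<^sup>2)))"
    using d by (intro prod.cong nn_integral_normal_exp_square refl) auto
  also have "\<dots> = ennreal (\<Prod>i\<in>UNIV. 1 / sqrt (1 - 2 * d i))"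
    using d by (subst prod_ennreal) (auto simp: less_imp_le)
  finally show ?thesis .
qed

text \<open>The Cameron--Martin formula. The logarithm of the density ratio is affine in x, so it
  simply joins the exponent.\<close>

lemma nn_integral_gauss_shift:
  fixes v :: "real^'n"
  assumes s: "0 < \<sigma>" and f[measurable]: "f \<in> borel_measurable borel"
  shows "(\<integral>\<^sup>+x. f x \<partial>gauss \<sigma>) = (\<integral>\<^sup>+x. f (v + x) * ennreal (exp (- (v \<bullet> x) / \<sigma>\<^sup>2 - (norm v)\<^sup>2 / (2 * \<sigma>\<^sup>2))) \<partial>gauss \<sigma>)"
proof -
  let ?g = "\<lambda>x::real^'n. \<Prod>i\<in>UNIV. normal_density 0 \<sigma> (x $ i)"
  let ?e = "\<lambda>x. exp (- (v \<bullet> x) / \<sigma>\<^sup>2 - (norm v)\<^sup>2 / (2 * \<sigma>\<^sup>2))"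
  have g0: "?g x \<ge> 0" for x by (simp add: prod_nonneg)
  have sh: "?g (v + x) = ?g x * ?e x" for x
  proof -
    have "normal_density 0 \<sigma> (v $ i + x $ i) = normal_density 0 \<sigma> (x $ i) * exp (- (v $ i * x $ i) / \<sigma>\<^sup>2 - (v $ i)\<^sup>2 / (2 * \<sigma>\<^sup>2))" for i
    proof -
      have "- (v $ i + x $ i)\<^sup>2 / (2 * \<sigma>\<^sup>2) = - (x $ i)\<^sup>2 / (2 * \<sigma>\<^sup>2) + (- (v $ i * x $ i) / \<sigma>\<^sup>2 - (v $ i)\<^sup>2 / (2 * \<sigma>\<^sup>2))"
        using s by (simp add: field_simps power2_eq_square)
      then have "exp (- (v $ i + x $ i)\<^sup>2 / (2 * \<sigma>\<^sup>2)) = exp (- (x $ i)\<^sup>2 / (2 * \<sigma>\<^sup>2)) * exp (- (v $ i * x $ i) / \<sigma>\<^sup>2 - (v $ i)\<^sup>2 / (2 * \<sigma>\<^sup>2))"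
        by (simp only: exp_add[symmetric])
      then show ?thesis by (simp add: normal_density_def)
    qed
    then have "?g (v + x) = ?g x * exp (\<Sum>i\<in>UNIV. - (v $ i * x $ i) / \<sigma>\<^sup>2 - (v $ i)\<^sup>2 / (2 * \<sigma>\<^sup>2))"
      by (simp add: prod.distrib exp_sum)
    also have "(\<Sum>i\<in>UNIV. - (v $ i * x $ i) / \<sigma>\<^sup>2 - (v $ i)\<^sup>2 / (2 * \<sigma>\<^sup>2)) = - (v \<bullet> x) / \<sigma>\<^sup>2 - (norm v)\<^sup>2 / (2 * \<sigma>\<^sup>2)"
      by (simp add: sum_subtractf sum_divide_distrib sum_negf inner_vec_def norm_vec_def L2_set_def sum_nonneg)
    finally show ?thesis .
  qed
  have "(\<integral>\<^sup>+x. f x \<partial>gauss \<sigma>) = (\<integral>\<^sup>+x. ennreal (?g x) * f x \<partial>lborel)"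
    unfolding gauss_def by (rule nn_integral_density) measurable
  also have "\<dots> = (\<integral>\<^sup>+x. ennreal (?g x) * f x \<partial>distr lborel borel ((+) v))"
    by (simp only: lborel_distr_plus)
  also have "\<dots> = (\<integral>\<^sup>+x. ennreal (?g (v + x)) * f (v + x) \<partial>lborel)"
    by (rule nn_integral_distr) measurable
  also have "\<dots> = (\<integral>\<^sup>+x. ennreal (?g x) * (f (v + x) * ennreal (?e x)) \<partial>lborel)"
    unfolding sh by (simp add: ennreal_mult' g0 mult_ac)
  also have "\<dots> = (\<integral>\<^sup>+x. f (v + x) * ennreal (?e x) \<partial>gauss \<sigma>)"
    unfolding gauss_def by (rule nn_integral_density[symmetric]) measurable
  finally show ?thesis .
qed

text \<open>Jensen's inequality, from the tangent of exp at the mean. With an extended integral on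
  the right, exp(G) need not be integrable.\<close>

lemma (in prob_space) exp_expectation_le_nn_integral:
  assumes "integrable M G"
  shows "ennreal (exp (expectation G)) \<le> (\<integral>\<^sup>+x. ennreal (exp (G x)) \<partial>M)"
proof -
  let ?m = "expectation G"
  have i: "integrable M (\<lambda>x. exp ?m * (1 + (G x - ?m)))" using assms by simp
  have "ennreal (exp ?m) = ennreal (\<integral>x. exp ?m * (1 + (G x - ?m)) \<partial>M)"
    using assms by (simp add: prob_space)
  \<comment> \<open>The tangent takes negative values; cutting them off at 0 allows the passage to
    the nonnegative integral.\<close>
  also have "\<dots> \<le> ennreal (\<integral>x. max 0 (exp ?m * (1 + (G x - ?m))) \<partial>M)"
    using i by (intro ennreal_leI integral_mono integrable_max) auto
  also have "\<dots> = (\<integral>\<^sup>+x. ennreal (max 0 (exp ?m * (1 + (G x - ?m)))) \<partial>M)"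
    using i by (intro nn_integral_eq_integral[symmetric] integrable_max) auto
  also have "\<dots> = (\<integral>\<^sup>+x. ennreal (exp ?m * (1 + (G x - ?m))) \<partial>M)"
    by (intro nn_integral_cong) (auto simp: max_def ennreal_neg)
  also have "\<dots> \<le> (\<integral>\<^sup>+x. ennreal (exp (G x)) \<partial>M)"
  proof (intro nn_integral_mono ennreal_leI)
    fix x
    have "exp ?m * (1 + (G x - ?m)) \<le> exp ?m * exp (G x - ?m)" by (intro mult_left_mono) auto
    then show "exp ?m * (1 + (G x - ?m)) \<le> exp (G x)" by (simp add: exp_add[symmetric])
  qed
  finally show ?thesis .
qed

text \<open>The second derivative of ln(1 + 4 u^2) is never below -1, a value it takes at u^2 = 3/4;
  this is the Taylor bound at u = 1, where the slope is 8/5. A quadratic minorant can be averaged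
  exactly: under a centred Gaussian its linear term vanishes.\<close>

lemma ln_one_plus_four_square_ge:
  fixes t :: real
  shows "ln 5 + 8/5 * t - t\<^sup>2 / 2 \<le> ln (1 + 4 * (1 + t)\<^sup>2)"
proof -
  define f where "f t = ln (1 + 4 * (1 + t)\<^sup>2) + t\<^sup>2 / 2 - 8/5 * t" for t :: real
  define f' where "f' t = t * (4 * (1 + t)\<^sup>2 - 32/5 * (1 + t) + 13/5) / (1 + 4 * (1 + t)\<^sup>2)" for t :: real
  have pos: "1 + 4 * (1 + t)\<^sup>2 > 0" for t :: real by (simp add: add_pos_nonneg)
  have der: "(f has_real_derivative f' t) (at t)" for t
  proof -
    have "(f has_real_derivative (8 * (1 + t)) / (1 + 4 * (1 + t)\<^sup>2) + t - 8/5) (at t)"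
      unfolding f_def using pos[of t] by (auto intro!: derivative_eq_intros simp: field_simps)
    also have "(8 * (1 + t)) / (1 + 4 * (1 + t)\<^sup>2) + t - 8/5 = f' t"
      unfolding f'_def using pos[of t] by (simp add: field_simps power2_eq_square)
    finally show ?thesis .
  qed
  have q: "4 * (1 + t)\<^sup>2 - 32/5 * (1 + t) + 13/5 \<ge> 0" for t :: real
  proof -
    have "4 * (1 + t)\<^sup>2 - 32/5 * (1 + t) + 13/5 = (2 * (1 + t) - 8/5)\<^sup>2 + 1/25"
      by (simp add: power2_eq_square field_simps)
    then show ?thesis by simp
  qed
  have "f 0 \<le> f t"
  proof (cases "t \<ge> 0")
    case True
    show ?thesis
    proof (rule DERIV_nonneg_imp_nondecreasing[OF True])
      fix x :: real assume "0 \<le> x" "x \<le> t"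
      then have "f' x \<ge> 0" unfolding f'_def using q[of x] pos[of x] by (intro divide_nonneg_pos mult_nonneg_nonneg)
      then show "\<exists>y. (f has_real_derivative y) (at x) \<and> 0 \<le> y" using der by blast
    qed
  next
    case False
    then have "t \<le> 0" by simp
    then show ?thesis
    proof (rule DERIV_nonpos_imp_nonincreasing)
      fix x :: real assume "t \<le> x" "x \<le> 0"
      then have "f' x \<le> 0" unfolding f'_def using q[of x] pos[of x] by (intro divide_nonpos_pos mult_nonpos_nonneg)
      then show "\<exists>y. (f has_real_derivative y) (at x) \<and> y \<le> 0" using der by blast
    qed
  qed
  then show ?thesis by (simp add: f_def)
qed

section \<open>Gaussian test matrices\<close>

locale gaussian_matrix = prob_space +
  fixes Om :: "'a \<Rightarrow> real^'s^'d"
  assumes gauss_entry: "\<And>i j. distributed M lborel (\<lambda>\<omega>. Om \<omega> $ i $ j) (\<lambda>x. ennreal (std_normal_density x))"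
    and indep_entries: "indep_vars (\<lambda>_. borel) (\<lambda>(i, j) \<omega>. Om \<omega> $ i $ j) UNIV"
begin

abbreviation col :: "'s \<Rightarrow> 'a \<Rightarrow> real^'d" where "col j \<omega> \<equiv> column j (Om \<omega>)"

lemma col_measurable [measurable]: "col j \<in> borel_measurable M"
proof (rule borel_measurable_vecI)
  show "(\<lambda>\<omega>. col j \<omega> $ i) \<in> borel_measurable M" for i
    using distributed_measurable[OF gauss_entry[of i j]] by (simp add: column_def)
qed

lemma indep_columns: "indep_vars (\<lambda>_. borel) col UNIV"
proof -
  define K :: "'s \<Rightarrow> ('d \<times> 's) set" where "K j = UNIV \<times> {j}" for j
  have "indep_vars (\<lambda>j. PiM (K j) (\<lambda>_. borel)) (\<lambda>j \<omega>. restrict (\<lambda>p. (\<lambda>(i, j) \<omega>. Om \<omega> $ i $ j) p \<omega>) (K j)) UNIV"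
    by (rule indep_vars_restrict[OF indep_entries]) (auto simp: disjoint_family_on_def K_def)
  then have "indep_vars (\<lambda>_. borel) (\<lambda>j \<omega>. (\<lambda>g. \<chi> i. g (i, j)) (restrict (\<lambda>p. (\<lambda>(i, j) \<omega>. Om \<omega> $ i $ j) p \<omega>) (K j))) UNIV"
  proof (rule indep_vars_compose2)
    fix j
    show "(\<lambda>g. \<chi> i. g (i, j)) \<in> Pi\<^sub>M (K j) (\<lambda>_. borel) \<rightarrow>\<^sub>M (borel :: (real^'d) measure)"
      by (rule borel_measurable_vecI) (simp, rule measurable_component_singleton, simp add: K_def)
  qed
  moreover have "(\<chi> i. restrict (\<lambda>p. (\<lambda>(i, j) \<omega>. Om \<omega> $ i $ j) p \<omega>) (K j) (i, j)) = col j \<omega>" for j \<omega>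
    by (simp add: K_def column_def)
  ultimately show ?thesis by simp
qed

lemma nn_integral_prod_columns:
  assumes [measurable]: "f \<in> borel_measurable borel"
  shows "(\<integral>\<^sup>+\<omega>. (\<Prod>j\<in>UNIV. f (col j \<omega>)) \<partial>M) = (\<Prod>j\<in>UNIV. \<integral>\<^sup>+\<omega>. f (col j \<omega>) \<partial>M)"
  by (rule indep_vars_nn_integral) (auto intro!: indep_vars_compose2[OF indep_columns])

lemma distributed_inner_column:
  assumes a: "a \<noteq> 0"
  shows "distributed M lborel (\<lambda>\<omega>. a \<bullet> col j \<omega>) (normal_density 0 (norm a))"
proof -
  let ?I = "(\<lambda>i. (i, j)) ` (UNIV :: 'd set)"
  have inj: "inj (\<lambda>i::'d. (i, j))" by (simp add: inj_def)
  have "distributed M lborel (\<lambda>\<omega>. \<Sum>p\<in>?I. (a $ fst p) * (\<lambda>(i, j) \<omega>. Om \<omega> $ i $ j) p \<omega>)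
     (normal_density 0 (1 * sqrt (\<Sum>p\<in>?I. (a $ fst p)\<^sup>2)))"
    using a gauss_entry
    by (intro linear_combination_indep_normal indep_vars_subset[OF indep_entries]) (auto simp: vec_eq_iff)
  then show ?thesis
    by (simp add: sum.reindex[OF inj] inner_vec_def column_def norm_vec_def L2_set_def)
qed

lemma nn_integral_exp_inner_column:
  "(\<integral>\<^sup>+\<omega>. ennreal (exp (a \<bullet> col j \<omega>)) \<partial>M) = ennreal (exp ((norm a)\<^sup>2 / 2))"
proof (cases "a = 0")
  case False
  have "(\<integral>\<^sup>+\<omega>. ennreal (exp (a \<bullet> col j \<omega>)) \<partial>M) = (\<integral>\<^sup>+t. ennreal (normal_density 0 (norm a) t) * ennreal (exp t) \<partial>lborel)"
    by (rule distributed_nn_integral[OF distributed_inner_column[OF False], symmetric]) measurable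
  also have "\<dots> = ennreal (exp ((norm a)\<^sup>2 / 2))"
    using nn_integral_normal_exp_linear[of "norm a" 1] False by (simp add: mult.commute)
  finally show ?thesis .
qed (simp add: emeasure_space_1)

lemma nn_integral_exp_square_inner_column:
  "(\<integral>\<^sup>+\<omega>. ennreal (exp (- 2 * (a \<bullet> col j \<omega>)\<^sup>2)) \<partial>M) = ennreal (1 / sqrt (1 + 4 * (norm a)\<^sup>2))"
proof (cases "a = 0")
  case False
  have "(\<integral>\<^sup>+\<omega>. ennreal (exp (- 2 * (a \<bullet> col j \<omega>)\<^sup>2)) \<partial>M) = (\<integral>\<^sup>+t. ennreal (normal_density 0 (norm a) t) * ennreal (exp (- 2 * t\<^sup>2)) \<partial>lborel)"
    by (rule distributed_nn_integral[OF distributed_inner_column[OF False], symmetric]) measurable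
  also have "\<dots> = ennreal (1 / sqrt (1 + 4 * (norm a)\<^sup>2))"
    using nn_integral_normal_exp_square[of "norm a" 2] False by (simp add: mult.commute add_pos_nonneg)
  finally show ?thesis .
qed (simp add: emeasure_space_1)

text \<open>The square in the exponent is linearised by an independent Gaussian vector (Hubbard--Stratonovich),
  after which the columns only enter through their moment generating function.\<close>

lemma nn_integral_exp_norm_square_column:
  fixes C :: "real^'d^'d"
  assumes CC: "transpose C ** C = diagm dd" and th: "0 \<le> \<theta>" "\<And>i. 2 * \<theta> * dd i < 1"
  shows "(\<integral>\<^sup>+\<omega>. ennreal (exp (\<theta> * (norm (transpose C *v col j \<omega>))\<^sup>2)) \<partial>M) = ennreal (\<Prod>i\<in>UNIV. 1 / sqrt (1 - 2 * \<theta> * dd i))"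
proof -
  let ?N = "gauss 1 :: (real^'d) measure"
  interpret N: prob_space ?N by (rule prob_space_gauss) simp
  interpret NM: pair_sigma_finite ?N M ..
  \<comment> \<open>Chosen so that the Gaussian average of exp(c a x) produces exactly the exponent
    \<open>\<theta>\<close> times the squared norm of a.\<close>
  define c where "c = sqrt (2 * \<theta>)"
  have c2: "c\<^sup>2 = 2 * \<theta>" using th by (simp add: c_def)
  have "(\<integral>\<^sup>+\<omega>. ennreal (exp (\<theta> * (norm (transpose C *v col j \<omega>))\<^sup>2)) \<partial>M)
      = (\<integral>\<^sup>+\<omega>. (\<integral>\<^sup>+x. ennreal (exp ((c *\<^sub>R (transpose C *v col j \<omega>)) \<bullet> x)) \<partial>?N) \<partial>M)"
    by (subst nn_integral_gauss_exp_linear) (simp_all add: power_mult_distrib c2)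
  also have "\<dots> = (\<integral>\<^sup>+\<omega>. (\<integral>\<^sup>+x. ennreal (exp ((c *\<^sub>R (C *v x)) \<bullet> col j \<omega>)) \<partial>?N) \<partial>M)"
    by (simp add: inner_commute[of "C *v _"] inner_matrix_transpose)
  also have "\<dots> = (\<integral>\<^sup>+x. (\<integral>\<^sup>+\<omega>. ennreal (exp ((c *\<^sub>R (C *v x)) \<bullet> col j \<omega>)) \<partial>M) \<partial>?N)"
  proof (rule NM.Fubini')
    have [measurable]: "(\<lambda>x. C *v x) \<in> borel_measurable ?N"
      by (simp add: measurable_cong_sets[OF sets_gauss refl] borel_measurable_continuous_onI matrix_vector_mult_linear_continuous_on)
    show "(\<lambda>(x, \<omega>). ennreal (exp ((c *\<^sub>R (C *v x)) \<bullet> col j \<omega>))) \<in> borel_measurable (?N \<Otimes>\<^sub>M M)" by measurable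
  qed
  also have "\<dots> = (\<integral>\<^sup>+x. ennreal (exp (\<Sum>i\<in>UNIV. (\<theta> * dd i) * (x $ i)\<^sup>2)) \<partial>?N)"
  proof -
    have "(norm (c *\<^sub>R (C *v x)))\<^sup>2 / 2 = (\<Sum>i\<in>UNIV. (\<theta> * dd i) * (x $ i)\<^sup>2)" for x
    proof -
      have "(norm (C *v x))\<^sup>2 = x \<bullet> (diagm dd *v x)"
        using inner_congruence[of C x "mat 1"] by (simp add: CC power2_norm_eq_inner)
      then have "(norm (c *\<^sub>R (C *v x)))\<^sup>2 / 2 = \<theta> * (\<Sum>i\<in>UNIV. dd i * (x $ i)\<^sup>2)"
        by (simp add: power_mult_distrib c2 inner_diagm)
      then show ?thesis by (simp add: sum_distrib_left mult.assoc)
    qed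
    then show ?thesis by (simp only: nn_integral_exp_inner_column)
  qed
  also have "\<dots> = ennreal (\<Prod>i\<in>UNIV. 1 / sqrt (1 - 2 * (\<theta> * dd i)))"
    using th by (intro nn_integral_gauss_exp_diag) (simp add: mult.assoc)
  finally show ?thesis by (simp add: mult.assoc)
qed

text \<open>A partition function over x drawn from a Gaussian prior. For fixed x the factor in front of the exponential
  is the reciprocal of its expectation, so the partition function has mean 1 (lemma nn_integral_smoothed);
  a null vector C v of the transpose of Om makes it large, by shifting the prior to v and applying
  Jensen's inequality (lemma smoothed_lower_bound).\<close>

definition smoothed :: "real \<Rightarrow> real^'d^'d \<Rightarrow> 'a \<Rightarrow> ennreal" where
  "smoothed \<sigma> C \<omega> = (\<integral>\<^sup>+x. ennreal (sqrt (1 + 4 * (norm (C *v x))\<^sup>2) ^ CARD('s) * exp (- 2 * (\<Sum>j\<in>UNIV. ((C *v x) \<bullet> col j \<omega>)\<^sup>2))) \<partial>gauss \<sigma>)"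

lemma matrix_vector_mult_measurable [measurable (raw)]:
  fixes C :: "real^'n^'m"
  assumes "f \<in> borel_measurable N"
  shows "(\<lambda>x. C *v f x) \<in> borel_measurable N"
  using assms by (rule measurable_compose) (intro borel_measurable_continuous_onI matrix_vector_mult_linear_continuous_on)

lemma smoothed_measurable:
  assumes "0 < \<sigma>"
  shows "smoothed \<sigma> C \<in> borel_measurable M"
proof -
  interpret N: prob_space "gauss \<sigma> :: (real^'d) measure" using assms by (rule prob_space_gauss)
  show ?thesis unfolding smoothed_def by (rule N.borel_measurable_nn_integral) measurable
qed

lemma nn_integral_smoothed:
  assumes "0 < \<sigma>"
  shows "(\<integral>\<^sup>+\<omega>. smoothed \<sigma> C \<omega> \<partial>M) = 1"
proof -
  let ?N = "gauss \<sigma> :: (real^'d) measure"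
  interpret N: prob_space ?N using assms by (rule prob_space_gauss)
  interpret NM: pair_sigma_finite ?N M ..
  have "(\<integral>\<^sup>+\<omega>. smoothed \<sigma> C \<omega> \<partial>M) = (\<integral>\<^sup>+x. (\<integral>\<^sup>+\<omega>. ennreal (sqrt (1 + 4 * (norm (C *v x))\<^sup>2) ^ CARD('s) * exp (- 2 * (\<Sum>j\<in>UNIV. ((C *v x) \<bullet> col j \<omega>)\<^sup>2))) \<partial>M) \<partial>?N)"
    unfolding smoothed_def by (rule NM.Fubini') measurable
  also have "\<dots> = (\<integral>\<^sup>+x. 1 \<partial>?N)"
  proof (rule nn_integral_cong)
    fix x :: "real^'d"
    define y where "y = C *v x"
    define D where "D = sqrt (1 + 4 * (norm y)\<^sup>2)"
    have D: "D > 0" by (simp add: D_def add_pos_nonneg)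
    have "(\<integral>\<^sup>+\<omega>. ennreal (D ^ CARD('s) * exp (- 2 * (\<Sum>j\<in>UNIV. (y \<bullet> col j \<omega>)\<^sup>2))) \<partial>M)
       = (\<integral>\<^sup>+\<omega>. ennreal (D ^ CARD('s)) * (\<Prod>j\<in>UNIV. ennreal (exp (- 2 * (y \<bullet> col j \<omega>)\<^sup>2))) \<partial>M)"
      using D by (simp add: ennreal_mult' sum_distrib_left exp_sum prod_ennreal)
    also have "\<dots> = ennreal (D ^ CARD('s)) * (\<integral>\<^sup>+\<omega>. (\<Prod>j\<in>UNIV. ennreal (exp (- 2 * (y \<bullet> col j \<omega>)\<^sup>2))) \<partial>M)"
      by (rule nn_integral_cmult) measurable
    also have "(\<integral>\<^sup>+\<omega>. (\<Prod>j\<in>UNIV. ennreal (exp (- 2 * (y \<bullet> col j \<omega>)\<^sup>2))) \<partial>M) = (\<Prod>j\<in>(UNIV::'s set). \<integral>\<^sup>+\<omega>. ennreal (exp (- 2 * (y \<bullet> col j \<omega>)\<^sup>2)) \<partial>M)"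
      by (rule nn_integral_prod_columns) measurable
    also have "\<dots> = ennreal ((1 / D) ^ CARD('s))"
      unfolding nn_integral_exp_square_inner_column D_def[symmetric] using D by (simp add: ennreal_power)
    also have "ennreal (D ^ CARD('s)) * \<dots> = 1"
      using D by (simp add: ennreal_mult'[symmetric] power_one_over)
    finally show "(\<integral>\<^sup>+\<omega>. ennreal (sqrt (1 + 4 * (norm (C *v x))\<^sup>2) ^ CARD('s) * exp (- 2 * (\<Sum>j\<in>UNIV. ((C *v x) \<bullet> col j \<omega>)\<^sup>2))) \<partial>M) = 1"
      by (simp add: y_def D_def)
  qed
  also have "\<dots> = 1" using N.emeasure_space_1 by simp
  finally show ?thesis .
qed

lemma smoothed_lower_bound:
  fixes C :: "real^'d^'d"
  assumes s: "0 < \<sigma>" and orth: "\<And>j. col j \<omega> \<bullet> (C *v v) = 0" and unit: "norm (C *v v) = 1"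
    and contr: "\<And>y. norm (transpose C *v y) \<le> norm y"
  shows "ennreal (exp (real CARD('s) / 2 * (ln 5 - \<sigma>\<^sup>2 / 2) - 2 * \<sigma>\<^sup>2 * (\<Sum>j\<in>UNIV. (norm (transpose C *v col j \<omega>))\<^sup>2) - (norm v)\<^sup>2 / (2 * \<sigma>\<^sup>2)))
     \<le> smoothed \<sigma> C \<omega>"
proof -
  let ?N = "gauss \<sigma> :: (real^'d) measure"
  let ?s = "real CARD('s)"
  interpret N: prob_space ?N using s by (rule prob_space_gauss)
  define y where "y = C *v v"
  define w where "w = transpose C *v y"
  define t where "t j = transpose C *v col j \<omega>" for j
  define F where "F x = sqrt (1 + 4 * (norm (C *v x))\<^sup>2) ^ CARD('s) * exp (- 2 * (\<Sum>j\<in>UNIV. ((C *v x) \<bullet> col j \<omega>)\<^sup>2))" for x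
  \<comment> \<open>A quadratic minorant of the whole exponent after the shift: the logarithm of the
    normalising factor is replaced by its Taylor bound, and the Cameron--Martin exponent is
    included.\<close>
  define G where "G x = ?s / 2 * (ln 5 + 8/5 * (w \<bullet> x) - (w \<bullet> x)\<^sup>2 / 2) - 2 * (\<Sum>j\<in>UNIV. (t j \<bullet> x)\<^sup>2)
      + (- (v \<bullet> x) / \<sigma>\<^sup>2 - (norm v)\<^sup>2 / (2 * \<sigma>\<^sup>2))" for x
  have Fm: "F \<in> borel_measurable borel" unfolding F_def by measurable
  have F0: "F x \<ge> 0" for x by (simp add: F_def)
  note mom = gauss_linear_moments[OF s]
  have Gi: "integrable ?N G" unfolding G_def
    by (intro Bochner_Integration.integrable_add Bochner_Integration.integrable_diff integrable_mult_right integrable_mult_left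
        Bochner_Integration.integrable_sum integrable_divide integrable_minus mom N.integrable_const)
  have EG: "N.expectation G = ?s / 2 * (ln 5 - \<sigma>\<^sup>2 * (norm w)\<^sup>2 / 2) - 2 * \<sigma>\<^sup>2 * (\<Sum>j\<in>UNIV. (norm (t j))\<^sup>2) - (norm v)\<^sup>2 / (2 * \<sigma>\<^sup>2)"
    unfolding G_def using N.prob_space by (simp add: mom sum_distrib_left mult.assoc)
  have "norm w \<le> 1" using contr[of y] unit by (simp add: w_def y_def)
  then have "(norm w)\<^sup>2 \<le> 1" by (simp add: power_le_one)
  then have "\<sigma>\<^sup>2 * (norm w)\<^sup>2 \<le> \<sigma>\<^sup>2 * 1" by (intro mult_left_mono) auto
  then have "?s / 2 * (ln 5 - \<sigma>\<^sup>2 / 2) \<le> ?s / 2 * (ln 5 - \<sigma>\<^sup>2 * (norm w)\<^sup>2 / 2)" by (intro mult_left_mono) auto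
  then have "?s / 2 * (ln 5 - \<sigma>\<^sup>2 / 2) - 2 * \<sigma>\<^sup>2 * (\<Sum>j\<in>UNIV. (norm (t j))\<^sup>2) - (norm v)\<^sup>2 / (2 * \<sigma>\<^sup>2) \<le> N.expectation G"
    unfolding EG by simp
  then have "ennreal (exp (?s / 2 * (ln 5 - \<sigma>\<^sup>2 / 2) - 2 * \<sigma>\<^sup>2 * (\<Sum>j\<in>UNIV. (norm (t j))\<^sup>2) - (norm v)\<^sup>2 / (2 * \<sigma>\<^sup>2))) \<le> ennreal (exp (N.expectation G))"
    by (intro ennreal_leI) simp
  also have "\<dots> \<le> (\<integral>\<^sup>+x. ennreal (exp (G x)) \<partial>?N)" using Gi by (rule N.exp_expectation_le_nn_integral)
  also have "\<dots> \<le> (\<integral>\<^sup>+x. ennreal (F (v + x)) * ennreal (exp (- (v \<bullet> x) / \<sigma>\<^sup>2 - (norm v)\<^sup>2 / (2 * \<sigma>\<^sup>2))) \<partial>?N)"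
  proof (rule nn_integral_mono)
    fix x
    \<comment> \<open>The shift is invisible to the columns, so only the fluctuation x is penalised.
      The norm in the normalising factor is reduced to one dimension below, by Cauchy--Schwarz
      against \<open>y\<close>.\<close>
    have tx: "(C *v (v + x)) \<bullet> col j \<omega> = t j \<bullet> x" for j
    proof -
      have "(C *v (v + x)) \<bullet> col j \<omega> = col j \<omega> \<bullet> (C *v v) + col j \<omega> \<bullet> (C *v x)"
        by (simp add: matrix_vector_right_distrib inner_simps inner_commute)
      then show ?thesis using orth[of j] by (simp add: t_def inner_matrix_transpose)
    qed
    have yx: "y \<bullet> (C *v (v + x)) = 1 + w \<bullet> x"
    proof -
      have "y \<bullet> (C *v (v + x)) = y \<bullet> y + y \<bullet> (C *v x)"
        by (simp add: matrix_vector_right_distrib inner_simps y_def)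
      moreover have "y \<bullet> y = 1" using unit by (simp add: y_def dot_square_norm)
      ultimately show ?thesis by (simp add: w_def inner_matrix_transpose)
    qed
    have "\<bar>1 + w \<bullet> x\<bar> \<le> norm (C *v (v + x))"
      using Cauchy_Schwarz_ineq2[of y "C *v (v + x)"] unit yx by (simp add: y_def)
    then have "(1 + w \<bullet> x)\<^sup>2 \<le> (norm (C *v (v + x)))\<^sup>2" by (simp add: abs_le_square_iff[symmetric])
    then have "ln (1 + 4 * (1 + w \<bullet> x)\<^sup>2) \<le> ln (1 + 4 * (norm (C *v (v + x)))\<^sup>2)"
      by (subst ln_le_cancel_iff) (auto simp: add_pos_nonneg)
    with ln_one_plus_four_square_ge[of "w \<bullet> x"]
    have l: "ln 5 + 8/5 * (w \<bullet> x) - (w \<bullet> x)\<^sup>2 / 2 \<le> ln (1 + 4 * (norm (C *v (v + x)))\<^sup>2)" by linarith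
    have pos: "0 < 1 + 4 * (norm (C *v (v + x)))\<^sup>2" by (simp add: add_pos_nonneg)
    have "sqrt (1 + 4 * (norm (C *v (v + x)))\<^sup>2) = exp (ln (1 + 4 * (norm (C *v (v + x)))\<^sup>2) / 2)"
      using pos by (simp add: ln_sqrt[symmetric])
    then have sq: "sqrt (1 + 4 * (norm (C *v (v + x)))\<^sup>2) ^ CARD('s) = exp (?s / 2 * ln (1 + 4 * (norm (C *v (v + x)))\<^sup>2))"
      by (simp add: exp_of_nat_mult[symmetric])
    have "exp (G x) = exp (?s / 2 * (ln 5 + 8/5 * (w \<bullet> x) - (w \<bullet> x)\<^sup>2 / 2)) * exp (- 2 * (\<Sum>j\<in>UNIV. (t j \<bullet> x)\<^sup>2))
        * exp (- (v \<bullet> x) / \<sigma>\<^sup>2 - (norm v)\<^sup>2 / (2 * \<sigma>\<^sup>2))"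
      unfolding G_def exp_add[symmetric] by simp
    also have "\<dots> \<le> F (v + x) * exp (- (v \<bullet> x) / \<sigma>\<^sup>2 - (norm v)\<^sup>2 / (2 * \<sigma>\<^sup>2))"
      unfolding F_def sq tx using l by (intro mult_right_mono) (auto intro!: mult_left_mono)
    finally show "ennreal (exp (G x)) \<le> ennreal (F (v + x)) * ennreal (exp (- (v \<bullet> x) / \<sigma>\<^sup>2 - (norm v)\<^sup>2 / (2 * \<sigma>\<^sup>2)))"
      using F0 by (simp add: ennreal_mult'[symmetric] ennreal_leI)
  qed
  also have "\<dots> = (\<integral>\<^sup>+x. ennreal (F x) \<partial>?N)"
    by (rule nn_integral_gauss_shift[OF s, symmetric]) (use Fm in measurable)
  also have "\<dots> = smoothed \<sigma> C \<omega>" by (simp add: smoothed_def F_def)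
  finally show ?thesis by (simp add: t_def)
qed


text \<open>Neither exceptional event mentions v, so the bound holds for all v at once and
  measurability over the continuum of v is no issue. One event controls the partition function, the
  other the trace term \<open>T\<close>; Markov's inequality gives each probability at most
  \<delta>/2.\<close>

theorem null_space_bound:
  fixes C :: "real^'d^'d"
  assumes CC: "transpose C ** C = diagm dd" and dd: "\<And>i. 0 \<le> dd i" "\<And>i. dd i \<le> 1"
    and tr: "sum dd UNIV \<le> real CARD('s) / 8" and \<delta>: "0 < \<delta>" "\<delta> < 1"
    and card: "64 * ln (16 / \<delta>) \<le> real CARD('s)"
  shows "\<exists>E\<in>events. 1 - \<delta> \<le> prob E \<and>
    (\<forall>\<omega>\<in>E. \<forall>v. (\<forall>j. col j \<omega> \<bullet> (C *v v) = 0) \<longrightarrow> 15/14 * (norm (C *v v))\<^sup>2 \<le> (norm v)\<^sup>2)"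
proof -
  define s where "s = real CARD('s)"
  \<comment> \<open>Since \<open>16 / \<delta>\<close> is at least exp 2, the sample size is at
    least 128, which absorbs all lower-order terms.\<close>
  have "exp 2 \<le> (16::real)"
  proof -
    have "exp (2::real) = (exp 1)\<^sup>2" by (simp add: exp_of_nat_mult[symmetric])
    also have "\<dots> \<le> 4\<^sup>2" using e_less_272 by (intro power_mono) auto
    finally show ?thesis by simp
  qed
  also have "\<dots> \<le> 16 / \<delta>" using \<delta> by (simp add: field_simps)
  finally have "2 \<le> ln (16 / \<delta>)" using \<delta> by (simp add: ln_ge_iff)
  then have s128: "s \<ge> 128" using card by (simp add: s_def)
  have "ln (2 / \<delta>) \<le> ln (16 / \<delta>)" using \<delta> by (subst ln_le_cancel_iff) (auto simp: divide_simps)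
  then have ln2: "ln (2 / \<delta>) \<le> s / 64" using card by (simp add: s_def)
  have ln5: "ln 5 \<ge> (8/5::real)"
  proof -
    have "exp (8/5::real) ^ 5 = exp 1 ^ 8" by (simp add: exp_of_nat_mult[symmetric])
    also have "\<dots> \<le> (272/100) ^ 8" using e_less_272 by (intro power_mono) auto
    also have "\<dots> \<le> (5::real) ^ 5" by (simp add: power_divide)
    finally have "exp (8/5::real) \<le> 5" by (rule power_le_imp_le_base[where n = 4, simplified]) simp
    then show ?thesis by (subst ln_ge_iff) simp_all
  qed
  have Cc: "norm (C *v x) \<le> norm x" for x
  proof (rule power2_le_imp_le)
    have "(norm (C *v x))\<^sup>2 = (\<Sum>i\<in>UNIV. dd i * (x $ i)\<^sup>2)"
      using inner_congruence[of C x "mat 1"] by (simp add: CC power2_norm_eq_inner inner_diagm)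
    also have "\<dots> \<le> (\<Sum>i\<in>UNIV. 1 * (x $ i)\<^sup>2)" using dd by (intro sum_mono mult_right_mono) auto
    also have "\<dots> = (norm x)\<^sup>2" by (simp add: norm_vec_def L2_set_def sum_nonneg)
    finally show "(norm (C *v x))\<^sup>2 \<le> (norm x)\<^sup>2" .
  qed simp
  have contr: "norm (transpose C *v y) \<le> norm y" for y
  proof -
    let ?w = "transpose C *v y"
    have "norm ?w * norm ?w = y \<bullet> (C *v ?w)" by (simp add: inner_matrix_transpose dot_square_norm power2_eq_square)
    also have "\<dots> \<le> norm y * norm (C *v ?w)" by (rule norm_cauchy_schwarz)
    also have "\<dots> \<le> norm y * norm ?w" by (intro mult_left_mono Cc) simp
    finally show ?thesis by (cases "?w = 0") auto
  qed
  \<comment> \<open>Its mean is s times \<open>sum dd UNIV\<close>, hence at most s^2/8; this is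
    where the effective dimension enters.\<close>
  define T where "T \<omega> = (\<Sum>j\<in>UNIV. (norm (transpose C *v col j \<omega>))\<^sup>2)" for \<omega>
  have [measurable]: "T \<in> borel_measurable M" unfolding T_def by measurable
  \<comment> \<open>The prior variance 7/(5s) nearly balances the two costs of the shift: the trace term, of order
    variance times s squared, and the Cameron--Martin term, of order 1/variance.\<close>
  define \<sigma> where "\<sigma> = sqrt (7 / (5 * s))"
  have sg: "\<sigma> > 0" "\<sigma>\<^sup>2 = 7 / (5 * s)" using s128 by (simp_all add: \<sigma>_def)
  have [measurable]: "smoothed \<sigma> C \<in> borel_measurable M" using sg(1) by (rule smoothed_measurable)
  \<comment> \<open>The rate 1/32 inflates the mean of \<open>T\<close> only by 16/15, from s^2/8 to
    2 s^2/15, and the tail costs just 32 ln(2/\<delta>), at most s/2.\<close>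
  have one: "(\<integral>\<^sup>+\<omega>. ennreal (exp (1/32 * (norm (transpose C *v col j \<omega>))\<^sup>2)) \<partial>M) \<le> ennreal (exp (s / 240))" for j
  proof -
    have "(\<Prod>i\<in>UNIV. 1 / sqrt (1 - 2 * (1/32) * dd i)) \<le> (\<Prod>i\<in>UNIV. exp (dd i / 30))"
    proof (intro prod_mono conjI)
      fix i
      have d: "0 \<le> dd i" "dd i \<le> 1" using dd by auto
      then show "0 \<le> 1 / sqrt (1 - 2 * (1/32) * dd i)" by simp
      have "1 / (1 - dd i / 16) \<le> 1 + dd i / 15" using d by (simp add: field_simps mult_left_le)
      also have "\<dots> \<le> exp (dd i / 15)" by (rule exp_ge_add_one_self)
      also have "\<dots> = (exp (dd i / 30))\<^sup>2" by (simp add: exp_of_nat_mult[symmetric])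
      finally have "sqrt (1 / (1 - dd i / 16)) \<le> exp (dd i / 30)" by (intro real_le_lsqrt) auto
      then show "1 / sqrt (1 - 2 * (1/32) * dd i) \<le> exp (dd i / 30)" by (simp add: real_sqrt_divide)
    qed
    also have "\<dots> = exp (sum dd UNIV / 30)" by (simp add: exp_sum sum_divide_distrib)
    also have "\<dots> \<le> exp (s / 240)" using tr by (simp add: s_def)
    finally have "(\<Prod>i\<in>UNIV. 1 / sqrt (1 - 2 * (1/32) * dd i)) \<le> exp (s / 240)" .
    moreover have "2 * (1/32) * dd i < 1" for i using dd(2)[of i] by simp
    ultimately show ?thesis
      by (subst nn_integral_exp_norm_square_column[OF CC]) (auto intro!: ennreal_leI)
  qed
  have ET: "(\<integral>\<^sup>+\<omega>. ennreal (exp (T \<omega> / 32)) \<partial>M) \<le> ennreal (exp (s\<^sup>2 / 240))"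
  proof -
    have "(\<integral>\<^sup>+\<omega>. ennreal (exp (T \<omega> / 32)) \<partial>M) = (\<integral>\<^sup>+\<omega>. (\<Prod>j\<in>UNIV. ennreal (exp (1/32 * (norm (transpose C *v col j \<omega>))\<^sup>2))) \<partial>M)"
      by (simp add: T_def sum_divide_distrib exp_sum prod_ennreal)
    also have "\<dots> = (\<Prod>j\<in>(UNIV::'s set). \<integral>\<^sup>+\<omega>. ennreal (exp (1/32 * (norm (transpose C *v col j \<omega>))\<^sup>2)) \<partial>M)"
      by (rule nn_integral_prod_columns) measurable
    also have "\<dots> \<le> (\<Prod>j\<in>(UNIV::'s set). ennreal (exp (s / 240)))"
      by (intro prod_mono_ennreal one)
    also have "\<dots> = ennreal (exp (s\<^sup>2 / 240))"
      by (simp add: ennreal_power exp_of_nat_mult[symmetric] s_def power2_eq_square)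
    finally show ?thesis .
  qed
  define B1 where "B1 = {\<omega>\<in>space M. 1 \<le> ennreal (\<delta> / 2) * smoothed \<sigma> C \<omega>}"
  define B2 where "B2 = {\<omega>\<in>space M. 1 \<le> ennreal (\<delta> / 2 * exp (- s\<^sup>2 / 240)) * ennreal (exp (T \<omega> / 32))}"
  have [measurable]: "B1 \<in> events" "B2 \<in> events" unfolding B1_def B2_def by measurable
  have "emeasure M B1 \<le> ennreal (\<delta> / 2) * (\<integral>\<^sup>+\<omega>. smoothed \<sigma> C \<omega> * indicator (space M) \<omega> \<partial>M)"
    unfolding B1_def by (rule nn_integral_Markov_inequality) measurable
  also have "(\<integral>\<^sup>+\<omega>. smoothed \<sigma> C \<omega> * indicator (space M) \<omega> \<partial>M) = 1"
    using nn_integral_smoothed[OF sg(1)] by (simp cong: nn_integral_cong_simp)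
  finally have p1: "prob B1 \<le> \<delta> / 2" using \<delta> by (simp add: emeasure_eq_measure)
  have "emeasure M B2 \<le> ennreal (\<delta> / 2 * exp (- s\<^sup>2 / 240)) * (\<integral>\<^sup>+\<omega>. ennreal (exp (T \<omega> / 32)) * indicator (space M) \<omega> \<partial>M)"
    unfolding B2_def by (rule nn_integral_Markov_inequality) measurable
  also have "(\<integral>\<^sup>+\<omega>. ennreal (exp (T \<omega> / 32)) * indicator (space M) \<omega> \<partial>M) = (\<integral>\<^sup>+\<omega>. ennreal (exp (T \<omega> / 32)) \<partial>M)"
    by (simp cong: nn_integral_cong_simp)
  also have "ennreal (\<delta> / 2 * exp (- s\<^sup>2 / 240)) * \<dots> \<le> ennreal (\<delta> / 2 * exp (- s\<^sup>2 / 240)) * ennreal (exp (s\<^sup>2 / 240))"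
    by (intro mult_left_mono ET) simp
  also have "\<dots> = ennreal (\<delta> / 2)"
    using \<delta> by (simp add: ennreal_mult'[symmetric] exp_minus field_simps)
  finally have p2: "prob B2 \<le> \<delta> / 2" using \<delta> by (simp add: emeasure_eq_measure)
  define E where "E = space M - (B1 \<union> B2)"
  have "E \<in> events" unfolding E_def by measurable
  moreover have "1 - \<delta> \<le> prob E"
  proof -
    have "prob (B1 \<union> B2) \<le> prob B1 + prob B2" by (rule measure_Un_le) measurable
    moreover have "prob E = 1 - prob (B1 \<union> B2)" unfolding E_def by (rule prob_compl) measurable
    ultimately show ?thesis using p1 p2 by linarith
  qed
  moreover have "15/14 * (norm (C *v v))\<^sup>2 \<le> (norm v)\<^sup>2" if w: "\<omega> \<in> E" and o: "\<And>j. col j \<omega> \<bullet> (C *v v) = 0" for \<omega> v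
  proof (rule ccontr)
    assume neg: "\<not> ?thesis"
    define n where "n = norm (C *v v)"
    have n: "n > 0"
    proof (rule ccontr)
      assume "\<not> n > 0"
      then have "norm (C *v v) = 0" by (simp add: n_def)
      then show False using neg by simp
    qed
    define v' where "v' = v /\<^sub>R n"
    have unit: "norm (C *v v') = 1" using n by (simp add: v'_def matrix_vector_mult_scaleR n_def)
    have "(norm v)\<^sup>2 < 15/14 * n\<^sup>2" using neg by (simp add: n_def)
    then have nv: "(norm v')\<^sup>2 < 15/14" using n by (simp add: v'_def power_divide divide_simps power_mult_distrib)
    have o': "col j \<omega> \<bullet> (C *v v') = 0" for j using o by (simp add: v'_def matrix_vector_mult_scaleR)
    have "\<omega> \<in> space M" using w by (simp add: E_def)
    then have nb: "\<not> 1 \<le> ennreal (\<delta> / 2) * smoothed \<sigma> C \<omega>"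
      "\<not> 1 \<le> ennreal (\<delta> / 2 * exp (- s\<^sup>2 / 240)) * ennreal (exp (T \<omega> / 32))"
      using w by (auto simp: E_def B1_def B2_def)
    \<comment> \<open>Here 2/15 is 128/960, and s at least 128 lets 7/960 of s^2 cover s/2; 135/960
      is 9/64.\<close>
    have T: "T \<omega> \<le> 9/64 * s\<^sup>2"
    proof -
      have "ennreal (\<delta> / 2 * exp (- s\<^sup>2 / 240) * exp (T \<omega> / 32)) < 1"
        using nb(2) \<delta> unfolding not_le by (subst ennreal_mult') simp_all
      then have "\<delta> / 2 * exp (- s\<^sup>2 / 240) * exp (T \<omega> / 32) < 1"
        by (simp add: ennreal_less_one_iff)
      moreover have "exp (- s\<^sup>2 / 240) * exp (T \<omega> / 32) = exp (T \<omega> / 32 - s\<^sup>2 / 240)"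
        by (simp add: mult_exp_exp)
      ultimately have "\<delta> / 2 * exp (T \<omega> / 32 - s\<^sup>2 / 240) < 1" by (simp only: mult.assoc)
      then have "exp (T \<omega> / 32 - s\<^sup>2 / 240) < 2 / \<delta>"
        using \<delta> by (simp add: pos_less_divide_eq mult.commute)
      then have "T \<omega> / 32 - s\<^sup>2 / 240 < ln (2 / \<delta>)" using \<delta> by (subst ln_exp[symmetric], subst ln_less_cancel_iff) auto
      then have "T \<omega> \<le> s / 2 + 2/15 * s\<^sup>2" using ln2 by simp
      moreover have "s / 2 \<le> 7/960 * s\<^sup>2" using s128 by (simp add: power2_eq_square)
      ultimately show ?thesis by simp
    qed
    define m where "m = s / 2 * (ln 5 - \<sigma>\<^sup>2 / 2) - 2 * \<sigma>\<^sup>2 * T \<omega> - (norm v')\<^sup>2 / (2 * \<sigma>\<^sup>2)"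
    have "ennreal (exp m) \<le> smoothed \<sigma> C \<omega>"
      using smoothed_lower_bound[OF sg(1) o' unit contr] by (simp add: m_def T_def s_def)
    then have "ennreal (\<delta> / 2) * ennreal (exp m) \<le> ennreal (\<delta> / 2) * smoothed \<sigma> C \<omega>" by (rule mult_left_mono) simp
    then have "ennreal (\<delta> / 2) * ennreal (exp m) < 1" using nb(1) by (simp only: not_le order.strict_trans1)
    then have "ennreal (\<delta> / 2 * exp m) < 1" using \<delta> by (subst ennreal_mult') simp_all
    then have "\<delta> / 2 * exp m < 1" by (simp add: ennreal_less_one_iff)
    then have "exp m < 2 / \<delta>" using \<delta> by (simp add: field_simps)
    then have "m < ln (2 / \<delta>)" using \<delta> by (subst ln_exp[symmetric], subst ln_less_cancel_iff) auto
    then have m1: "m < s / 64" using ln2 by linarith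
    have a1: "s / 2 * (ln 5 - \<sigma>\<^sup>2 / 2) \<ge> 4/5 * s - 7/20"
    proof -
      have "s / 2 * (8/5) \<le> s / 2 * ln 5" using ln5 s128 by (intro mult_left_mono) auto
      moreover have "s / 2 * (\<sigma>\<^sup>2 / 2) = 7/20" using s128 by (simp add: sg)
      ultimately show ?thesis by (simp add: right_diff_distrib)
    qed
    have a2: "2 * \<sigma>\<^sup>2 * T \<omega> \<le> 63/160 * s"
    proof -
      have "2 * \<sigma>\<^sup>2 * T \<omega> \<le> 2 * \<sigma>\<^sup>2 * (9/64 * s\<^sup>2)" using T by (intro mult_left_mono) auto
      also have "\<dots> = 63/160 * s" unfolding sg(2) using s128 by (simp add: power2_eq_square)
      finally show ?thesis .
    qed
    have a3: "(norm v')\<^sup>2 / (2 * \<sigma>\<^sup>2) \<le> 75/196 * s"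
    proof -
      have "(norm v')\<^sup>2 / (2 * \<sigma>\<^sup>2) \<le> (15/14) / (2 * \<sigma>\<^sup>2)" using nv sg(1) by (intro divide_right_mono) auto
      also have "\<dots> = 75/196 * s" using s128 by (simp add: sg)
      finally show ?thesis .
    qed
    \<comment> \<open>In units of s: 4/5 - 63/160 - 75/196 exceeds 0.023, whereas 1/64 plus 7/20
      divided by 128 stays below 0.019.\<close>
    show False using m1 a1 a2 a3 s128 unfolding m_def by linarith
  qed
  ultimately show ?thesis by blast
qed

end

section \<open>The Nystrom preconditioner\<close>

definition is_pinv :: "real^'s^'s \<Rightarrow> real^'s^'s \<Rightarrow> bool" where
  "is_pinv S X \<longleftrightarrow> S ** X ** S = S \<and> X ** S ** X = X \<and>
     transpose (S ** X) = S ** X \<and> transpose (X ** S) = X ** S"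

text \<open>\<open>S ** X\<close> and \<open>S ** Y\<close> are both the orthogonal projector onto
  the range of S, and \<open>X ** S\<close> and \<open>Y ** S\<close> both project onto the
  complement of its kernel. Uniqueness is what gives the \<open>THE\<close> in \<open>pinv\<close> a
  meaning.\<close>

lemma is_pinv_unique:
  assumes "is_pinv S X" "is_pinv S Y"
  shows "X = Y"
proof -
  have X: "S ** X ** S = S" "X ** S ** X = X" "transpose (S ** X) = S ** X" "transpose (X ** S) = X ** S"
    and Y: "S ** Y ** S = S" "Y ** S ** Y = Y" "transpose (S ** Y) = S ** Y" "transpose (Y ** S) = Y ** S"
    using assms by (auto simp: is_pinv_def)
  have "S ** X = transpose ((S ** Y ** S) ** X)" by (simp only: X Y)
  also have "\<dots> = transpose ((S ** Y) ** (S ** X))" by (simp only: matrix_mul_assoc)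
  also have "\<dots> = (S ** X) ** (S ** Y)" by (subst matrix_transpose_mul) (simp only: X Y)
  also have "\<dots> = (S ** X ** S) ** Y" by (simp only: matrix_mul_assoc)
  finally have 1: "S ** X = S ** Y" by (simp only: X)
  have "X ** S = transpose (X ** (S ** Y ** S))" by (simp only: X Y)
  also have "\<dots> = transpose ((X ** S) ** (Y ** S))" by (simp only: matrix_mul_assoc)
  also have "\<dots> = (Y ** S) ** (X ** S)" by (subst matrix_transpose_mul) (simp only: X Y)
  also have "\<dots> = Y ** (S ** X ** S)" by (simp only: matrix_mul_assoc)
  finally have 2: "X ** S = Y ** S" by (simp only: X)
  have "X = X ** (S ** X)" using X(2) by (simp only: matrix_mul_assoc)
  also have "\<dots> = (X ** S) ** Y" by (simp only: 1 matrix_mul_assoc)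
  also have "\<dots> = Y" by (simp only: 2 Y)
  finally show ?thesis .
qed

lemma is_pinv_pinv:
  fixes S :: "real^'s^'s"
  assumes sym: "transpose S = S"
  shows "is_pinv S (pinv S)"
proof -
  obtain Q l where Q: "orthogonal_matrix Q" and S: "S = Q ** diagm l ** transpose Q"
    using symmetric_diagonalizable[OF sym] .
  have QQ: "transpose Q ** Q = mat 1" using Q by (simp add: orthogonal_matrix_def)
  \<comment> \<open>Division by zero yields 0, so zero eigenvalues stay zero, as the pseudoinverse
    requires.\<close>
  define X where "X = Q ** diagm (\<lambda>i. 1 / l i) ** transpose Q"
  have mul: "(Q ** diagm f ** transpose Q) ** (Q ** diagm g ** transpose Q) = Q ** diagm (\<lambda>i. f i * g i) ** transpose Q" for f g
  proof -
    have "(Q ** diagm f ** transpose Q) ** (Q ** diagm g ** transpose Q) = Q ** diagm f ** (transpose Q ** Q) ** diagm g ** transpose Q"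
      by (simp only: matrix_mul_assoc)
    also have "\<dots> = Q ** (diagm f ** diagm g) ** transpose Q" by (simp add: QQ matrix_mul_assoc)
    finally show ?thesis by (simp only: diagm_mult_diagm)
  qed
  have tr: "transpose (Q ** diagm f ** transpose Q) = Q ** diagm f ** transpose Q" for f
    by (simp add: matrix_transpose_mul matrix_mul_assoc)
  have "(\<lambda>i. l i * (1 / l i) * l i) = l" "(\<lambda>i. 1 / l i * l i * (1 / l i)) = (\<lambda>i. 1 / l i)" by auto
  then have ex: "is_pinv S X" unfolding is_pinv_def S X_def mul tr by (simp only: simp_thms)
  have "is_pinv S (THE X. is_pinv S X)"
  proof (rule theI)
    show "Y = X" if "is_pinv S Y" for Y by (rule is_pinv_unique[OF that ex])
  qed (rule ex)
  then show ?thesis by (simp add: pinv_def is_pinv_def)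
qed

lemma transpose_pinv:
  assumes "transpose S = S" shows "transpose (pinv S) = pinv S"
proof -
  have "is_pinv S (transpose (pinv S))"
    using is_pinv_pinv[OF assms] assms unfolding is_pinv_def
    by (metis matrix_mul_assoc matrix_transpose_mul transpose_transpose)
  then show ?thesis using is_pinv_pinv[OF assms] is_pinv_unique by blast
qed

text \<open>Writing H as B times its transpose, the Nystrom approximation is B times the orthogonal projector
  onto the range of (transpose B) Om times (transpose B); w is the component outside that range.\<close>

lemma nystrom_residual:
  fixes B :: "real^'d^'d" and Om :: "real^'s^'d"
  assumes H: "H = B ** transpose B"
  obtains w where "transpose Om *v (B *v w) = 0" "v \<bullet> (H *v v) - v \<bullet> (nystrom H Om *v v) = w \<bullet> w"
    "w \<bullet> w = (B *v w) \<bullet> v" "0 \<le> v \<bullet> (nystrom H Om *v v)"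
proof -
  define K where "K = transpose B ** Om"
  define S where "S = transpose K ** K"
  define X where "X = pinv S"
  have tK: "transpose K = transpose Om ** B" by (simp add: K_def matrix_transpose_mul)
  have S: "transpose Om ** H ** Om = S" unfolding S_def tK unfolding K_def H by (simp only: matrix_mul_assoc)
  have Ss: "transpose S = S" by (simp add: S_def matrix_transpose_mul)
  have Xs: "transpose X = X" unfolding X_def by (rule transpose_pinv[OF Ss])
  have pX: "S ** X ** S = S" "X ** S ** X = X" using is_pinv_pinv[OF Ss] by (auto simp: is_pinv_def X_def)
  define Pi where "Pi = K ** X ** transpose K"
  have Pt: "transpose Pi = Pi" by (simp add: Pi_def matrix_transpose_mul Xs matrix_mul_assoc)
  have PP: "Pi ** Pi = Pi"
  proof -
    have "Pi ** Pi = K ** (X ** S ** X) ** transpose K" unfolding Pi_def S_def by (simp only: matrix_mul_assoc)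
    then show ?thesis by (simp only: pX Pi_def)
  qed
  have Hs: "transpose H = H" by (simp add: H matrix_transpose_mul)
  have N: "nystrom H Om = B ** Pi ** transpose B"
  proof -
    have "nystrom H Om = (H ** Om) ** X ** (transpose Om ** H)"
      by (simp add: nystrom_def S X_def matrix_transpose_mul Hs)
    then show ?thesis unfolding Pi_def tK unfolding K_def H by (simp only: matrix_mul_assoc)
  qed
  have SXK: "S ** X ** transpose K = transpose K"
  proof -
    have "K ** X ** S = K"
    proof -
      have "(K ** X ** S) *v y = K *v y" for y
      proof -
        \<comment> \<open>S is \<open>transpose K ** K\<close> and has the same kernel as K, which
          lets one factor be cancelled from \<open>S ** X ** S = S\<close>.\<close>
        define d where "d = (X ** S) *v y - y"
        have "S *v d = 0" using pX(1) by (simp add: d_def matrix_vector_mult_diff_distrib matrix_vector_mul_assoc matrix_mul_assoc)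
        then have "(K *v d) \<bullet> (K *v d) = 0" using inner_congruence[of K d "mat 1"] by (simp add: S_def)
        then have "K *v d = 0" by simp
        then show ?thesis by (simp add: d_def matrix_vector_mult_diff_distrib matrix_vector_mul_assoc matrix_mul_assoc)
      qed
      then show ?thesis by (simp add: matrix_eq)
    qed
    then have "transpose (K ** X ** S) = transpose K" by simp
    then show ?thesis by (simp add: matrix_transpose_mul Ss Xs matrix_mul_assoc)
  qed
  define q where "q = transpose B *v v"
  define w where "w = q - Pi *v q"
  have KP: "transpose K ** Pi = transpose K"
    unfolding Pi_def using SXK unfolding S_def by (simp only: matrix_mul_assoc)
  have "transpose K *v w = 0"
    by (simp add: w_def matrix_vector_mult_diff_distrib matrix_vector_mul_assoc KP)
  then have 1: "transpose Om *v (B *v w) = 0" by (simp add: tK matrix_vector_mul_assoc)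
  have vH: "v \<bullet> (H *v v) = q \<bullet> q" by (simp add: H q_def matrix_vector_mul_assoc[symmetric] inner_matrix_transpose)
  have vN: "v \<bullet> (nystrom H Om *v v) = q \<bullet> (Pi *v q)"
    by (simp add: N q_def matrix_vector_mul_assoc[symmetric] inner_matrix_transpose[of v B])
  have qP: "q \<bullet> (Pi *v q) = (Pi *v q) \<bullet> (Pi *v q)"
  proof -
    have "(Pi *v q) \<bullet> (Pi *v q) = q \<bullet> (Pi *v (Pi *v q))" using inner_matrix_transpose[of q Pi "Pi *v q"] by (simp add: Pt)
    then show ?thesis by (simp add: matrix_vector_mul_assoc PP)
  qed
  have ww: "w \<bullet> w = q \<bullet> q - q \<bullet> (Pi *v q)" by (simp add: w_def inner_simps inner_commute qP[symmetric])
  have wq: "w \<bullet> q = w \<bullet> w" unfolding ww by (simp add: w_def inner_simps inner_commute)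
  have "(B *v w) \<bullet> v = w \<bullet> q" by (simp add: q_def inner_commute[of "B *v w"] inner_matrix_transpose inner_commute[of w])
  then show thesis using that[OF 1] vH vN ww wq qP by simp
qed

lemma bessel:
  fixes U :: "real^'s^'d"
  assumes "transpose U ** U = mat 1"
  shows "(transpose U *v v) \<bullet> (transpose U *v v) \<le> v \<bullet> v"
proof -
  let ?y = "transpose U *v v"
  have "(v - U *v ?y) \<bullet> (v - U *v ?y) = v \<bullet> v - 2 * (v \<bullet> (U *v ?y)) + (U *v ?y) \<bullet> (U *v ?y)"
    by (simp add: inner_simps inner_commute)
  moreover have "v \<bullet> (U *v ?y) = ?y \<bullet> ?y" by (rule inner_matrix_transpose)
  moreover have "(U *v ?y) \<bullet> (U *v ?y) = ?y \<bullet> ?y"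
    using inner_congruence[of U ?y "mat 1"] by (simp add: assms)
  moreover have "(v - U *v ?y) \<bullet> (v - U *v ?y) \<ge> 0" by simp
  ultimately show ?thesis by linarith
qed

lemma shift_mult_vec: "(A + c *\<^sub>R mat 1) *v x = A *v x + c *\<^sub>R x" for A :: "real^'n^'n"
  by (simp add: matrix_vector_mult_add_rdistrib scaleR_matrix_vector_assoc[symmetric])

section \<open>The effective dimension in an eigenbasis of H\<close>

locale spectral_psd =
  fixes H Q :: "real^'d^'d" and l :: "'d \<Rightarrow> real" and rho :: real
  assumes Q: "orthogonal_matrix Q" and H: "H = Q ** diagm l ** transpose Q"
    and psd: "\<And>v. 0 \<le> v \<bullet> (H *v v)" and rho: "rho > 0"
begin

lemma QQ: "transpose Q ** Q = mat 1" "Q ** transpose Q = mat 1"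
  using Q by (auto simp: orthogonal_matrix_def)

lemma l_nonneg: "l i \<ge> 0"
proof -
  have "transpose Q ** H ** Q = (transpose Q ** Q) ** diagm l ** (transpose Q ** Q)" unfolding H by (simp only: matrix_mul_assoc)
  then have "transpose Q ** H ** Q = diagm l" by (simp add: QQ)
  then show ?thesis using psd[of "Q *v axis i 1"] unfolding inner_congruence by (simp add: inner_diagm_axis)
qed

lemma inv_shift: "matrix_inv (H + rho *\<^sub>R mat 1) = Q ** diagm (\<lambda>i. 1 / (l i + rho)) ** transpose Q"
proof (rule matrix_inv_eqI)
  have "H + rho *\<^sub>R mat 1 = Q ** diagm (\<lambda>i. l i + rho) ** transpose Q"
  proof -
    have "diagm (\<lambda>i. l i + rho) *v y = diagm l *v y + rho *\<^sub>R y" for y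
      by (simp add: diagm_mult_vec vec_eq_iff algebra_simps)
    then have "(Q ** diagm (\<lambda>i. l i + rho) ** transpose Q) *v v = H *v v + rho *\<^sub>R ((Q ** transpose Q) *v v)" for v
      by (simp add: H matrix_vector_mul_assoc[symmetric] matrix_vector_right_distrib matrix_vector_mult_scaleR)
    then show ?thesis by (simp add: matrix_eq shift_mult_vec QQ)
  qed
  then have "(H + rho *\<^sub>R mat 1) ** (Q ** diagm (\<lambda>i. 1 / (l i + rho)) ** transpose Q)
     = Q ** diagm (\<lambda>i. l i + rho) ** (transpose Q ** Q) ** diagm (\<lambda>i. 1 / (l i + rho)) ** transpose Q"
    by (simp only: matrix_mul_assoc)
  also have "\<dots> = Q ** (diagm (\<lambda>i. l i + rho) ** diagm (\<lambda>i. 1 / (l i + rho))) ** transpose Q"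
    by (simp add: QQ matrix_mul_assoc)
  also have "\<dots> = mat 1"
  proof -
    have "(l i + rho) * (1 / (l i + rho)) = 1" for i using l_nonneg[of i] rho by simp
    then show ?thesis by (simp only: diagm_mult_diagm diagm_one matrix_mul_rid QQ)
  qed
  finally show "(H + rho *\<^sub>R mat 1) ** (Q ** diagm (\<lambda>i. 1 / (l i + rho)) ** transpose Q) = mat 1" .
qed

lemma deff_eq: "deff H rho = (\<Sum>i\<in>UNIV. l i / (l i + rho))"
proof -
  have "H ** matrix_inv (H + rho *\<^sub>R mat 1) = Q ** diagm l ** (transpose Q ** Q) ** diagm (\<lambda>i. 1 / (l i + rho)) ** transpose Q"
    unfolding inv_shift by (simp only: H matrix_mul_assoc)
  also have "\<dots> = Q ** (diagm (\<lambda>i. l i / (l i + rho)) ** transpose Q)"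
    by (simp add: QQ diagm_mult_diagm flip: matrix_mul_assoc)
  finally have "deff H rho = trace (diagm (\<lambda>i. l i / (l i + rho)) ** transpose Q ** Q)"
    unfolding deff_def by (metis trace_mul_sym)
  also have "\<dots> = trace (diagm (\<lambda>i. l i / (l i + rho)))" by (simp add: matrix_mul_assoc[symmetric] QQ)
  finally show ?thesis by (simp add: trace_def diagm_def)
qed

text \<open>The smallest Nystrom eigenvalue is small because each of the s of them contributes to the effective dimension.\<close>

lemma deff_ge_min_eigenvalue:
  fixes U :: "real^'s^'d" and lam :: "'s \<Rightarrow> real"
  assumes U: "transpose U ** U = mat 1" and N: "N = U ** diagm lam ** transpose U"
    and lam: "\<And>i. lam i \<ge> 0" and NH: "\<And>v. v \<bullet> (N *v v) \<le> v \<bullet> (H *v v)"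
  shows "real CARD('s) * (Min (range lam) / (Min (range lam) + rho)) \<le> deff H rho"
proof -
  let ?m = "Min (range lam)"
  have m: "?m \<ge> 0" "\<And>k. ?m \<le> lam k" using lam by (auto simp: Min_ge_iff)
  define u where "u k = U *v axis k 1" for k
  define t where "t k = transpose Q *v u k" for k
  have uu: "u k \<bullet> u k = 1" for k using inner_congruence[of U "axis k 1" "mat 1"] by (simp add: u_def U inner_axis_axis)
  have tt: "(\<Sum>i\<in>UNIV. (t k $ i)\<^sup>2) = 1" for k
  proof -
    have "t k \<bullet> t k = u k \<bullet> u k" using inner_congruence[of "transpose Q" "u k" "mat 1"] by (simp add: t_def QQ)
    then show ?thesis using uu by (simp add: inner_vec_def power2_eq_square)
  qed
  have step: "?m / (?m + rho) \<le> (\<Sum>i\<in>UNIV. l i / (l i + rho) * (t k $ i)\<^sup>2)" for k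
  proof -
    \<comment> \<open>Comparing resolvents of N and H by hand: \<open>g\<close> is the resolvent
      form at \<open>u k\<close>, and testing H against N at x gives (lam k + rho) g^2 at most g.
      This avoids operator monotonicity of the inverse.\<close>
    define x where "x = matrix_inv (H + rho *\<^sub>R mat 1) *v u k"
    define g where "g = u k \<bullet> x"
    have inv: "(H + rho *\<^sub>R mat 1) ** matrix_inv (H + rho *\<^sub>R mat 1) = mat 1"
    proof (rule matrix_inv_mult, rule posdef_invertible)
      fix v :: "real^'d" assume "v \<noteq> 0"
      then show "0 < v \<bullet> ((H + rho *\<^sub>R mat 1) *v v)" using psd[of v] rho
        by (simp add: shift_mult_vec inner_simps add_nonneg_pos)
    qed
    have Mx: "H *v x + rho *\<^sub>R x = u k"
      unfolding shift_mult_vec[symmetric] x_def by (simp add: matrix_vector_mul_assoc inv)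
    have g1: "g = (\<Sum>i\<in>UNIV. 1 / (l i + rho) * (t k $ i)\<^sup>2)"
      unfolding g_def x_def inv_shift matrix_vector_mul_assoc[symmetric] inner_matrix_transpose[of _ Q]
      by (simp add: t_def[symmetric] inner_diagm)
    have g0: "g \<ge> 0" unfolding g1 using l_nonneg rho by (intro sum_nonneg mult_nonneg_nonneg) (auto simp: add_nonneg_pos less_imp_le)
    have gx: "g = x \<bullet> (H *v x) + rho * (x \<bullet> x)" unfolding g_def by (subst Mx[symmetric]) (simp add: inner_simps inner_commute)
    have "x \<bullet> (N *v x) = (\<Sum>i\<in>UNIV. lam i * ((transpose U *v x) $ i)\<^sup>2)"
      unfolding N matrix_vector_mul_assoc[symmetric] inner_matrix_transpose[of _ U] by (simp add: inner_diagm)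
    also have "\<dots> \<ge> lam k * ((transpose U *v x) $ k)\<^sup>2"
      by (rule member_le_sum) (auto simp: lam)
    also have "(transpose U *v x) $ k = g"
    proof -
      have "(transpose U *v x) $ k = axis k 1 \<bullet> (transpose U *v x)" by (simp add: inner_axis')
      then show ?thesis by (simp add: g_def u_def inner_matrix_transpose)
    qed
    finally have "lam k * g\<^sup>2 \<le> x \<bullet> (H *v x)" using NH[of x] by linarith
    moreover have "g\<^sup>2 \<le> x \<bullet> x" using Cauchy_Schwarz_ineq[of "u k" x] by (simp add: g_def uu)
    then have "rho * g\<^sup>2 \<le> rho * (x \<bullet> x)" using rho by (intro mult_left_mono) auto
    ultimately have "(lam k + rho) * g\<^sup>2 \<le> g" using gx by (simp add: algebra_simps)
    then have "g * ((lam k + rho) * g) \<le> g * 1" by (simp add: power2_eq_square algebra_simps)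
    then have "(lam k + rho) * g \<le> 1" using g0 by (cases "g = 0") (auto simp: mult_le_cancel_left)
    moreover have "(?m + rho) * g \<le> (lam k + rho) * g" using m g0 by (intro mult_right_mono) auto
    moreover have mr: "?m + rho > 0" using m(1) rho by linarith
    ultimately have "g \<le> 1 / (?m + rho)" by (simp only: pos_le_divide_eq[OF mr]) (simp add: mult.commute)
    then have "rho * g \<le> rho * (1 / (?m + rho))" using rho by (intro mult_left_mono) auto
    moreover have "(\<Sum>i\<in>UNIV. l i / (l i + rho) * (t k $ i)\<^sup>2) = 1 - rho * g"
    proof -
      have "l i / (l i + rho) * (t k $ i)\<^sup>2 = (t k $ i)\<^sup>2 - rho * (1 / (l i + rho) * (t k $ i)\<^sup>2)" for i
        using l_nonneg[of i] rho by (simp add: field_simps)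
      then show ?thesis by (simp add: sum_subtractf tt g1 sum_distrib_left)
    qed
    moreover have "?m / (?m + rho) = 1 - rho * (1 / (?m + rho))" using mr by (simp add: field_simps)
    ultimately show ?thesis by linarith
  qed
  have "real CARD('s) * (?m / (?m + rho)) \<le> (\<Sum>k\<in>(UNIV::'s set). \<Sum>i\<in>UNIV. l i / (l i + rho) * (t k $ i)\<^sup>2)"
    using sum_mono[of "UNIV::'s set" "\<lambda>_. ?m / (?m + rho)", OF step] by simp
  also have "\<dots> = (\<Sum>i\<in>UNIV. l i / (l i + rho) * (\<Sum>k\<in>(UNIV::'s set). (t k $ i)\<^sup>2))"
    by (subst sum.swap) (simp add: sum_distrib_left)
  \<comment> \<open>By Bessel's inequality for the orthonormal columns of U, each eigenvector of H
    receives total weight at most 1.\<close>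
  also have "\<dots> \<le> (\<Sum>i\<in>UNIV. l i / (l i + rho) * 1)"
  proof (intro sum_mono mult_left_mono)
    fix i
    let ?q = "Q *v axis i 1"
    have "t k $ i = (transpose U *v ?q) $ k" for k
    proof -
      have "t k $ i = axis i 1 \<bullet> (transpose Q *v (U *v axis k 1))" by (simp add: t_def u_def inner_axis')
      also have "\<dots> = axis k 1 \<bullet> (transpose U *v ?q)"
        using inner_matrix_transpose[of "axis i 1" "transpose Q" "U *v axis k 1"]
          inner_matrix_transpose[of "axis k 1" "transpose U" ?q] by (simp add: inner_commute)
      finally show ?thesis by (simp add: inner_axis')
    qed
    then have "(\<Sum>k\<in>(UNIV::'s set). (t k $ i)\<^sup>2) = (transpose U *v ?q) \<bullet> (transpose U *v ?q)"
      by (simp add: inner_vec_def power2_eq_square)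
    also have "\<dots> \<le> ?q \<bullet> ?q" by (rule bessel[OF U])
    also have "\<dots> = 1" using inner_congruence[of Q "axis i 1" "mat 1"] by (simp add: QQ inner_axis_axis)
    finally show "(\<Sum>k\<in>(UNIV::'s set). (t k $ i)\<^sup>2) \<le> 1" .
  qed (use l_nonneg rho in \<open>simp add: add_nonneg_pos less_imp_le\<close>)
  finally show ?thesis by (simp add: deff_eq)
qed

end

lemma nys_precond_bounds:
  fixes H :: "real^'d^'d" and U :: "real^'s^'d" and lam :: "'s \<Rightarrow> real"
  assumes U: "transpose U ** U = mat 1" and N: "N = U ** diagm lam ** transpose U"
    and lam: "\<And>i. lam i \<ge> 0" and m: "Min (range lam) \<le> rho" and rho: "rho > 0"
    and lo: "\<And>v. v \<bullet> (N *v v) \<le> v \<bullet> (H *v v)" and hi: "\<And>v. v \<bullet> (H *v v) \<le> v \<bullet> (N *v v) + 14 * rho * (v \<bullet> v)"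
  defines "P \<equiv> nys_precond U lam rho"
  shows "transpose P = P" "v \<bullet> v \<le> v \<bullet> (P *v v)"
    "rho * (v \<bullet> (P *v v)) \<le> v \<bullet> (H *v v) + rho * (v \<bullet> v)" "v \<bullet> (H *v v) + rho * (v \<bullet> v) \<le> 16 * rho * (v \<bullet> (P *v v))"
proof -
  let ?m = "Min (range lam)"
  have m0: "?m \<ge> 0" and ml: "\<And>k. ?m \<le> lam k" using lam by (auto simp: Min_ge_iff)
  have tadd: "transpose (X + Y) = transpose X + transpose Y" "transpose (X - Y) = transpose X - transpose Y"
    "transpose (c *\<^sub>R X) = c *\<^sub>R transpose X" for X Y :: "real^'d^'d" and c
    by (simp_all add: transpose_def vec_eq_iff)
  show "transpose P = P" by (simp add: P_def nys_precond_def tadd matrix_transpose_mul matrix_mul_assoc transpose_mat)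
  define y where "y = transpose U *v v"
  define yy where "yy = y \<bullet> y"
  have yv: "yy \<le> v \<bullet> v" unfolding yy_def y_def by (rule bessel[OF U])
  have yys: "yy = (\<Sum>i\<in>UNIV. (y $ i)\<^sup>2)" by (simp add: yy_def inner_vec_def power2_eq_square)
  have UU: "v \<bullet> ((U ** diagm f ** transpose U) *v v) = (\<Sum>i\<in>UNIV. f i * (y $ i)\<^sup>2)" for f
    unfolding matrix_vector_mul_assoc[symmetric] inner_matrix_transpose[of _ U] y_def[symmetric] by (simp add: inner_diagm)
  have vN: "v \<bullet> (N *v v) = (\<Sum>i\<in>UNIV. lam i * (y $ i)\<^sup>2)" unfolding N by (rule UU)
  have UUt: "v \<bullet> ((U ** transpose U) *v v) = yy"
    unfolding matrix_vector_mul_assoc[symmetric] inner_matrix_transpose[of _ U] y_def[symmetric] by (simp add: yy_def)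
  have vP: "v \<bullet> (P *v v) = (1 / (?m + rho)) * (\<Sum>i\<in>UNIV. (lam i + rho) * (y $ i)\<^sup>2) + (v \<bullet> v - yy)"
    unfolding P_def nys_precond_def
    by (simp add: matrix_vector_mult_add_rdistrib matrix_vector_mult_diff_rdistrib inner_simps UU UUt scaleR_matrix_vector_assoc[symmetric])
  have mr: "?m + rho > 0" using m0 rho by linarith
  have "(\<Sum>i\<in>UNIV. (?m + rho) * (y $ i)\<^sup>2) \<le> (\<Sum>i\<in>UNIV. (lam i + rho) * (y $ i)\<^sup>2)"
    using ml by (intro sum_mono mult_right_mono) auto
  then have "(?m + rho) * yy \<le> (\<Sum>i\<in>UNIV. (lam i + rho) * (y $ i)\<^sup>2)" by (simp add: yys sum_distrib_left)
  then have "yy \<le> (1 / (?m + rho)) * (\<Sum>i\<in>UNIV. (lam i + rho) * (y $ i)\<^sup>2)" using mr by (simp add: field_simps)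
  then show vvP: "v \<bullet> v \<le> v \<bullet> (P *v v)" unfolding vP by linarith
  have "(\<Sum>i\<in>UNIV. (lam i + rho) * (y $ i)\<^sup>2) = v \<bullet> (N *v v) + rho * yy"
    by (simp add: vN yys distrib_right sum.distrib sum_distrib_left)
  then have mP: "(?m + rho) * (v \<bullet> (P *v v)) = v \<bullet> (N *v v) + rho * (v \<bullet> v) + ?m * (v \<bullet> v - yy)"
    unfolding vP using mr by (simp add: field_simps)
  let ?M = "v \<bullet> (H *v v) + rho * (v \<bullet> v)"
  have N0: "v \<bullet> (N *v v) \<ge> 0" unfolding vN by (intro sum_nonneg mult_nonneg_nonneg) (auto simp: lam)
  have "?m * (v \<bullet> v - yy) \<le> ?m * (v \<bullet> v)" using m0 by (intro mult_left_mono) (auto simp: yy_def)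
  then have "(?m + rho) * (v \<bullet> (P *v v)) \<le> ?M + ?m * (v \<bullet> v)" using mP lo[of v] by linarith
  then have "rho * ((?m + rho) * (v \<bullet> (P *v v))) \<le> rho * (?M + ?m * (v \<bullet> v))" using rho by (intro mult_left_mono) auto
  also have "\<dots> \<le> (?m + rho) * ?M"
  proof -
    have "?m * (rho * (v \<bullet> v)) \<le> ?m * ?M" using m0 N0 lo[of v] by (intro mult_left_mono) auto
    then show ?thesis by (simp add: algebra_simps)
  qed
  finally have "(?m + rho) * (rho * (v \<bullet> (P *v v))) \<le> (?m + rho) * ?M" by (simp add: algebra_simps)
  then show "rho * (v \<bullet> (P *v v)) \<le> ?M" using mr by (simp add: mult_le_cancel_left)
  have "?m * (v \<bullet> v - yy) \<ge> 0" using m0 yv by (intro mult_nonneg_nonneg) auto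
  then have "?M \<le> (?m + rho) * (v \<bullet> (P *v v)) + 14 * rho * (v \<bullet> v)" using mP hi[of v] by linarith
  also have "\<dots> \<le> (2 * rho) * (v \<bullet> (P *v v)) + 14 * rho * (v \<bullet> (P *v v))"
  proof (intro add_mono mult_right_mono mult_left_mono)
    show "0 \<le> v \<bullet> (P *v v)" using vvP inner_ge_zero[of v] by linarith
  qed (use m rho vvP in auto)
  finally show "?M \<le> 16 * rho * (v \<bullet> (P *v v))" by simp
qed

section \<open>Inexact ADMM\<close>

definition subgrad :: "('a::real_inner \<Rightarrow> ereal) \<Rightarrow> 'a \<Rightarrow> 'a \<Rightarrow> bool" where
  "subgrad h x y \<longleftrightarrow> \<bar>h x\<bar> \<noteq> \<infinity> \<and> (\<forall>v. h x + ereal (y \<bullet> (v - x)) \<le> h v)"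

lemma subgrad_monotone:
  assumes "subgrad h x y" "subgrad h x' y'"
  shows "(x - x') \<bullet> (y - y') \<ge> 0"
proof -
  obtain a b where ab: "h x = ereal a" "h x' = ereal b"
    using assms by (auto simp: subgrad_def)
  have "h x + ereal (y \<bullet> (x' - x)) \<le> h x'" "h x' + ereal (y' \<bullet> (x - x')) \<le> h x"
    using assms by (auto simp: subgrad_def)
  then have "a + y \<bullet> (x' - x) \<le> b" "b + y' \<bullet> (x - x') \<le> a" using ab by auto
  then show ?thesis by (simp add: inner_simps inner_commute)
qed

text \<open>For fixed v the subgradient inequality says that a point depending continuously on the
  pair lies in the epigraph, so a closed epigraph does the work of lower semicontinuity.\<close>

lemma subgrad_closed_graph:
  fixes h :: "'a::real_inner \<Rightarrow> ereal"
  assumes h: "closed_fun h" "proper_fun h"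
    and X: "X \<longlonglongrightarrow> x" and Y: "Y \<longlonglongrightarrow> y" and s: "\<And>k. subgrad h (X k) (Y k)"
  shows "subgrad h x y"
proof -
  have le: "h x \<le> ereal (t - y \<bullet> (v - x))" if v: "h v = ereal t" for v t
  proof -
    have "h (X k) \<le> ereal (t - Y k \<bullet> (v - X k))" for k
    proof -
      obtain a where "h (X k) = ereal a" using s[of k] by (auto simp: subgrad_def)
      moreover have "h (X k) + ereal (Y k \<bullet> (v - X k)) \<le> h v" using s by (auto simp: subgrad_def)
      ultimately show ?thesis using v by auto
    qed
    then have "(X k, t - Y k \<bullet> (v - X k)) \<in> epigraph h" for k by (simp add: epigraph_def)
    moreover have "(\<lambda>k. (X k, t - Y k \<bullet> (v - X k))) \<longlonglongrightarrow> (x, t - y \<bullet> (v - x))"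
      by (intro tendsto_intros X Y)
    ultimately have "(x, t - y \<bullet> (v - x)) \<in> epigraph h"
      by (rule closed_sequentially[OF h(1)[unfolded closed_fun_def]])
    then show ?thesis by (simp add: epigraph_def)
  qed
  obtain v0 where "h v0 \<noteq> \<infinity>" using h(2) by (auto simp: proper_fun_def)
  then obtain t0 where "h v0 = ereal t0" using h(2) by (cases "h v0") (auto simp: proper_fun_def)
  from le[OF this] have "h x \<noteq> \<infinity>" by auto
  then obtain a where a: "h x = ereal a" using h(2) by (cases "h x") (auto simp: proper_fun_def)
  have "h x + ereal (y \<bullet> (v - x)) \<le> h v" for v
  proof (cases "h v")
    case (real t)
    from le[OF this] show ?thesis using a real by simp
  qed (use h(2) in \<open>auto simp: proper_fun_def\<close>)
  then show ?thesis using a by (simp add: subgrad_def)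
qed

lemma convex_fun_segment:
  assumes "convex_fun h" "h x = ereal a" "h v = ereal c" "0 \<le> t" "t \<le> 1"
  shows "h (x + t *\<^sub>R (v - x)) \<le> ereal (a + t * (c - a))"
proof -
  have "(x, a) \<in> epigraph h" "(v, c) \<in> epigraph h" using assms by (auto simp: epigraph_def)
  then have "(1 - t) *\<^sub>R (x, a) + t *\<^sub>R (v, c) \<in> epigraph h"
    using assms unfolding convex_fun_def convex_alt by blast
  moreover have "(1 - t) *\<^sub>R x + t *\<^sub>R v = x + t *\<^sub>R (v - x)" "(1 - t) * a + t * c = a + t * (c - a)"
    by (simp_all add: algebra_simps)
  ultimately show ?thesis by (simp add: epigraph_def)
qed

text \<open>Towards v, convexity makes h grow at most linearly, so minimality bounds the difference
  quotients of f from below. Used twice: a primal solution yields a multiplier, and the z-update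
  yields a subgradient.\<close>

lemma minimizer_smooth_plus_convex_subgrad:
  fixes h :: "'a::real_inner \<Rightarrow> ereal"
  assumes h: "convex_fun h" "proper_fun h"
    and der: "(f has_derivative (\<lambda>v. G \<bullet> v)) (at x)"
    and min: "\<And>v. ereal (f x) + h x \<le> ereal (f v) + h v"
  shows "subgrad h x (- G)"
proof -
  obtain v0 where "h v0 \<noteq> \<infinity>" using h(2) by (auto simp: proper_fun_def)
  then have "h x \<noteq> \<infinity>" using min[of v0] by auto
  then obtain a where a: "h x = ereal a" using h(2) by (cases "h x") (auto simp: proper_fun_def)
  have "h x + ereal (- G \<bullet> (v - x)) \<le> h v" for v
  proof (cases "h v")
    case (real c)
    let ?q = "\<lambda>t. (f (x + t *\<^sub>R (v - x)) - f x) / t"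
    have "((\<lambda>t. f (x + t *\<^sub>R (v - x))) has_derivative (\<lambda>t. G \<bullet> (t *\<^sub>R (v - x)))) (at 0)"
      by (rule has_derivative_compose[where g = f and f = "\<lambda>t. x + t *\<^sub>R (v - x)" , simplified])
         (auto intro!: derivative_eq_intros simp: der)
    then have "((\<lambda>t. f (x + t *\<^sub>R (v - x))) has_real_derivative (G \<bullet> (v - x))) (at 0)"
      by (simp add: has_field_derivative_def mult.commute[of _ "G \<bullet> (v - x)"] fun_eq_iff)
    from DERIV_D[OF this] have "(?q \<longlongrightarrow> G \<bullet> (v - x)) (at 0)" by simp
    then have lim: "(?q \<longlongrightarrow> G \<bullet> (v - x)) (at_right 0)"
      using filterlim_at_split by blast
    have ev: "eventually (\<lambda>t. a - c \<le> ?q t) (at_right (0::real))"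
      using eventually_at_right_less[of "0::real"] eventually_at_right_real[of 0 1, OF zero_less_one]
    proof eventually_elim
      case (elim t)
      then have t: "0 < t" "t \<le> 1" by auto
      have "ereal (f x) + ereal a \<le> ereal (f (x + t *\<^sub>R (v - x))) + h (x + t *\<^sub>R (v - x))"
        using min a by metis
      also have "\<dots> \<le> ereal (f (x + t *\<^sub>R (v - x))) + ereal (a + t * (c - a))"
        using convex_fun_segment[OF h(1) a real, of t] t by (intro add_left_mono) auto
      finally have "f x + a \<le> f (x + t *\<^sub>R (v - x)) + (a + t * (c - a))" by simp
      then show ?case using t by (simp add: field_simps)
    qed
    have "a - c \<le> G \<bullet> (v - x)" by (rule tendsto_lowerbound[OF lim ev]) simp
    then show ?thesis using a real by simp
  qed (use h(2) in \<open>auto simp: proper_fun_def\<close>)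
  then show ?thesis using a by (simp add: subgrad_def)
qed

lemma fconj_subgrad:
  assumes "subgrad h x y" "h x = ereal a"
  shows "fconj h y = ereal (y \<bullet> x - a)"
  unfolding fconj_def
proof (rule antisym)
  show "(SUP v. ereal (y \<bullet> v) - h v) \<le> ereal (y \<bullet> x - a)"
  proof (rule SUP_least)
    fix v
    have "h x + ereal (y \<bullet> (v - x)) \<le> h v" using assms by (auto simp: subgrad_def)
    then show "ereal (y \<bullet> v) - h v \<le> ereal (y \<bullet> x - a)"
      using assms(2) by (cases "h v") (auto simp: inner_simps)
  qed
  show "ereal (y \<bullet> x - a) \<le> (SUP v. ereal (y \<bullet> v) - h v)"
    using assms(2) by (intro SUP_upper2[of x]) auto
qed

text \<open>Both conjugates are attained at x for this y. For any other \<open>y'\<close>,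
  evaluating both suprema at the same x makes the \<open>y'\<close> terms cancel, so no duality
  theorem is involved.\<close>

lemma primal_dual_sol_of_subgrad:
  assumes f: "subgrad (\<lambda>x. ereal (fsmooth A b g x)) x (- y)" and h: "subgrad h x y"
  shows "is_primal_sol A b g h x" "is_dual_sol A b g h y"
proof -
  obtain a where a: "h x = ereal a" using h by (auto simp: subgrad_def)
  let ?f = "fsmooth A b g"
  show "is_primal_sol A b g h x"
    unfolding is_primal_sol_def primal_obj_def
  proof
    fix v
    have "h x + ereal (y \<bullet> (v - x)) \<le> h v" "ereal (?f x) + ereal (- y \<bullet> (v - x)) \<le> ereal (?f v)"
      using f h by (auto simp: subgrad_def)
    then show "ereal (?f x) + h x \<le> ereal (?f v) + h v" using a by (cases "h v") auto
  qed
  have 1: "fconj (\<lambda>x. ereal (?f x)) (- y) = ereal (- y \<bullet> x - ?f x)" by (rule fconj_subgrad[OF f]) simp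
  have 2: "fconj h y = ereal (y \<bullet> x - a)" by (rule fconj_subgrad[OF h a])
  show "is_dual_sol A b g h y" unfolding is_dual_sol_def dual_obj_def
  proof
    fix y'
    have "ereal (- y' \<bullet> x - ?f x) \<le> fconj (\<lambda>x. ereal (?f x)) (- y')"
      unfolding fconj_def by (rule SUP_upper2[of x]) auto
    moreover have "ereal (y' \<bullet> x - a) \<le> fconj h y'"
      unfolding fconj_def using a by (intro SUP_upper2[of x]) auto
    ultimately have "ereal (- y' \<bullet> x - ?f x) + ereal (y' \<bullet> x - a) \<le> fconj (\<lambda>x. ereal (?f x)) (- y') + fconj h y'"
      by (rule add_mono)
    then show "- (fconj (\<lambda>x. ereal (?f x)) (- y') + fconj h y') \<le> - (fconj (\<lambda>x. ereal (?f x)) (- y) + fconj h y)"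
      unfolding 1 2 by (cases "fconj (\<lambda>x. ereal (?f x)) (- y') + fconj h y'") (auto simp: inner_simps)
  qed
qed

section \<open>Convergence of the perturbed iteration\<close>

lemma convergent_almost_decreasing:
  fixes a e :: "nat \<Rightarrow> real"
  assumes "\<And>k. 0 \<le> a k" "\<And>k. a (Suc k) \<le> a k + e k" "\<And>k. 0 \<le> e k" "summable e"
  shows "convergent a"
proof -
  define c where "c k = a k - (\<Sum>i<k. e i)" for k
  have "decseq c" using assms(2) by (intro decseq_SucI) (auto simp: c_def algebra_simps)
  moreover have "c k \<ge> - suminf e" for k
    using assms(1)[of k] sum_le_suminf[OF assms(4), of "{..<k}"] assms(3) by (simp add: c_def)
  ultimately obtain L where "c \<longlonglongrightarrow> L" using decseq_convergent by metis
  then have "(\<lambda>k. c k + (\<Sum>i<k. e i)) \<longlonglongrightarrow> L + suminf e"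
    using assms(4) by (intro tendsto_add summable_LIMSEQ)
  then show ?thesis by (auto simp: c_def convergent_def)
qed

text \<open>In the variable z + u, ADMM is a Douglas--Rachford iteration.\<close>

lemma admm_step_firmly_nonexpansive:
  fixes H :: "real^'d^'d"
  assumes psd: "\<And>v. 0 \<le> v \<bullet> (H *v v)" and rho: "rho > 0"
    and x: "H *v x + rho *\<^sub>R x = c + rho *\<^sub>R (z - u)"
    and x': "H *v x' + rho *\<^sub>R x' = c + rho *\<^sub>R (z' - u')"
    and mono: "(z - z') \<bullet> (u - u') \<ge> 0"
  shows "(norm (x + u - (x' + u')))\<^sup>2 \<le> (norm (z + u - (z' + u')))\<^sup>2 - (norm (z - x - (z' - x')))\<^sup>2"
proof -
  define X Z Y where "X = x - x'" "Z = z - z'" "Y = u - u'"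
  have "H *v X + rho *\<^sub>R X = (H *v x + rho *\<^sub>R x) - (H *v x' + rho *\<^sub>R x')"
    by (simp add: X_Z_Y_def matrix_vector_mult_diff_distrib algebra_simps)
  also have "\<dots> = rho *\<^sub>R (Z - Y)" unfolding x x' by (simp add: X_Z_Y_def algebra_simps)
  finally have "X \<bullet> (H *v X) + rho * (X \<bullet> X) = rho * (X \<bullet> (Z - Y))"
    by (metis inner_add_right inner_scaleR_right)
  with psd[of X] have "rho * (X \<bullet> X) \<le> rho * (X \<bullet> (Z - Y))" by linarith
  then have "X \<bullet> X \<le> X \<bullet> (Z - Y)" using rho by simp
  moreover have "Z \<bullet> Y \<ge> 0" using mono by (simp add: X_Z_Y_def)
  moreover have "x + u - (x' + u') = X + Y" "z + u - (z' + u') = Z + Y" "z - x - (z' - x') = Z - X"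
    by (simp_all add: X_Z_Y_def)
  \<comment> \<open>Right side minus left side is twice
    \<open>Z \<bullet> Y + X \<bullet> (Z - Y) - X \<bullet> X\<close>.\<close>
  ultimately show ?thesis by (simp add: power2_norm_eq_inner inner_simps inner_commute)
qed

text \<open>An Opial argument. The distance from \<open>w\<close> to each optimal pair converges,
  because errors are summable. Vanishing \<open>z k - xe k\<close> makes a cluster point optimal
  itself; its distance to \<open>w\<close> converges and tends to 0 along a subsequence, hence
  altogether.\<close>

theorem inexact_admm_quadratic_convergence:
  fixes H :: "real^'d^'d" and h :: "real^'d \<Rightarrow> ereal"
  assumes psd: "\<And>v. 0 \<le> v \<bullet> (H *v v)" and rho: "rho > 0"
    and h: "closed_fun h" "proper_fun h"
    and eps: "\<And>k. 0 \<le> e k" "summable e"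
    and kkt: "H *v xs - c = - (rho *\<^sub>R us)" "subgrad h xs (rho *\<^sub>R us)"
    and sub: "\<And>k. subgrad h (z k) (rho *\<^sub>R u k)"
    and ex: "\<And>k. H *v xe k + rho *\<^sub>R xe k = c + rho *\<^sub>R (z k - u k)"
    and err: "\<And>k. norm (x (Suc k) - xe k) \<le> e k"
    and ustep: "\<And>k. u (Suc k) = u k + x (Suc k) - z (Suc k)"
  shows "\<exists>xl ul. x \<longlonglongrightarrow> xl \<and> u \<longlonglongrightarrow> ul \<and> subgrad h xl (rho *\<^sub>R ul) \<and> H *v xl - c = - (rho *\<^sub>R ul)"
proof -
  define w where "w k = z k + u k" for k
  have wS: "w (Suc k) = x (Suc k) + u k" for k by (simp add: w_def ustep)
  have mono: "(a - a') \<bullet> (q - q') \<ge> 0" if "subgrad h a (rho *\<^sub>R q)" "subgrad h a' (rho *\<^sub>R q')" for a a' q q'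
  proof -
    have "rho * ((a - a') \<bullet> (q - q')) \<ge> 0"
      using subgrad_monotone[OF that] by (simp add: inner_simps algebra_simps)
    then show ?thesis using rho by (simp add: zero_le_mult_iff)
  qed
  have fejer: "(norm (xe k + u k - (a + q)))\<^sup>2 \<le> (norm (w k - (a + q)))\<^sup>2 - (norm (z k - xe k))\<^sup>2"
    if "H *v a - c = - (rho *\<^sub>R q)" "subgrad h a (rho *\<^sub>R q)" for a q k
  proof -
    have "H *v a + rho *\<^sub>R a = c + rho *\<^sub>R (a - q)" using that(1) by (simp add: algebra_simps)
    from admm_step_firmly_nonexpansive[OF psd rho ex this mono[OF sub that(2)]] show ?thesis
      by (simp add: w_def)
  qed
  have step: "norm (w (Suc k) - p) \<le> norm (xe k + u k - p) + e k" for k p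
  proof -
    have "norm (w (Suc k) - p) \<le> norm (xe k + u k - p) + norm (x (Suc k) - xe k)"
      using norm_triangle_ineq[of "xe k + u k - p" "x (Suc k) - xe k"] by (simp add: wS algebra_simps)
    then show ?thesis using err[of k] by linarith
  qed
  have cv: "convergent (\<lambda>k. norm (w k - (a + q)))" and le: "norm (xe k + u k - (a + q)) \<le> norm (w k - (a + q))"
    if "H *v a - c = - (rho *\<^sub>R q)" "subgrad h a (rho *\<^sub>R q)" for a q k
  proof -
    show l: "norm (xe k + u k - (a + q)) \<le> norm (w k - (a + q))" for k
    proof (rule power2_le_imp_le)
      show "(norm (xe k + u k - (a + q)))\<^sup>2 \<le> (norm (w k - (a + q)))\<^sup>2"
        using fejer[OF that, of k] zero_le_power2[of "norm (z k - xe k)"] by linarith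
    qed simp
    show "convergent (\<lambda>k. norm (w k - (a + q)))"
    proof (rule convergent_almost_decreasing[OF _ _ eps])
      show "norm (w (Suc k) - (a + q)) \<le> norm (w k - (a + q)) + e k" for k
        using step[of k "a + q"] l[of k] by linarith
    qed simp
  qed
  obtain L where L: "(\<lambda>k. norm (w k - (xs + us))) \<longlonglongrightarrow> L" using cv[OF kkt] by (auto simp: convergent_def)
  have e0: "e \<longlonglongrightarrow> 0" using eps(2) by (rule summable_LIMSEQ_zero)
  \<comment> \<open>The exact step lies within \<open>e k\<close> of the next \<open>w\<close> and
    is no farther from the solution than the current one. Equal limits then leave no room for the
    decrease term in \<open>fejer\<close>.\<close>
  have L': "(\<lambda>k. norm (xe k + u k - (xs + us))) \<longlonglongrightarrow> L"
  proof (rule tendsto_sandwich[of "\<lambda>k. norm (w (Suc k) - (xs + us)) - e k"])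
    show "(\<lambda>k. norm (w (Suc k) - (xs + us)) - e k) \<longlonglongrightarrow> L"
      using tendsto_diff[OF LIMSEQ_Suc[OF L] e0] by simp
    show "\<forall>\<^sub>F k in sequentially. norm (w (Suc k) - (xs + us)) - e k \<le> norm (xe k + u k - (xs + us))"
      using step[of _ "xs + us"] by (auto simp: algebra_simps)
    show "\<forall>\<^sub>F k in sequentially. norm (xe k + u k - (xs + us)) \<le> norm (w k - (xs + us))"
      using le[OF kkt] by auto
  qed (rule L)
  have d2: "(\<lambda>k. (norm (z k - xe k))\<^sup>2) \<longlonglongrightarrow> 0"
  proof (rule tendsto_sandwich[of "\<lambda>k. 0"])
    show "(\<lambda>k. (norm (w k - (xs + us)))\<^sup>2 - (norm (xe k + u k - (xs + us)))\<^sup>2) \<longlonglongrightarrow> 0"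
      using tendsto_diff[OF tendsto_power[OF L, of 2] tendsto_power[OF L', of 2]] by simp
    show "\<forall>\<^sub>F k in sequentially. (norm (z k - xe k))\<^sup>2 \<le> (norm (w k - (xs + us)))\<^sup>2 - (norm (xe k + u k - (xs + us)))\<^sup>2"
      using fejer[OF kkt] by (auto simp: algebra_simps)
  qed auto
  then have d0: "(\<lambda>k. z k - xe k) \<longlonglongrightarrow> 0"
    using tendsto_real_sqrt[OF d2] by (simp add: tendsto_norm_zero_iff)
  \<comment> \<open>By monotonicity z and u depend nonexpansively on their sum, so bounds and limits
    for \<open>w\<close> pass to both.\<close>
  have contr: "(norm (a - a'))\<^sup>2 + (norm (q - q'))\<^sup>2 \<le> (norm (a + q - (a' + q')))\<^sup>2"
    if "subgrad h a (rho *\<^sub>R q)" "subgrad h a' (rho *\<^sub>R q')" for a a' q q'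
    using mono[OF that] by (simp add: power2_norm_eq_inner inner_simps inner_commute)
  obtain K where K: "\<And>k. norm (w k - (xs + us)) \<le> K"
    using convergent_imp_Bseq[OF cv[OF kkt]] by (auto simp: Bseq_def)
  have bd: "norm (z k - xs) \<le> K \<and> norm (u k - us) \<le> K" for k
  proof -
    have "(norm (z k - xs))\<^sup>2 + (norm (u k - us))\<^sup>2 \<le> (norm (w k - (xs + us)))\<^sup>2"
      using contr[OF sub kkt(2)] by (simp add: w_def)
    then have "(norm (z k - xs))\<^sup>2 \<le> (norm (w k - (xs + us)))\<^sup>2" "(norm (u k - us))\<^sup>2 \<le> (norm (w k - (xs + us)))\<^sup>2"
      by (smt (verit) zero_le_power2)+
    then have "norm (z k - xs) \<le> norm (w k - (xs + us))" "norm (u k - us) \<le> norm (w k - (xs + us))"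
      by (auto intro: power2_le_imp_le)
    then show ?thesis using K[of k] by linarith
  qed
  have "\<forall>k. (z k, u k) \<in> cball xs K \<times> cball us K"
    using bd by (auto simp: dist_norm norm_minus_commute)
  moreover have "compact (cball xs K \<times> cball us K)" by (intro compact_Times compact_cball)
  ultimately obtain l r where lr: "strict_mono (r::nat\<Rightarrow>nat)" "((\<lambda>k. (z k, u k)) \<circ> r) \<longlonglongrightarrow> l"
    unfolding compact_def by metis
  obtain zl ul where l: "l = (zl, ul)" by fastforce
  have zr: "(\<lambda>k. z (r k)) \<longlonglongrightarrow> zl" and ur: "(\<lambda>k. u (r k)) \<longlonglongrightarrow> ul"
    using tendsto_fst[OF lr(2)] tendsto_snd[OF lr(2)] by (auto simp: l o_def)
  have sl: "subgrad h zl (rho *\<^sub>R ul)"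
    by (rule subgrad_closed_graph[OF h zr, of "\<lambda>k. rho *\<^sub>R u (r k)"]) (auto intro!: tendsto_intros ur sub)
  have xr: "(\<lambda>k. xe (r k)) \<longlonglongrightarrow> zl"
    using tendsto_diff[OF zr LIMSEQ_subseq_LIMSEQ[OF d0 lr(1)]] by (simp add: o_def)
  have "(\<lambda>k. H *v xe (r k) + rho *\<^sub>R xe (r k)) \<longlonglongrightarrow> H *v zl + rho *\<^sub>R zl"
    by (intro tendsto_intros xr isCont_tendsto_compose[OF _ xr] linear_continuous_at matrix_vector_mul_bounded_linear)
  moreover have "(\<lambda>k. c + rho *\<^sub>R (z (r k) - u (r k))) \<longlonglongrightarrow> c + rho *\<^sub>R (zl - ul)"
    by (intro tendsto_intros zr ur)
  ultimately have "H *v zl + rho *\<^sub>R zl = c + rho *\<^sub>R (zl - ul)"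
    unfolding ex by (rule LIMSEQ_unique)
  then have kl: "H *v zl - c = - (rho *\<^sub>R ul)" by (simp add: algebra_simps)
  obtain L2 where L2: "(\<lambda>k. norm (w k - (zl + ul))) \<longlonglongrightarrow> L2" using cv[OF kl sl] by (auto simp: convergent_def)
  have "(\<lambda>k. norm (w (r k) - (zl + ul))) \<longlonglongrightarrow> norm (zl + ul - (zl + ul))"
    unfolding w_def by (intro tendsto_intros zr ur)
  moreover have "(\<lambda>k. norm (w (r k) - (zl + ul))) \<longlonglongrightarrow> L2"
    using LIMSEQ_subseq_LIMSEQ[OF L2 lr(1)] by (simp add: o_def)
  ultimately have w0: "(\<lambda>k. norm (w k - (zl + ul))) \<longlonglongrightarrow> 0"
    using L2 LIMSEQ_unique by fastforce
  have b2: "norm (z k - zl) \<le> norm (w k - (zl + ul)) \<and> norm (u k - ul) \<le> norm (w k - (zl + ul))" for k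
  proof -
    have "(norm (z k - zl))\<^sup>2 + (norm (u k - ul))\<^sup>2 \<le> (norm (w k - (zl + ul)))\<^sup>2"
      using contr[OF sub sl] by (simp add: w_def)
    then have "(norm (z k - zl))\<^sup>2 \<le> (norm (w k - (zl + ul)))\<^sup>2" "(norm (u k - ul))\<^sup>2 \<le> (norm (w k - (zl + ul)))\<^sup>2"
      by (smt (verit) zero_le_power2)+
    then show ?thesis by (auto intro: power2_le_imp_le)
  qed
  have zl: "z \<longlonglongrightarrow> zl" and ul: "u \<longlonglongrightarrow> ul"
    using b2 by (auto intro!: LIM_zero_cancel[of z] LIM_zero_cancel[of u] Lim_null_comparison[OF _ w0])
  have "xe \<longlonglongrightarrow> zl" using tendsto_diff[OF zl d0] by simp
  moreover have "(\<lambda>k. x (Suc k) - xe k) \<longlonglongrightarrow> 0"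
    by (rule Lim_null_comparison[OF _ e0]) (simp add: err)
  ultimately have "(\<lambda>k. xe k + (x (Suc k) - xe k)) \<longlonglongrightarrow> zl + 0" by (intro tendsto_add)
  then have "x \<longlonglongrightarrow> zl" by (simp add: filterlim_sequentially_Suc)
  then show ?thesis using ul sl kl by blast
qed

section \<open>The smooth part as a convex quadratic\<close>

lemma fsmooth_quadratic:
  fixes A :: "real^'d^'n" and b :: "real^'n" and g :: "real^'d \<Rightarrow> real"
  assumes g_grad: "\<And>x. (g has_derivative (\<lambda>v. gradg x \<bullet> v)) (at x)"
    and g_hess: "\<And>x. (gradg has_derivative (\<lambda>v. Hg *v v)) (at x)"
    and Hg_sym: "transpose Hg = Hg" and Hg_psd: "\<And>v. 0 \<le> v \<bullet> (Hg *v v)"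
  defines "H \<equiv> transpose A ** A + Hg" and "c \<equiv> transpose A *v b - gradg 0"
  shows "transpose H = H" "0 \<le> v \<bullet> (H *v v)" "gradg x = gradg 0 + Hg *v x"
    "(fsmooth A b g has_derivative (\<lambda>v. (H *v x - c) \<bullet> v)) (at x)"
    "subgrad (\<lambda>x. ereal (fsmooth A b g x)) x (H *v x - c)"
proof -
  have tadd: "transpose (X + Y) = transpose X + transpose Y" for X Y :: "real^'d^'d"
    by (simp add: transpose_def vec_eq_iff)
  show Hs: "transpose H = H" by (simp add: H_def tadd matrix_transpose_mul Hg_sym)
  have Hv: "H *v v = transpose A *v (A *v v) + Hg *v v" for v
    by (simp add: H_def matrix_vector_mult_add_rdistrib matrix_vector_mul_assoc)
  show psd: "0 \<le> v \<bullet> (H *v v)" for v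
    using Hg_psd[of v] by (simp add: Hv inner_simps inner_matrix_transpose[of _ "transpose A"])
  have mvd: "((\<lambda>x. B *v x) has_derivative (\<lambda>v. B *v v)) (at x)" for B :: "real^'k^'m" and x
    by (rule bounded_linear_imp_has_derivative) (rule matrix_vector_mul_bounded_linear)
  show gr: "gradg x = gradg 0 + Hg *v x" for x
  proof -
    have "((\<lambda>x. gradg x - Hg *v x) has_derivative (\<lambda>v. 0)) (at x)" for x
      using has_derivative_diff[OF g_hess[of x] mvd[of Hg x]] by simp
    then obtain k where "\<And>x. gradg x - Hg *v x = k"
      using has_derivative_zero_constant[of UNIV "\<lambda>x. gradg x - Hg *v x"] by auto
    from this[of x] this[of 0] show ?thesis by (simp add: algebra_simps)
  qed
  show der: "(fsmooth A b g has_derivative (\<lambda>v. (H *v x - c) \<bullet> v)) (at x)" for x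
  proof -
    have fs: "fsmooth A b g = (\<lambda>x. 1/2 * ((A *v x - b) \<bullet> (A *v x - b)) + g x)"
      by (simp add: fsmooth_def fun_eq_iff power2_norm_eq_inner)
    have "((\<lambda>x. A *v x - b) has_derivative (\<lambda>v. A *v v - 0)) (at x)"
      by (intro has_derivative_diff mvd has_derivative_const)
    then have "((\<lambda>x. A *v x - b) has_derivative (\<lambda>v. A *v v)) (at x)" by simp
    from has_derivative_inner[OF this this]
    have "((\<lambda>x. (A *v x - b) \<bullet> (A *v x - b)) has_derivative (\<lambda>v. 2 * ((A *v x - b) \<bullet> (A *v v)))) (at x)"
      by (simp add: inner_commute)
    from has_derivative_add[OF has_derivative_mult_right[OF this, of "1/2"] g_grad[of x]]
    have "(fsmooth A b g has_derivative (\<lambda>v. (A *v x - b) \<bullet> (A *v v) + gradg x \<bullet> v)) (at x)"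
      unfolding fs by simp
    moreover have "(A *v x - b) \<bullet> (A *v v) + gradg x \<bullet> v = (H *v x - c) \<bullet> v" for v
      by (simp add: inner_matrix_transpose Hv c_def gr[of x] matrix_vector_mult_diff_distrib inner_simps)
    ultimately show ?thesis by simp
  qed
  show "subgrad (\<lambda>x. ereal (fsmooth A b g x)) x (H *v x - c)"
  proof -
    let ?q = "\<lambda>x. 1/2 * (x \<bullet> (H *v x)) - c \<bullet> x"
    have sy: "u \<bullet> (H *v v) = v \<bullet> (H *v u)" for u v by (metis Hs inner_matrix_transpose inner_commute)
    have dq: "(?q has_derivative (\<lambda>v. (H *v x - c) \<bullet> v)) (at x)" for x
    proof -
      have "((\<lambda>x. x \<bullet> (H *v x)) has_derivative (\<lambda>v. x \<bullet> (H *v v) + v \<bullet> (H *v x))) (at x)"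
        by (rule has_derivative_inner) (auto intro: mvd)
      from has_derivative_diff[OF has_derivative_mult_right[OF this, of "1/2"] has_derivative_inner_right[OF has_derivative_ident, of c]]
      show ?thesis using sy[of x] by (simp add: inner_simps inner_commute)
    qed
    \<comment> \<open>Equal derivatives make the objective and \<open>?q\<close> differ by a
      constant, so the subgradient gap is exactly a quadratic form in \<open>v - x\<close>.\<close>
    have "((\<lambda>x. fsmooth A b g x - ?q x) has_derivative (\<lambda>v. 0)) (at x)" for x
      using has_derivative_diff[OF der[of x] dq[of x]] by simp
    then obtain k where k: "\<And>x. fsmooth A b g x - ?q x = k"
      using has_derivative_zero_constant[of UNIV "\<lambda>x. fsmooth A b g x - ?q x"] by auto
    have "fsmooth A b g x + (H *v x - c) \<bullet> (v - x) \<le> fsmooth A b g v" for v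
    proof -
      have "(v - x) \<bullet> (H *v (v - x)) = v \<bullet> (H *v v) - 2 * ((H *v x) \<bullet> v) + x \<bullet> (H *v x)"
        using sy[of x v] by (simp add: matrix_vector_mult_diff_distrib inner_simps inner_commute)
      then have "fsmooth A b g v - (fsmooth A b g x + (H *v x - c) \<bullet> (v - x)) = 1/2 * ((v - x) \<bullet> (H *v (v - x)))"
        using k[of x] k[of v] by (simp add: inner_simps inner_commute algebra_simps)
      then show ?thesis using psd[of "v - x"] by simp
    qed
    then show ?thesis by (simp add: subgrad_def)
  qed
qed

section \<open>Convergence of NysADMM\<close>

theorem theorem4p3:
  fixes A :: "real^'d::finite^'n::finite" and b :: "real^'n"
    and g :: "real^'d \<Rightarrow> real" and gradg :: "real^'d \<Rightarrow> real^'d" and Hg :: "real^'d^'d"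
    and h :: "real^'d \<Rightarrow> ereal"
    and x0 z0 u0 :: "real^'d" and rho :: real and eps :: "nat \<Rightarrow> real" and \<delta> :: real
    and R :: real
    and M :: "'a measure" and Om :: "'a \<Rightarrow> real^'s::finite^'d"
    and U :: "'a \<Rightarrow> real^'s^'d" and lam :: "'a \<Rightarrow> 's \<Rightarrow> real"
    and xt zt ut :: "'a \<Rightarrow> nat \<Rightarrow> real^'d"
  defines "H \<equiv> transpose A ** A + Hg"
  assumes g_convex: "convex_on UNIV g"
    and g_grad: "\<And>x. (g has_derivative (\<lambda>v. gradg x \<bullet> v)) (at x)"
    and g_hess: "\<And>x. (gradg has_derivative (\<lambda>v. Hg *v v)) (at x)"
    and Hg_sym: "transpose Hg = Hg" and Hg_psd: "\<And>v. 0 \<le> v \<bullet> (Hg *v v)"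
    and h_closed: "closed_fun h" and h_proper: "proper_fun h" and h_convex: "convex_fun h"
    and sol_exists: "\<exists>x. is_primal_sol A b g h x"
    and rho_pos: "rho > 0"
    and eps_pos: "\<And>k. eps k > 0" and eps_summable: "summable eps"
    and delta: "0 < \<delta>" "\<delta> < 1"
    and P: "prob_space M"
    and Om_gauss: "\<And>i j. distributed M lborel (\<lambda>\<omega>. Om \<omega> $ i $ j) (\<lambda>x. ennreal (std_normal_density x))"
    and Om_indep: "prob_space.indep_vars M (\<lambda>_. borel) (\<lambda>(i, j) \<omega>. Om \<omega> $ i $ j) UNIV"
    and s_bound: "real CARD('s) \<ge> 8 * (sqrt (deff H rho) + sqrt (8 * ln (16 / \<delta>)))^2"
    and U_orth: "\<And>\<omega>. \<omega> \<in> space M \<Longrightarrow> transpose (U \<omega>) ** U \<omega> = mat 1"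
    and U_eig: "\<And>\<omega>. \<omega> \<in> space M \<Longrightarrow>
                  nystrom H (Om \<omega>) = U \<omega> ** diagm (lam \<omega>) ** transpose (U \<omega>)"
    and init: "\<And>\<omega>. \<omega> \<in> space M \<Longrightarrow> xt \<omega> 0 = x0 \<and> zt \<omega> 0 = z0 \<and> ut \<omega> 0 = u0"
    and x_step: "\<And>\<omega> k. \<omega> \<in> space M \<Longrightarrow>
        xt \<omega> (Suc k) = pcg (H + rho *\<^sub>R mat 1) (nys_precond (U \<omega>) (lam \<omega>) rho)
                           (nys_rhs A b Hg gradg rho (xt \<omega> k) (zt \<omega> k) (ut \<omega> k))
                           (pcg_iters R (eps k) rho)"
    and z_step: "\<And>\<omega> k z. \<omega> \<in> space M \<Longrightarrow>
        h (zt \<omega> (Suc k)) + ereal (rho / 2 * (norm (xt \<omega> (Suc k) - zt \<omega> (Suc k) + ut \<omega> k))^2)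
        \<le> h z + ereal (rho / 2 * (norm (xt \<omega> (Suc k) - z + ut \<omega> k))^2)"
    and u_step: "\<And>\<omega> k. \<omega> \<in> space M \<Longrightarrow>
        ut \<omega> (Suc k) = ut \<omega> k + xt \<omega> (Suc k) - zt \<omega> (Suc k)"
    and r_bound: "\<And>\<omega> k. \<omega> \<in> space M \<Longrightarrow>
        norm (nys_rhs A b Hg gradg rho (xt \<omega> k) (zt \<omega> k) (ut \<omega> k)) \<le> R"
  shows "\<exists>E \<in> sets M. measure M E \<ge> 1 - \<delta> \<and>
           (\<forall>\<omega> \<in> E.
              (\<forall>k. norm (xt \<omega> (Suc k) -
                          matrix_inv (H + rho *\<^sub>R mat 1)
                            *v nys_rhs A b Hg gradg rho (xt \<omega> k) (zt \<omega> k) (ut \<omega> k)) \<le> eps k)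
            \<and> (\<exists>xs. is_primal_sol A b g h xs \<and> xt \<omega> \<longlonglongrightarrow> xs)
            \<and> (\<exists>ys. is_dual_sol A b g h ys \<and> (\<lambda>k. rho *\<^sub>R ut \<omega> k) \<longlonglongrightarrow> ys))"
proof -
  interpret gaussian_matrix M Om
    using P Om_gauss Om_indep by (intro gaussian_matrix.intro gaussian_matrix_axioms.intro)
  define c where "c = transpose A *v b - gradg 0"
  have quad: "transpose H = H" "\<And>v. 0 \<le> v \<bullet> (H *v v)" "\<And>x. gradg x = gradg 0 + Hg *v x"
    "\<And>x. (fsmooth A b g has_derivative (\<lambda>v. (H *v x - c) \<bullet> v)) (at x)"
    "\<And>x. subgrad (\<lambda>x. ereal (fsmooth A b g x)) x (H *v x - c)"
    unfolding H_def c_def by (rule fsmooth_quadratic[OF g_grad g_hess Hg_sym Hg_psd])+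
  have Hs: "transpose H = H" and psd: "\<And>v. 0 \<le> v \<bullet> (H *v v)" by (fact quad)+
  obtain Q l where Q: "orthogonal_matrix Q" and HQ: "H = Q ** diagm l ** transpose Q"
    using symmetric_diagonalizable[OF Hs] .
  interpret spectral_psd H Q l rho using Q HQ psd rho_pos by unfold_locales
  define s where "s = real CARD('s)"
  have d0: "deff H rho \<ge> 0" unfolding deff_eq using l_nonneg rho_pos by (intro sum_nonneg divide_nonneg_nonneg) (auto simp: less_imp_le)
  have ln0: "ln (16 / \<delta>) \<ge> 0" using delta by simp
  \<comment> \<open>Only these two consequences of the sample size are kept; the cross term of the
    square is dropped.\<close>
  have s1: "8 * deff H rho \<le> s" and s2: "64 * ln (16 / \<delta>) \<le> s"
  proof -
    define p q where "p = sqrt (deff H rho)" and "q = sqrt (8 * ln (16 / \<delta>))"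
    have pq: "p \<ge> 0" "q \<ge> 0" "p\<^sup>2 = deff H rho" "q\<^sup>2 = 8 * ln (16 / \<delta>)" using d0 ln0 by (simp_all add: p_def q_def)
    have "8 * (p + q)\<^sup>2 \<le> s" using s_bound by (simp add: p_def q_def s_def)
    moreover have "p\<^sup>2 \<le> (p + q)\<^sup>2" "q\<^sup>2 \<le> (p + q)\<^sup>2" using pq(1,2) by (auto intro!: power_mono)
    ultimately show "8 * deff H rho \<le> s" "64 * ln (16 / \<delta>) \<le> s" using pq(3,4) by linarith+
  qed
  \<comment> \<open>A square root of H(H + rho)^-1, so a Gaussian prior on x gives
    \<open>C *v x\<close> this covariance up to scale; the trace of \<open>transpose C ** C\<close>
    is the effective dimension.\<close>
  define C where "C = Q ** diagm (\<lambda>i. sqrt (l i / (l i + rho)))"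
  have lr: "0 < l i + rho" for i using l_nonneg[of i] rho_pos by simp
  have CC: "transpose C ** C = diagm (\<lambda>i. l i / (l i + rho))"
  proof -
    have "transpose C ** C = diagm (\<lambda>i. sqrt (l i / (l i + rho))) ** (transpose Q ** Q) ** diagm (\<lambda>i. sqrt (l i / (l i + rho)))"
      by (simp add: C_def matrix_transpose_mul matrix_mul_assoc)
    also have "\<dots> = diagm (\<lambda>i. sqrt (l i / (l i + rho)) * sqrt (l i / (l i + rho)))" by (simp add: QQ diagm_mult_diagm del: real_sqrt_mult_self)
    also have "(\<lambda>i. sqrt (l i / (l i + rho)) * sqrt (l i / (l i + rho))) = (\<lambda>i. l i / (l i + rho))"
      using l_nonneg lr by (simp add: less_imp_le)
    finally show ?thesis .
  qed
  obtain E where E: "E \<in> sets M" "1 - \<delta> \<le> measure M E"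
    and null: "\<And>\<omega> v. \<omega> \<in> E \<Longrightarrow> (\<And>j. col j \<omega> \<bullet> (C *v v) = 0) \<Longrightarrow> 15/14 * (norm (C *v v))\<^sup>2 \<le> (norm v)\<^sup>2"
  proof -
    have "\<exists>E\<in>sets M. 1 - \<delta> \<le> measure M E \<and>
      (\<forall>\<omega>\<in>E. \<forall>v. (\<forall>j. col j \<omega> \<bullet> (C *v v) = 0) \<longrightarrow> 15/14 * (norm (C *v v))\<^sup>2 \<le> (norm v)\<^sup>2)"
    proof (rule null_space_bound[OF CC])
      show "0 \<le> l i / (l i + rho)" "l i / (l i + rho) \<le> 1" for i using l_nonneg[of i] rho_pos by simp_all
      show "(\<Sum>i\<in>UNIV. l i / (l i + rho)) \<le> real CARD('s) / 8" using s1 by (simp add: deff_eq s_def)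
    qed (use delta s2 in \<open>simp_all add: s_def\<close>)
    then show thesis using that by blast
  qed
  define B where "B = Q ** diagm (\<lambda>i. sqrt (l i))"
  have HB: "H = B ** transpose B"
  proof -
    have "B ** transpose B = Q ** (diagm (\<lambda>i. sqrt (l i)) ** diagm (\<lambda>i. sqrt (l i))) ** transpose Q"
      by (simp add: B_def matrix_transpose_mul matrix_mul_assoc)
    then show ?thesis using l_nonneg by (simp add: HQ diagm_mult_diagm)
  qed
  let ?A = "H + rho *\<^sub>R mat 1"
  have At: "transpose ?A = ?A"
  proof -
    have "transpose (X + rho *\<^sub>R mat 1) = transpose X + rho *\<^sub>R mat 1" for X :: "real^'d^'d"
      by (auto simp: transpose_def vec_eq_iff mat_def)
    then show ?thesis by (simp add: Hs)
  qed
  have Av: "v \<bullet> (?A *v v) = v \<bullet> (H *v v) + rho * (v \<bullet> v)" for v by (simp add: shift_mult_vec inner_simps)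
  have acc: "norm (pcg ?A (nys_precond (U \<omega>) (lam \<omega>) rho) r (pcg_iters R e rho) - matrix_inv ?A *v r) \<le> e"
    if w: "\<omega> \<in> E" and e: "e > 0" and r: "norm r \<le> R" for \<omega> e r
  proof -
    have ws: "\<omega> \<in> space M" using w E(1) sets.sets_into_space by blast
    note U = U_orth[OF ws] and N = U_eig[OF ws]
    let ?N = "nystrom H (Om \<omega>)"
    have Nb: "0 \<le> v \<bullet> (?N *v v) \<and> v \<bullet> (?N *v v) \<le> v \<bullet> (H *v v) \<and> v \<bullet> (H *v v) \<le> v \<bullet> (?N *v v) + 14 * rho * (v \<bullet> v)" for v
    proof -
      obtain y where y: "transpose (Om \<omega>) *v (B *v y) = 0" "v \<bullet> (H *v v) - v \<bullet> (?N *v v) = y \<bullet> y"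
        "y \<bullet> y = (B *v y) \<bullet> v" "0 \<le> v \<bullet> (?N *v v)" by (rule nystrom_residual[OF HB])
      \<comment> \<open>Reparametrised so that \<open>C *v v' = B *v y\<close>. The squared norm of
        \<open>v'\<close> is that of \<open>B *v y\<close> plus rho times that of y, so the factor
        15/14 becomes the bound 14 rho.\<close>
      define v' where "v' = diagm (\<lambda>i. sqrt (l i + rho)) *v y"
      have Cv: "C *v v' = B *v y"
      proof -
        have "C *v v' = Q *v ((diagm (\<lambda>i. sqrt (l i / (l i + rho))) ** diagm (\<lambda>i. sqrt (l i + rho))) *v y)"
          by (simp add: C_def v'_def matrix_vector_mul_assoc matrix_mul_assoc)
        also have "diagm (\<lambda>i. sqrt (l i / (l i + rho))) ** diagm (\<lambda>i. sqrt (l i + rho)) = diagm (\<lambda>i. sqrt (l i))"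
        proof -
          have "sqrt (l i / (l i + rho)) * sqrt (l i + rho) = sqrt (l i)" for i
            using lr[of i] by (simp add: real_sqrt_divide)
          then show ?thesis by (simp only: diagm_mult_diagm)
        qed
        finally show ?thesis by (simp add: B_def matrix_vector_mul_assoc)
      qed
      have "col j \<omega> \<bullet> (C *v v') = 0" for j
      proof -
        have "(transpose (Om \<omega>) *v (B *v y)) $ j = col j \<omega> \<bullet> (B *v y)"
          by (simp add: matrix_vector_mult_def transpose_def column_def inner_vec_def)
        then show ?thesis by (simp add: Cv y(1))
      qed
      from null[OF w this] have n: "15/14 * (norm (B *v y))\<^sup>2 \<le> (norm v')\<^sup>2" by (simp add: Cv)
      have "(norm (B *v y))\<^sup>2 = (\<Sum>i\<in>UNIV. l i * (y $ i)\<^sup>2)"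
      proof -
        have "transpose B ** B = diagm (\<lambda>i. sqrt (l i)) ** (transpose Q ** Q) ** diagm (\<lambda>i. sqrt (l i))"
          by (simp add: B_def matrix_transpose_mul matrix_mul_assoc)
        then have "transpose B ** B = diagm l" using l_nonneg by (simp add: QQ diagm_mult_diagm)
        then show ?thesis using inner_congruence[of B y "mat 1"] by (simp add: power2_norm_eq_inner inner_diagm)
      qed
      moreover have "(norm v')\<^sup>2 = (\<Sum>i\<in>UNIV. (l i + rho) * (y $ i)\<^sup>2)"
        using lr by (simp add: v'_def diagm_mult_vec power2_norm_eq_inner inner_vec_def power2_eq_square[symmetric] power_mult_distrib less_imp_le)
      moreover have "(\<Sum>i\<in>UNIV. (l i + rho) * (y $ i)\<^sup>2) = (\<Sum>i\<in>UNIV. l i * (y $ i)\<^sup>2) + rho * (y \<bullet> y)"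
        by (simp add: distrib_right sum.distrib sum_distrib_left inner_vec_def power2_eq_square)
      ultimately have By: "(norm (B *v y))\<^sup>2 \<le> 14 * rho * (y \<bullet> y)" using n by simp
      \<comment> \<open>The identity \<open>y \<bullet> y = (B *v y) \<bullet> v\<close> and
        Cauchy--Schwarz transfer the bound from y to v.\<close>
      have "y \<bullet> y \<le> 14 * rho * (v \<bullet> v)"
      proof (cases "y = 0")
        case False
        then have yp: "y \<bullet> y > 0" by simp
        have "(y \<bullet> y) * (y \<bullet> y) \<le> (norm (B *v y))\<^sup>2 * (v \<bullet> v)"
          using Cauchy_Schwarz_ineq[of "B *v y" v] unfolding y(3)[symmetric] power2_norm_eq_inner by (simp only: power2_eq_square)
        also have "\<dots> \<le> (14 * rho * (y \<bullet> y)) * (v \<bullet> v)" using By by (intro mult_right_mono) auto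
        finally have "(y \<bullet> y) * (y \<bullet> y) \<le> (y \<bullet> y) * (14 * rho * (v \<bullet> v))" by (simp only: mult_ac)
        then show ?thesis using yp by (simp only: mult_le_cancel_left_pos)
      qed (use rho_pos in simp)
      moreover have "y \<bullet> y \<ge> 0" by simp
      ultimately show ?thesis using y(2,4) by linarith
    qed
    have lam0: "lam \<omega> k \<ge> 0" for k
    proof -
      have "transpose (U \<omega>) ** ?N ** U \<omega> = (transpose (U \<omega>) ** U \<omega>) ** diagm (lam \<omega>) ** (transpose (U \<omega>) ** U \<omega>)"
        unfolding N by (simp only: matrix_mul_assoc)
      then have "transpose (U \<omega>) ** ?N ** U \<omega> = diagm (lam \<omega>)" by (simp add: U)
      then show ?thesis using Nb[of "U \<omega> *v axis k 1"] unfolding inner_congruence by (simp add: inner_diagm_axis)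
    qed
    have m: "Min (range (lam \<omega>)) \<le> rho"
    proof -
      define m where "m = Min (range (lam \<omega>))"
      have m0: "m \<ge> 0" using lam0 by (simp add: m_def Min_ge_iff)
      have sp: "s > 0" by (simp add: s_def)
      have "s * (m / (m + rho)) \<le> deff H rho"
        unfolding s_def m_def by (rule deff_ge_min_eigenvalue[OF U N lam0]) (use Nb in blast)
      also have "\<dots> \<le> s * (1/8)" using s1 by simp
      finally have "m / (m + rho) \<le> 1/8" using sp by (simp only: mult_le_cancel_left_pos)
      moreover have mr: "m + rho > 0" using m0 rho_pos by linarith
      ultimately have "m \<le> 1/8 * (m + rho)" by (simp only: pos_divide_le_eq)
      then have "8 * m \<le> m + rho" by simp
      then have "m \<le> rho" using rho_pos m0 by linarith
      then show ?thesis by (simp only: m_def)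
    qed
    have lo: "\<And>v. v \<bullet> (?N *v v) \<le> v \<bullet> (H *v v)" and hi: "\<And>v. v \<bullet> (H *v v) \<le> v \<bullet> (?N *v v) + 14 * rho * (v \<bullet> v)"
      using Nb by blast+
    note pb = nys_precond_bounds[OF U N lam0 m rho_pos lo hi]
    show ?thesis
    proof (rule pcg_iters_accuracy[OF At pb(1) rho_pos e pb(2) _ _ _ r])
      show "rho * (v \<bullet> v) \<le> v \<bullet> (?A *v v)" for v using psd[of v] by (simp add: Av)
      show "rho * (v \<bullet> (nys_precond (U \<omega>) (lam \<omega>) rho *v v)) \<le> v \<bullet> (?A *v v)" for v unfolding Av by (rule pb(3))
      show "v \<bullet> (?A *v v) \<le> 16 * rho * (v \<bullet> (nys_precond (U \<omega>) (lam \<omega>) rho *v v))" for v unfolding Av by (rule pb(4))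
    qed
  qed
  obtain xstar where "is_primal_sol A b g h xstar" using sol_exists by blast
  then have star: "subgrad h xstar (- (H *v xstar - c))"
    by (intro minimizer_smooth_plus_convex_subgrad[OF h_convex h_proper quad(4)])
       (simp add: is_primal_sol_def primal_obj_def)
  \<comment> \<open>The scaled multiplier is read off the primal optimality condition, so existence
    of a dual solution need not be assumed.\<close>
  define ustar where "ustar = (1 / rho) *\<^sub>R (c - H *v xstar)"
  have ru: "rho *\<^sub>R ustar = - (H *v xstar - c)" using rho_pos by (simp add: ustar_def)
  have "(\<forall>k. norm (xt \<omega> (Suc k) - matrix_inv ?A *v nys_rhs A b Hg gradg rho (xt \<omega> k) (zt \<omega> k) (ut \<omega> k)) \<le> eps k)
      \<and> (\<exists>xs. is_primal_sol A b g h xs \<and> xt \<omega> \<longlonglongrightarrow> xs)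
      \<and> (\<exists>ys. is_dual_sol A b g h ys \<and> (\<lambda>k. rho *\<^sub>R ut \<omega> k) \<longlonglongrightarrow> ys)"
    if w: "\<omega> \<in> E" for \<omega>
  proof -
    have ws: "\<omega> \<in> space M" using w E(1) sets.sets_into_space by blast
    define xe where "xe k = matrix_inv ?A *v nys_rhs A b Hg gradg rho (xt \<omega> k) (zt \<omega> k) (ut \<omega> k)" for k
    have err: "norm (xt \<omega> (Suc k) - xe k) \<le> eps k" for k
      unfolding x_step[OF ws] xe_def by (rule acc[OF w eps_pos r_bound[OF ws]])
    \<comment> \<open>The gradient is affine, so all occurrences of x cancel and the linearised
      subproblem is the exact one.\<close>
    have rhs: "nys_rhs A b Hg gradg rho x z u = c + rho *\<^sub>R (z - u)" for x z u
      by (simp add: nys_rhs_def c_def quad(3)[of x] matrix_vector_mult_diff_distrib matrix_vector_mul_assoc algebra_simps)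
    have inv: "invertible ?A"
    proof (rule posdef_invertible)
      fix v :: "real^'d" assume "v \<noteq> 0"
      then show "0 < v \<bullet> (?A *v v)" unfolding Av using psd[of v] rho_pos by (simp add: add_nonneg_pos)
    qed
    have ex: "H *v xe k + rho *\<^sub>R xe k = c + rho *\<^sub>R (zt \<omega> k - ut \<omega> k)" for k
      unfolding shift_mult_vec[symmetric] xe_def rhs by (simp add: matrix_vector_mul_assoc matrix_inv_mult[OF inv])
    have sub: "subgrad h (zt \<omega> (Suc k)) (rho *\<^sub>R ut \<omega> (Suc k))" for k
    proof -
      define a where "a = xt \<omega> (Suc k) + ut \<omega> k"
      let ?f = "\<lambda>z. rho / 2 * (norm (xt \<omega> (Suc k) - z + ut \<omega> k))\<^sup>2"
      let ?z = "zt \<omega> (Suc k)"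
      have f: "?f = (\<lambda>z. rho / 2 * ((a - z) \<bullet> (a - z)))"
        by (simp add: a_def power2_norm_eq_inner algebra_simps)
      have "((\<lambda>z. a - z) has_derivative (\<lambda>v. - v)) (at ?z)"
        using has_derivative_diff[OF has_derivative_const has_derivative_ident, of a] by simp
      from has_derivative_mult_right[OF has_derivative_inner[OF this this], of "rho / 2"]
      have "(?f has_derivative (\<lambda>v. (- (rho *\<^sub>R (a - ?z))) \<bullet> v)) (at ?z)"
        unfolding f by (simp add: inner_simps inner_commute algebra_simps)
      \<comment> \<open>By the u-update, \<open>a - ?z\<close> is the new u, so the scaled dual
        iterate is itself the subgradient.\<close>
      then have "subgrad h ?z (- (- (rho *\<^sub>R (a - ?z))))"
        by (rule minimizer_smooth_plus_convex_subgrad[OF h_convex h_proper])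
           (use z_step[OF ws, of k] in \<open>simp add: add.commute\<close>)
      then show ?thesis by (simp add: a_def u_step[OF ws] algebra_simps)
    qed
    \<comment> \<open>Started at index 1: the subgradient relation between z and u is created by the
      updates, and arbitrary initial iterates need not satisfy it.\<close>
    have "\<exists>xl ul. (\<lambda>k. xt \<omega> (Suc k)) \<longlonglongrightarrow> xl \<and> (\<lambda>k. ut \<omega> (Suc k)) \<longlonglongrightarrow> ul \<and> subgrad h xl (rho *\<^sub>R ul) \<and> H *v xl - c = - (rho *\<^sub>R ul)"
    proof (rule inexact_admm_quadratic_convergence[OF psd rho_pos h_closed h_proper])
      show "0 \<le> eps (Suc k)" for k using eps_pos[of "Suc k"] by simp
      show "summable (\<lambda>k. eps (Suc k))" using eps_summable by (simp add: summable_Suc_iff)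
      show "H *v xstar - c = - (rho *\<^sub>R ustar)" by (simp add: ru)
      show "subgrad h xstar (rho *\<^sub>R ustar)" using star by (simp add: ru)
      show "norm (xt \<omega> (Suc (Suc k)) - xe (Suc k)) \<le> eps (Suc k)" for k by (rule err)
      show "ut \<omega> (Suc (Suc k)) = ut \<omega> (Suc k) + xt \<omega> (Suc (Suc k)) - zt \<omega> (Suc (Suc k))" for k by (rule u_step[OF ws])
    qed (rule sub ex)+
    then obtain xl ul where lim: "(\<lambda>k. xt \<omega> (Suc k)) \<longlonglongrightarrow> xl" "(\<lambda>k. ut \<omega> (Suc k)) \<longlonglongrightarrow> ul"
      and kkt: "subgrad h xl (rho *\<^sub>R ul)" "H *v xl - c = - (rho *\<^sub>R ul)" by blast
    have x: "xt \<omega> \<longlonglongrightarrow> xl" and u: "ut \<omega> \<longlonglongrightarrow> ul" using lim by (simp_all add: filterlim_sequentially_Suc)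
    have "subgrad (\<lambda>x. ereal (fsmooth A b g x)) xl (- (rho *\<^sub>R ul))" using quad(5)[of xl] kkt(2) by simp
    note sols = primal_dual_sol_of_subgrad[OF this kkt(1)]
    have "(\<lambda>k. rho *\<^sub>R ut \<omega> k) \<longlonglongrightarrow> rho *\<^sub>R ul" by (intro tendsto_intros u)
    then show ?thesis using err sols x unfolding xe_def by blast
  qed
  then show ?thesis using E by blast
qed

end
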